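(* For every language $L\subseteq\Sigma^*$ recognized by a 2D1CA, there exists a simple 2R1CA $M'$ which recognizes $L$ with no error: every $x\in L$ is accepted by $M'$ with probability $1$ and every $x\in\Sigma^*\setminus L$ is rejected by $M'$ with probability $1$.
   Context: Let $\Sigma$ be a finite alphabet, $\Gamma=\Sigma\cup\{\cent,\$\}$ with end-markers $\cent,\$\notin\Sigma$, $S=\{0,1\}$, $\mathrm{sign}(k)=0$ if $k=0$ and $1$ otherwise, and $\mu(\leftarrow)=-1,\mu(\downarrow)=0,\mu(\rightarrow)=+1$. 2D1CA: $M=(Q,\Sigma,\delta,q_0,Q_{\rm acc},Q_{\rm rej})$ with finite $Q$, initial state $q_0$, disjoint $Q_{\rm acc},Q_{\rm rej}\subset Q$, and $\delta:Q\times\Gamma\times S\to Q\times\{-1,0,+1\}\times\{\leftarrow,\downarrow,\rightarrow\}$. On input $x$ of length $n$ the circular tape holds $w_x=\cent x\$$ at positions $0,\dots,n+1$ (modulo $n+2$); start in $q_0$, counter $0$, head at $0$; from (state $q$, counter $a$, head $b$), if $\delta(q,w_x(b),\mathrm{sign}(a))=(q',c,d)$ go to $(q',a+c,b+\mu(d))$; halt upon entering $Q_{\rm acc}$ (accept) or $Q_{\rm rej}$ (reject). $M$ recognizes $L$ if on every input it halts, accepting iff $x\in L$. 2Q1CA: $M=(Q,\Sigma,\delta,q_0,Q_{\rm acc},Q_{\rm rej})$ with finite $Q$, $q_0\in Q$, disjoint $Q_{\rm acc},Q_{\rm rej}\subset Q$, and $\delta:Q\times\Gamma\times S\times Q\times\{-1,0,+1\}\times\{\leftarrow,\downarrow,\rightarrow\}\to\mathbb{C}$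 satisfying the well-formedness conditions below. For $\alpha,\beta\in\{-2,\dots,2\}$ let $W_{\alpha,\beta}(q_1,\sigma_1,s_1;q_2,\sigma_2,s_2)=\sum_{q'\in Q}\sum\overline{\delta(q_1,\sigma_1,s_1,q',c_1,d_1)}\,\delta(q_2,\sigma_2,s_2,q',c_2,d_2)$, inner sum over $(c_1,d_1),(c_2,d_2)$ with $c_2-c_1=\alpha$, $\mu(d_2)-\mu(d_1)=\beta$. Well-formedness: for all $q_1,q_2\in Q$, $\sigma,\sigma_1,\sigma_2\in\Gamma$, $s,s_1,s_2\in S$: (i) $W_{0,0}(q_1,\sigma,s;q_2,\sigma,s)=[q_1=q_2]$; (ii) $W_{0,\beta}(q_1,\sigma_1,s;q_2,\sigma_2,s)=0$ for $\beta\in\{1,2\}$; (iii) $W_{\alpha,0}(q_1,\sigma,s_1;q_2,\sigma,s_2)=0$ for $\alpha\in\{1,2\}$; (iv) $W_{\alpha,\beta}(q_1,\sigma_1,s_1;q_2,\sigma_2,s_2)=0$ for $\alpha\in\{1,2\}$, $\beta\in\{-2,-1,1,2\}$. On input $x$ of length $n$, configurations are $(q,a,b)\in Q\times\mathbb{Z}\times\{0,\dots,n+1\}$ and $U_x|q,a,b\rangle=\sum_{q',c,d}\delta(q,w_x(b),\mathrm{sign}(a),q',c,d)|q',a+c,b+\mu(d)\rangle$. Computation starts in $|q_0,0,0\rangle$; at each step $U_x$ is applied and then the state is measured w.r.t. the orthogonal decomposition into the spans of configurations whose state lies in $Q_{\rm acc}$, in $Q_{\rm rej}$, and in neither; outcomes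 "accept"/"reject" halt, otherwise the computation continues from the collapsed (renormalized) state. Acceptance (rejection) probability is the total probability of ever obtaining the outcome "accept" ("reject"). A 2R1CA is a 2Q1CA all of whose transition amplitudes $\delta(\cdot)$ lie in $\{0,1\}$. A 2Q1CA (or 2R1CA) is simple if there are linear operators $V_{\sigma,s}$ on $\ell_2(Q)$, a counter function $C:Q\times\Gamma\to\{-1,0,+1\}$ and a head function $D:Q\to\{\leftarrow,\downarrow,\rightarrow\}$ with $\delta(q,\sigma,s,q',c,d)=\langle q'|V_{\sigma,s}|q\rangle$ if $C(q',\sigma)=c$ and $D(q')=d$, and $0$ otherwise. *)

theory Defs
  imports "HOL-Analysis.Analysis"
begin

datatype 'a tsym = Cent | Dollar | Sym 'a

datatype dir = Lft | Stay | Rgt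

definition dirs :: "dir set" where "dirs = {Lft, Stay, Rgt}"

fun mu :: "dir \<Rightarrow> int" where
  "mu Lft = -1" | "mu Stay = 0" | "mu Rgt = 1"

definition sgnc :: "int \<Rightarrow> nat" where
  "sgnc k = (if k = 0 then 0 else 1)"

definition incs :: "int set" where "incs = {-1, 0, 1}"

definition tape :: "'a list \<Rightarrow> nat \<Rightarrow> 'a tsym" where
  "tape x b = (if b = 0 then Cent else if b = length x + 1 then Dollar else Sym (x ! (b - 1)))"

definition move :: "'a list \<Rightarrow> nat \<Rightarrow> int \<Rightarrow> nat" where
  "move x b m = nat ((int b + m) mod int (length x + 2))"

record ('q, 'a) dca =
  dstates :: "'q set"
  dinit :: 'q
  dacc :: "'q set"
  drej :: "'q set"
  dtrans :: "'q \<Rightarrow> 'a tsym \<Rightarrow> nat \<Rightarrow> 'q \<times> int \<times> dir"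

definition valid_dca :: "('q, 'a) dca \<Rightarrow> bool" where
  "valid_dca M \<longleftrightarrow> finite (dstates M) \<and> dinit M \<in> dstates M
     \<and> dacc M \<subseteq> dstates M \<and> drej M \<subseteq> dstates M \<and> dacc M \<inter> drej M = {}
     \<and> (\<forall>q\<in>dstates M. \<forall>\<sigma> s. s \<in> {0,1} \<longrightarrow>
          (case dtrans M q \<sigma> s of (q', c, d) \<Rightarrow> q' \<in> dstates M \<and> c \<in> incs))"

definition dstep :: "('q, 'a) dca \<Rightarrow> 'a list \<Rightarrow> 'q \<times> int \<times> nat \<Rightarrow> 'q \<times> int \<times> nat" where
  "dstep M x cf = (case cf of (q, a, b) \<Rightarrow>
     (case dtrans M q (tape x b) (sgnc a) of (q', c, d) \<Rightarrow> (q', a + c, move x b (mu d))))"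

definition dconf :: "('q, 'a) dca \<Rightarrow> 'a list \<Rightarrow> nat \<Rightarrow> 'q \<times> int \<times> nat" where
  "dconf M x t = (dstep M x ^^ t) (dinit M, 0, 0)"

definition dhalted_at :: "('q, 'a) dca \<Rightarrow> 'a list \<Rightarrow> nat \<Rightarrow> bool" where
  "dhalted_at M x t \<longleftrightarrow> t \<ge> 1 \<and> fst (dconf M x t) \<in> dacc M \<union> drej M"

definition dca_recognizes :: "('q, 'a) dca \<Rightarrow> 'a list set \<Rightarrow> bool" where
  "dca_recognizes M L \<longleftrightarrow> (\<forall>x. (\<exists>t. dhalted_at M x t) \<and>
      (x \<in> L \<longleftrightarrow> fst (dconf M x (LEAST t. dhalted_at M x t)) \<in> dacc M))"

record ('q, 'a) qca =
  qstates :: "'q set"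
  qinit :: 'q
  qacc :: "'q set"
  qrej :: "'q set"
  qtrans :: "'q \<Rightarrow> 'a tsym \<Rightarrow> nat \<Rightarrow> 'q \<Rightarrow> int \<Rightarrow> dir \<Rightarrow> complex"

definition W :: "('q, 'a) qca \<Rightarrow> int \<Rightarrow> int \<Rightarrow> 'q \<Rightarrow> 'a tsym \<Rightarrow> nat \<Rightarrow> 'q \<Rightarrow> 'a tsym \<Rightarrow> nat \<Rightarrow> complex" where
  "W M \<alpha> \<beta> q1 \<sigma>1 s1 q2 \<sigma>2 s2 =
     (\<Sum>q'\<in>qstates M. \<Sum>(c1, d1)\<in>incs \<times> dirs. \<Sum>(c2, d2)\<in>incs \<times> dirs.
        if c2 - c1 = \<alpha> \<and> mu d2 - mu d1 = \<beta>
        then cnj (qtrans M q1 \<sigma>1 s1 q' c1 d1) * qtrans M q2 \<sigma>2 s2 q' c2 d2 else 0)"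

definition well_formed :: "('q, 'a) qca \<Rightarrow> bool" where
  "well_formed M \<longleftrightarrow>
     (\<forall>q1\<in>qstates M. \<forall>q2\<in>qstates M.
       (\<forall>\<sigma> s. s \<in> {0,1} \<longrightarrow> W M 0 0 q1 \<sigma> s q2 \<sigma> s = (if q1 = q2 then 1 else 0))
     \<and> (\<forall>\<sigma>1 \<sigma>2 s \<beta>. s \<in> {0,1} \<and> \<beta> \<in> {1,2} \<longrightarrow> W M 0 \<beta> q1 \<sigma>1 s q2 \<sigma>2 s = 0)
     \<and> (\<forall>\<sigma> s1 s2 \<alpha>. s1 \<in> {0,1} \<and> s2 \<in> {0,1} \<and> \<alpha> \<in> {1,2} \<longrightarrow> W M \<alpha> 0 q1 \<sigma> s1 q2 \<sigma> s2 = 0)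
     \<and> (\<forall>\<sigma>1 \<sigma>2 s1 s2 \<alpha> \<beta>. s1 \<in> {0,1} \<and> s2 \<in> {0,1} \<and> \<alpha> \<in> {1,2} \<and> \<beta> \<in> {-2,-1,1,2}
           \<longrightarrow> W M \<alpha> \<beta> q1 \<sigma>1 s1 q2 \<sigma>2 s2 = 0))"

definition valid_qca :: "('q, 'a) qca \<Rightarrow> bool" where
  "valid_qca M \<longleftrightarrow> finite (qstates M) \<and> qinit M \<in> qstates M
     \<and> qacc M \<subseteq> qstates M \<and> qrej M \<subseteq> qstates M \<and> qacc M \<inter> qrej M = {}
     \<and> well_formed M"

text \<open>Vectors over configurations (q, a, b); the operator U_x, written via its matrix
  entries: the coefficient of |q',a',b'> in U_x psi collects all source configurations
  (q, a'-c, b) with (b + mu d) mod (n+2) = b'.\<close>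
type_synonym 'q qvec = "'q \<times> int \<times> nat \<Rightarrow> complex"

definition Ux :: "('q, 'a) qca \<Rightarrow> 'a list \<Rightarrow> 'q qvec \<Rightarrow> 'q qvec" where
  "Ux M x \<psi> = (\<lambda>(q', a', b').
     if q' \<in> qstates M \<and> b' \<le> length x + 1 then
       (\<Sum>q\<in>qstates M. \<Sum>c\<in>incs. \<Sum>d\<in>dirs.
          (let b = move x b' (- mu d) in
             \<psi> (q, a' - c, b) * qtrans M q (tape x b) (sgnc (a' - c)) q' c d))
     else 0)"

definition proj :: "'q set \<Rightarrow> 'q qvec \<Rightarrow> 'q qvec" where
  "proj S \<psi> = (\<lambda>(q, a, b). if q \<in> S then \<psi> (q, a, b) else 0)"

definition normsq :: "'q qvec \<Rightarrow> real" where
  "normsq \<psi> = infsum (\<lambda>cf. (cmod (\<psi> cf))\<^sup>2) UNIV"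

text \<open>Unnormalised state after t steps conditioned on no halting outcome so far.\<close>
primrec qvec_at :: "('q, 'a) qca \<Rightarrow> 'a list \<Rightarrow> nat \<Rightarrow> 'q qvec" where
  "qvec_at M x 0 = (\<lambda>cf. if cf = (qinit M, 0, 0) then 1 else 0)"
| "qvec_at M x (Suc t) = proj (- (qacc M \<union> qrej M)) (Ux M x (qvec_at M x t))"

text \<open>Probability of obtaining outcome accept (reject) at step t+1.\<close>
definition acc_step :: "('q, 'a) qca \<Rightarrow> 'a list \<Rightarrow> nat \<Rightarrow> real" where
  "acc_step M x t = normsq (proj (qacc M) (Ux M x (qvec_at M x t)))"

definition rej_step :: "('q, 'a) qca \<Rightarrow> 'a list \<Rightarrow> nat \<Rightarrow> real" where
  "rej_step M x t = normsq (proj (qrej M) (Ux M x (qvec_at M x t)))"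

definition is_2R1CA :: "('q, 'a) qca \<Rightarrow> bool" where
  "is_2R1CA M \<longleftrightarrow> valid_qca M \<and>
     (\<forall>q\<in>qstates M. \<forall>\<sigma> s q' c d. s \<in> {0,1} \<and> q' \<in> qstates M \<and> c \<in> incs \<and> d \<in> dirs
        \<longrightarrow> qtrans M q \<sigma> s q' c d \<in> {0, 1})"

definition is_simple :: "('q, 'a) qca \<Rightarrow> bool" where
  "is_simple M \<longleftrightarrow> (\<exists>(V :: 'a tsym \<Rightarrow> nat \<Rightarrow> 'q \<Rightarrow> 'q \<Rightarrow> complex) C D.
     (\<forall>q' \<sigma>. C q' \<sigma> \<in> incs) \<and>
     (\<forall>q\<in>qstates M. \<forall>\<sigma> s q' c d. s \<in> {0,1} \<and> q' \<in> qstates M \<and> c \<in> incs \<and> d \<in> dirs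
        \<longrightarrow> qtrans M q \<sigma> s q' c d = (if C q' \<sigma> = c \<and> D q' = d then V \<sigma> s q' q else 0)))"

end

theory Submission
  imports Defs
begin

text \<open>
  The classical way to make a deterministic machine reversible (Lange, McKenzie, Tapp) is to walk
  around the tree of predecessors of its halting configuration. This needs the tree to have no
  infinite path, which fails for counter automata: a loop that decrements the counter can be traced
  back forever, and a single zero test cannot detect that the counter has become too large.

  While the counter is nonzero, the automaton moves on the finite functional graph of pairs (state,
  head position), so an infinite backward path runs through a cycle of this graph. On every cycle
  one node is marked: the least state at the leftmost position. Before leaving a marked node with
  nonzero counter, the modified automaton tours the predecessor tree back to, but not through,
  marked nodes, and stops for good unless it meets counter value 0. A halting run always passes this
  test, because the run itself entered the cycle from a configuration with counter 0, and counters
  change by at most 1. On the other hand an infinite backward path would eventually avoid counter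
  value 0 altogether and so fail the test.

  Whether a node is marked depends on the letter under the head and on the behaviour of the automaton
  to the right of the head. The latter is the state of a right-to-left finite automaton, and by
  the technique of Hopcroft and Ullman a two-way head can carry this state along in both directions.
\<close>

section \<open>Local machines\<close>

text \<open>If counter change and head move depend only on the state entered, both amplitudes in
  each term of \<open>W\<close> share them, so well-formedness asks just that the states are
  permuted for each letter and sign. Such a machine can test a transition only at the cell where it
  applies, which is why one edge of a predecessor tree costs two phases: going to the candidate
  source, and testing there. The tour climbs the run and explores the subtrees hanging off it. Hence
  backward paths must be finite even through configurations that no run reaches. This is
  \<open>tame\<close>, and it has to survive along with the language. Tests consult the annotation
  and the tour cannot, so the annotation is eliminated in between, without creating new infinite
  backward paths. That an infinite backward path avoids counter value 0 in the end rests on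
  determinism: traced back from a halting configuration it never repeats a configuration, and only
  finitely many configurations have counter 0.\<close>

type_synonym ('q, 'a, 'b) lmach = "'q \<Rightarrow> 'a tsym \<Rightarrow> 'b \<Rightarrow> bool \<Rightarrow> ('q \<times> int \<times> int) option"

text \<open>A partial transition function reads the state, the letter, an annotation of the head position and
  whether the counter is 0. Head positions are integers, since \<^emph>\<open>good\<close> machines never move across the ends
  of the tape.\<close>

definition gstep :: "('q, 'a, 'b) lmach \<Rightarrow> 'a list \<Rightarrow> (int \<Rightarrow> 'b) \<Rightarrow> 'q \<times> int \<times> int \<Rightarrow> ('q \<times> int \<times> int) option" where
  "gstep \<delta> x \<gamma> = (\<lambda>(q, a, b). map_option (\<lambda>(q', c, d). (q', a + c, b + d)) (\<delta> q (tape x (nat b)) (\<gamma> b) (a = 0)))"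

definition vconf :: "'q set \<Rightarrow> 'a list \<Rightarrow> ('q \<times> int \<times> int) set" where
  "vconf Q x = Q \<times> UNIV \<times> {0..int (length x) + 1}"

definition stp :: "('q, 'a, 'b) lmach \<Rightarrow> 'q set \<Rightarrow> 'a list \<Rightarrow> (int \<Rightarrow> 'b) \<Rightarrow> (('q \<times> int \<times> int) \<times> ('q \<times> int \<times> int)) set" where
  "stp \<delta> Q x \<gamma> = {(u, v). u \<in> vconf Q x \<and> gstep \<delta> x \<gamma> u = Some v}"

definition good :: "('q, 'a, 'b) lmach \<Rightarrow> 'q set \<Rightarrow> bool" where
  "good \<delta> Q \<longleftrightarrow> finite Q \<and> (\<forall>q\<in>Q. \<forall>\<sigma> \<beta> z q' c d. \<delta> q \<sigma> \<beta> z = Some (q', c, d) \<longrightarrow>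
     q' \<in> Q \<and> c \<in> incs \<and> d \<in> incs \<and> (\<sigma> = Cent \<longrightarrow> d \<noteq> -1) \<and> (\<sigma> = Dollar \<longrightarrow> d \<noteq> 1))"

text \<open>\<open>None\<close> may occur outside \<open>A\<close> and \<open>R\<close>: a failed
  test or a wrong annotation leaves the machine stuck without a verdict. Since \<open>q0\<close> is
  not final, a deciding run makes at least one step.\<close>

definition decides :: "('q, 'a, 'b) lmach \<Rightarrow> 'q set \<Rightarrow> 'q \<Rightarrow> 'q set \<Rightarrow> 'q set \<Rightarrow> ('a list \<Rightarrow> int \<Rightarrow> 'b) \<Rightarrow> 'a list set \<Rightarrow> bool" where
  "decides \<delta> Q q0 A R \<gamma> L \<longleftrightarrow> good \<delta> Q \<and> q0 \<in> Q \<and> q0 \<notin> A \<union> R \<and> A \<subseteq> Q \<and> R \<subseteq> Q \<and> A \<inter> R = {} \<and>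
     (\<forall>q\<in>A \<union> R. \<forall>\<sigma> \<beta> z. \<delta> q \<sigma> \<beta> z = None) \<and>
     (\<forall>x. \<exists>u. ((q0, 0, 0), u) \<in> (stp \<delta> Q x (\<gamma> x))\<^sup>* \<and> fst u \<in> (if x \<in> L then A else R))"

definition tame :: "('q, 'a, 'b) lmach \<Rightarrow> 'q set \<Rightarrow> 'q \<Rightarrow> ('a list \<Rightarrow> int \<Rightarrow> 'b) \<Rightarrow> bool" where
  "tame \<delta> Q q0 \<gamma> \<longleftrightarrow> (\<forall>x u. ((q0, 0, 0), u) \<in> (stp \<delta> Q x (\<gamma> x))\<^sup>* \<longrightarrow> u \<in> Wellfounded.acc (stp \<delta> Q x (\<gamma> x)))"

section \<open>Runs of good machines\<close>

lemma tape_Cent_iff: "0 \<le> b \<Longrightarrow> tape x (nat b) = Cent \<longleftrightarrow> b = 0"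
  by (auto simp: tape_def)

lemma tape_Dollar_iff: "0 \<le> b \<Longrightarrow> tape x (nat b) = Dollar \<longleftrightarrow> b = int (length x) + 1"
  by (auto simp: tape_def nat_eq_iff)

lemma goodD:
  assumes "good \<delta> Q" "q \<in> Q" "\<delta> q \<sigma> \<beta> z = Some (q', c, d)"
  shows "q' \<in> Q" "c \<in> incs" "d \<in> incs" "\<sigma> = Cent \<Longrightarrow> d \<noteq> -1" "\<sigma> = Dollar \<Longrightarrow> d \<noteq> 1"
  using assms unfolding good_def by blast+

lemma vconf_iff: "(q, a, b) \<in> vconf Q x \<longleftrightarrow> q \<in> Q \<and> 0 \<le> b \<and> b \<le> int (length x) + 1"
  by (auto simp: vconf_def)

lemma gstep_iff: "gstep \<delta> x \<gamma> (q, a, b) = Some v \<longleftrightarrow>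
    (\<exists>q' c d. \<delta> q (tape x (nat b)) (\<gamma> b) (a = 0) = Some (q', c, d) \<and> v = (q', a + c, b + d))"
  by (auto simp: gstep_def)

lemma vconf_step:
  assumes "good \<delta> Q" "u \<in> vconf Q x" "gstep \<delta> x \<gamma> u = Some v"
  shows "v \<in> vconf Q x"
proof -
  obtain q a b where u: "u = (q, a, b)" by (cases u)
  obtain q' c d where d: "\<delta> q (tape x (nat b)) (\<gamma> b) (a = 0) = Some (q', c, d)" "v = (q', a + c, b + d)"
    using assms(3) unfolding u gstep_iff by blast
  have r: "q \<in> Q" "0 \<le> b" "b \<le> int (length x) + 1" using assms(2) unfolding u vconf_iff by auto
  note g = goodD[OF assms(1) r(1) d(1)]
  show ?thesis using g r d(2) tape_Cent_iff[of b x] tape_Dollar_iff[of b x]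
    by (cases "b = 0"; cases "b = int (length x) + 1") (auto simp: vconf_iff incs_def)
qed

lemma stp_vconf: "good \<delta> Q \<Longrightarrow> (u, v) \<in> stp \<delta> Q x \<gamma> \<Longrightarrow> u \<in> vconf Q x \<and> v \<in> vconf Q x"
  using vconf_step[of \<delta> Q u x \<gamma> v] by (auto simp: stp_def)

lemma stps_vconf: 
  assumes "good \<delta> Q" "(u, v) \<in> (stp \<delta> Q x \<gamma>)\<^sup>*" "u \<in> vconf Q x"
  shows "v \<in> vconf Q x"
  using assms(2,3) by (induction rule: rtrancl_induct) (auto dest: stp_vconf[OF assms(1)])

text \<open>By determinism \<open>w\<close> and \<open>f\<close> lie on one path from
  \<open>s\<close>, and no step leaves \<open>f\<close>.\<close>

lemma stp_det:
  assumes "(s, w) \<in> (stp \<delta> Q x \<gamma>)\<^sup>*" "(s, f) \<in> (stp \<delta> Q x \<gamma>)\<^sup>*" "gstep \<delta> x \<gamma> f = None"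
  shows "(w, f) \<in> (stp \<delta> Q x \<gamma>)\<^sup>*"
  using assms
proof (induction rule: rtrancl_induct)
  case (step y z)
  hence "(y, f) \<in> (stp \<delta> Q x \<gamma>)\<^sup>*" by simp
  thus ?case
  proof (cases rule: converse_rtranclE)
    case base
    thus ?thesis using step by (auto simp: stp_def)
  next
    case (step y')
    thus ?thesis using \<open>(y, z) \<in> stp \<delta> Q x \<gamma>\<close> by (auto simp: stp_def)
  qed
qed

lemma final_stuck: "decides \<delta> Q q0 A R \<gamma> L \<Longrightarrow> fst u \<in> A \<union> R \<Longrightarrow> gstep \<delta> x (\<gamma> x) u = None"
  by (cases u) (auto simp: decides_def gstep_def)

text \<open>The run is one path into the final configuration, so the predecessor tree of each
  configuration on it is a subtree of the final one's.\<close>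

lemma tameI:
  assumes dec: "decides \<delta> Q q0 A R \<gamma> L"
    and acc: "\<And>x u. ((q0, 0, 0), u) \<in> (stp \<delta> Q x (\<gamma> x))\<^sup>* \<Longrightarrow> fst u \<in> A \<union> R \<Longrightarrow> u \<in> Wellfounded.acc (stp \<delta> Q x (\<gamma> x))"
  shows "tame \<delta> Q q0 \<gamma>"
  unfolding tame_def
proof (intro allI impI)
  fix x u assume u: "((q0, 0, 0), u) \<in> (stp \<delta> Q x (\<gamma> x))\<^sup>*"
  obtain f where f: "((q0, 0, 0), f) \<in> (stp \<delta> Q x (\<gamma> x))\<^sup>*" "fst f \<in> A \<union> R"
    using dec unfolding decides_def by (metis UnCI)
  show "u \<in> Wellfounded.acc (stp \<delta> Q x (\<gamma> x))"
    using acc[OF f] stp_det[OF u f(1) final_stuck[OF dec f(2)]] by (rule acc_downwards)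
qed

definition index_of :: "'c list \<Rightarrow> 'c \<Rightarrow> nat" where
  "index_of ks k = (THE i. i < length ks \<and> ks ! i = k)"

lemma index_of:
  assumes "distinct ks" "k \<in> set ks"
  shows "index_of ks k < length ks" "ks ! index_of ks k = k"
proof -
  obtain i where "i < length ks" "ks ! i = k" using assms(2) by (auto simp: in_set_conv_nth)
  hence "\<exists>!i. i < length ks \<and> ks ! i = k" using nth_eq_iff_index_eq[OF assms(1)] by metis
  from theI'[OF this] have "index_of ks k < length ks \<and> ks ! index_of ks k = k" unfolding index_of_def .
  thus "index_of ks k < length ks" "ks ! index_of ks k = k" by auto
qed

lemma index_of_nth: "distinct ks \<Longrightarrow> i < length ks \<Longrightarrow> index_of ks (ks ! i) = i"
  using index_of[of ks "ks ! i"] nth_eq_iff_index_eq[of ks] nth_mem by metis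

section \<open>Permutation machines as simple 2R1CAs\<close>

definition perm_qca :: "nat set \<Rightarrow> nat \<Rightarrow> nat set \<Rightarrow> nat set \<Rightarrow> ('a tsym \<Rightarrow> nat \<Rightarrow> nat \<Rightarrow> nat) \<Rightarrow> (nat \<Rightarrow> int) \<Rightarrow> (nat \<Rightarrow> dir) \<Rightarrow> (nat, 'a) qca" where
  "perm_qca S i A R \<pi> C D = \<lparr>qstates = S, qinit = i, qacc = A, qrej = R,
     qtrans = (\<lambda>q \<sigma> s q' c d. if q' = \<pi> \<sigma> s q \<and> c = C q' \<and> d = D q' then 1 else 0)\<rparr>"

lemma dirs_UNIV: "dirs = UNIV"
  using dir.exhaust by (auto simp: dirs_def)

lemma finite_dirs [simp]: "finite dirs" by (simp add: dirs_def)
lemma finite_incs [simp]: "finite incs" by (simp add: incs_def)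

lemma sum_indicator_pair:
  assumes "finite A" "(c, d) \<in> A"
  shows "(\<Sum>(c', d')\<in>A. if c' = c \<and> d' = d then k else (0::complex)) = k"
proof -
  have "(\<Sum>(c', d')\<in>A. if c' = c \<and> d' = d then k else 0) = (\<Sum>y\<in>A. if y = (c, d) then k else 0)"
    by (intro sum.cong) (auto split: if_splits)
  thus ?thesis using assms by simp
qed

text \<open>Both amplitudes in a term of \<open>W\<close> enter the same state \<open>q'\<close>,
  which fixes \<open>c1 = c2 = C q'\<close> and \<open>d1 = d2 = D q'\<close>. So terms with a
  nonzero shift vanish, and the rest compares two values of \<open>\<pi>\<close>.\<close>

lemma W_perm_qca:
  assumes "finite S" "\<And>q. C q \<in> incs" and "\<pi> \<sigma>1 s1 q1 \<in> S"
  shows "W (perm_qca S i A R \<pi> C D) \<alpha> \<beta> q1 \<sigma>1 s1 q2 \<sigma>2 s2 =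
    (if \<alpha> = 0 \<and> \<beta> = 0 \<and> \<pi> \<sigma>1 s1 q1 = \<pi> \<sigma>2 s2 q2 then 1 else 0)"
proof -
  have *: "(\<Sum>(c1, d1)\<in>incs \<times> dirs. \<Sum>(c2, d2)\<in>incs \<times> dirs.
        if c2 - c1 = \<alpha> \<and> mu d2 - mu d1 = \<beta>
        then cnj (if q' = \<pi> \<sigma>1 s1 q1 \<and> c1 = C q' \<and> d1 = D q' then 1 else 0) *
             (if q' = \<pi> \<sigma>2 s2 q2 \<and> c2 = C q' \<and> d2 = D q' then 1 else 0) else 0)
      = (if q' = \<pi> \<sigma>1 s1 q1 then (if \<alpha> = 0 \<and> \<beta> = 0 \<and> \<pi> \<sigma>1 s1 q1 = \<pi> \<sigma>2 s2 q2 then 1 else 0) else (0::complex))" for q'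
  proof -
    let ?k = "if q' = \<pi> \<sigma>1 s1 q1 \<and> \<alpha> = 0 \<and> \<beta> = 0 \<and> q' = \<pi> \<sigma>2 s2 q2 then 1 else (0::complex)"
    have p: "finite (incs \<times> dirs)" "(C q', D q') \<in> incs \<times> dirs" using assms(2) by (simp_all only: finite_cartesian_product finite_dirs finite_incs) (simp add: dirs_UNIV)
    have "(\<Sum>(c1, d1)\<in>incs \<times> dirs. \<Sum>(c2, d2)\<in>incs \<times> dirs.
        if c2 - c1 = \<alpha> \<and> mu d2 - mu d1 = \<beta>
        then cnj (if q' = \<pi> \<sigma>1 s1 q1 \<and> c1 = C q' \<and> d1 = D q' then 1 else 0) *
             (if q' = \<pi> \<sigma>2 s2 q2 \<and> c2 = C q' \<and> d2 = D q' then 1 else 0) else 0)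
       = (\<Sum>(c1, d1)\<in>incs \<times> dirs. if c1 = C q' \<and> d1 = D q' then (\<Sum>(c2, d2)\<in>incs \<times> dirs. if c2 = C q' \<and> d2 = D q' then ?k else 0) else 0)"
      apply (intro sum.cong refl)
      apply (clarsimp split del: if_split)
      apply (cases "q' = \<pi> \<sigma>1 s1 q1")
       apply (auto intro!: sum.cong sum.neutral)
      done
    also have "\<dots> = ?k"
      by (simp only: sum_indicator_pair[OF p])
    finally show ?thesis by auto
  qed
  show ?thesis unfolding W_def perm_qca_def qca.simps *
    using assms by simp
qed

section \<open>Permutation machines acting on basis vectors\<close>

locale perm_machine =
  fixes S :: "nat set" and i0 :: nat and A R :: "nat set" and \<pi> :: "'a tsym \<Rightarrow> nat \<Rightarrow> nat \<Rightarrow> nat"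
    and C :: "nat \<Rightarrow> int" and D :: "nat \<Rightarrow> dir"
  assumes fin: "finite S" and i0: "i0 \<in> S" and AS: "A \<subseteq> S" and RS: "R \<subseteq> S" and AR: "A \<inter> R = {}"
    and C: "\<And>q. C q \<in> incs"
    and closed: "\<And>\<sigma> s q. s \<in> {0, 1} \<Longrightarrow> q \<in> S \<Longrightarrow> \<pi> \<sigma> s q \<in> S"
    and inj: "\<And>\<sigma> s. s \<in> {0, 1} \<Longrightarrow> inj_on (\<pi> \<sigma> s) S"
begin

abbreviation "Mq \<equiv> perm_qca S i0 A R \<pi> C D"

lemma well_formed: "well_formed Mq"
proof -
  have q: "qstates Mq = S" by (simp add: perm_qca_def)
  have W: "W Mq \<alpha> \<beta> q1 \<sigma>1 s1 q2 \<sigma>2 s2 = (if \<alpha> = 0 \<and> \<beta> = 0 \<and> \<pi> \<sigma>1 s1 q1 = \<pi> \<sigma>2 s2 q2 then 1 else 0)"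
    if "q1 \<in> S" "s1 \<in> {0, 1}" for \<alpha> \<beta> q1 \<sigma>1 s1 q2 \<sigma>2 s2
    by (rule W_perm_qca[where \<pi> = \<pi> and C = C]) (use that closed fin C in auto)
  have i: "\<pi> \<sigma> s q1 = \<pi> \<sigma> s q2 \<longleftrightarrow> q1 = q2" if "q1 \<in> S" "q2 \<in> S" "s \<in> {0, 1}" for \<sigma> s q1 q2
    using inj_on_eq_iff[OF inj[OF that(3), of \<sigma>] that(1,2)] .
  show ?thesis unfolding well_formed_def q
  proof (intro ballI conjI allI impI)
  qed (simp_all only: W i, auto)
qed

lemma is_2R1CA: "is_2R1CA Mq"
  using well_formed fin i0 AS RS AR unfolding is_2R1CA_def valid_qca_def
  by (auto simp: perm_qca_def)

lemma is_simple: "is_simple Mq"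
  unfolding is_simple_def
  by (rule exI[of _ "\<lambda>\<sigma> s q' q. if q' = \<pi> \<sigma> s q then 1 else 0"], rule exI[of _ "\<lambda>q \<sigma>. C q"], rule exI[of _ D])
     (auto simp: perm_qca_def C)

definition nxt :: "'a list \<Rightarrow> nat \<times> int \<times> nat \<Rightarrow> nat \<times> int \<times> nat" where
  "nxt x = (\<lambda>(q, a, b). let q' = \<pi> (tape x b) (sgnc a) q in (q', a + C q', move x b (mu (D q'))))"

definition ket :: "nat \<times> int \<times> nat \<Rightarrow> nat qvec" where
  "ket cf = (\<lambda>cf'. if cf' = cf then 1 else 0)"

lemma move_less: "move x b m \<le> length x + 1"
proof -
  have "(int b + m) mod int (length x + 2) < int (length x + 2)" by (intro pos_mod_bound) simp
  thus ?thesis unfolding move_def by linarith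
qed

lemma move_move: "b \<le> length x + 1 \<Longrightarrow> move x (move x b m) (- m) = b"
  unfolding move_def by (simp add: mod_simps)

text \<open>\<open>Ux\<close> sums over the possible sources of a target. On the circular tape a
  move is undone by its opposite, so only the term with source \<open>q\<close>, counter change
  \<open>C q'\<close> and move \<open>D q'\<close> can survive.\<close>

lemma Ux_ket:
  assumes "q \<in> S" "b \<le> length x + 1"
  shows "Ux Mq x (ket (q, a, b)) = ket (nxt x (q, a, b))"
proof (rule ext, clarify)
  fix q' a' b'
  define p where "p = \<pi> (tape x b) (sgnc a) q"
  have sg: "sgnc a \<in> {0, 1}" by (auto simp: sgnc_def)
  have pS: "p \<in> S" unfolding p_def using closed[OF sg assms(1)] .
  have mv: "move x b' (- mu d) = b \<longleftrightarrow> b' = move x b (mu d)" if "b' \<le> length x + 1" for d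
    using move_move[of b' x "- mu d"] move_move[of b x "mu d"] that assms(2) by auto
  show "Ux Mq x (ket (q, a, b)) (q', a', b') = ket (nxt x (q, a, b)) (q', a', b')"
  proof (cases "q' \<in> S \<and> b' \<le> length x + 1")
    case True
    have *: "ket (q, a, b) (r, a' - c, move x b' (- mu d)) *
         (if q' = \<pi> (tape x (move x b' (- mu d))) (sgnc (a' - c)) r \<and> c = C q' \<and> d = D q' then 1 else 0)
       = (if r = q then if c = C q' then if d = D q' then (if (q', a', b') = nxt x (q, a, b) then 1 else 0) else 0 else 0 else 0)" for r c d
    proof (cases "r = q \<and> c = C q' \<and> d = D q'")
      case t: True
      have "(q, a' - c, move x b' (- mu d)) = (q, a, b) \<longleftrightarrow> a = a' - c \<and> b' = move x b (mu d)"
        using mv[of d] True by auto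
      moreover have "move x (move x b (mu d)) (- mu d) = b" using move_move[OF assms(2)] .
      ultimately show ?thesis using t unfolding ket_def nxt_def Let_def case_prod_conv prod.inject
        by (cases "a = a' - c \<and> b' = move x b (mu d)") auto
    next
      case False
      thus ?thesis by (auto simp: ket_def)
    qed
    have "Ux Mq x (ket (q, a, b)) (q', a', b') = (\<Sum>r\<in>S. \<Sum>c\<in>incs. \<Sum>d\<in>dirs. ket (q, a, b) (r, a' - c, move x b' (- mu d)) *
         (if q' = \<pi> (tape x (move x b' (- mu d))) (sgnc (a' - c)) r \<and> c = C q' \<and> d = D q' then 1 else 0))"
      using True by (simp add: Ux_def perm_qca_def Let_def)
    also have "\<dots> = (\<Sum>r\<in>S. if r = q then (\<Sum>c\<in>incs. if c = C q' then (\<Sum>d\<in>dirs. if d = D q' then (if (q', a', b') = nxt x (q, a, b) then 1 else 0) else 0) else 0) else 0)"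
      unfolding * by (intro sum.cong refl) (simp only: split: if_split, intro conjI impI sum.cong sum.neutral ballI refl, simp_all)
    also have "\<dots> = (if (q', a', b') = nxt x (q, a, b) then 1 else 0)"
    proof -
      have "D q' \<in> dirs" by (simp add: dirs_UNIV)
      thus ?thesis using assms C by (simp add: fin)
    qed
    finally show ?thesis by (simp add: ket_def)
  next
    case False
    hence "(q', a', b') \<noteq> nxt x (q, a, b)" using pS move_less[of x b "mu (D p)"] by (auto simp: nxt_def Let_def p_def)
    thus ?thesis using False by (auto simp: Ux_def ket_def perm_qca_def)
  qed
qed

lemma nxt_closed: "q \<in> S \<Longrightarrow> nxt x (q, a, b) = (q', a', b') \<Longrightarrow> q' \<in> S \<and> b' \<le> length x + 1"
  using closed[of "sgnc a"] move_less by (auto simp: nxt_def Let_def sgnc_def)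

lemma normsq_ket: "normsq (ket cf) = 1"
proof -
  have "infsum (\<lambda>c. (cmod (ket cf c))\<^sup>2) UNIV = infsum (\<lambda>c. (cmod (ket cf c))\<^sup>2) {cf}"
    by (rule infsum_cong_neutral) (auto simp: ket_def)
  thus ?thesis by (simp add: normsq_def ket_def)
qed

lemma normsq_zero: "normsq (\<lambda>_. 0) = 0"
  by (simp add: normsq_def)

lemma Ux_zero: "Ux Mq x (\<lambda>_. 0) = (\<lambda>_. 0)"
  by (auto simp: Ux_def Let_def)

lemma proj_zero: "proj T (\<lambda>_. 0) = (\<lambda>_. 0)"
  by (auto simp: proj_def)

lemma proj_ket: "proj T (ket (q, r)) = (if q \<in> T then ket (q, r) else (\<lambda>_. 0))"
  by (auto simp: proj_def ket_def fun_eq_iff)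

text \<open>Time 0 is exempt because each measurement follows an application of \<open>Ux\<close>;
  the initial vector itself is not measured.\<close>

lemma run_ket:
  assumes "\<And>t. t \<le> k \<Longrightarrow> fst ((nxt x ^^ t) (i0, 0, 0)) \<notin> A \<union> R \<or> t = 0"
  shows "t \<le> k \<Longrightarrow> qvec_at Mq x t = ket ((nxt x ^^ t) (i0, 0, 0)) \<and>
     fst ((nxt x ^^ t) (i0, 0, 0)) \<in> S \<and> snd (snd ((nxt x ^^ t) (i0, 0, 0))) \<le> length x + 1"
proof (induction t)
  case 0
  show ?case using i0 by (auto simp: ket_def perm_qca_def)
next
  case (Suc t)
  obtain q a b where c: "(nxt x ^^ t) (i0, 0, 0) = (q, a, b)" by (cases "(nxt x ^^ t) (i0, 0, 0)")
  obtain q' a' b' where c': "nxt x (q, a, b) = (q', a', b')" by (cases "nxt x (q, a, b)")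
  have "q' \<notin> A \<union> R" using assms[OF Suc.prems] c c' by simp
  moreover have "qacc Mq = A" "qrej Mq = R" by (simp_all add: perm_qca_def)
  ultimately show ?case using Suc c c' nxt_closed[OF _ c'] Ux_ket[of q b x a]
    by (simp add: proj_ket)
qed

text \<open>Index \<open>k\<close> of \<open>acc_step\<close> and \<open>rej_step\<close> refers to
  the configuration after \<open>Suc k\<close> steps. That outcome is certain and the surviving
  vector is 0 from then on, so the series has a single nonzero term.\<close>

lemma halting_run:
  assumes "\<And>t. 0 < t \<Longrightarrow> t \<le> k \<Longrightarrow> fst ((nxt x ^^ t) (i0, 0, 0)) \<notin> A \<union> R"
    and f: "fst ((nxt x ^^ Suc k) (i0, 0, 0)) \<in> (if acc then A else R)"
  shows "(if acc then acc_step Mq x else rej_step Mq x) sums 1"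
proof -
  have r: "t \<le> k \<Longrightarrow> qvec_at Mq x t = ket ((nxt x ^^ t) (i0, 0, 0)) \<and>
     fst ((nxt x ^^ t) (i0, 0, 0)) \<in> S \<and> snd (snd ((nxt x ^^ t) (i0, 0, 0))) \<le> length x + 1" for t
    by (rule run_ket) (use assms(1) in auto)
  have U: "Ux Mq x (qvec_at Mq x t) = ket ((nxt x ^^ Suc t) (i0, 0, 0))" if "t \<le> k" for t
    using r[OF that] Ux_ket by (cases "(nxt x ^^ t) (i0, 0, 0)") auto
  have q: "qacc Mq = A" "qrej Mq = R" by (simp_all add: perm_qca_def)
  obtain qf r where qf: "(nxt x ^^ Suc k) (i0, 0, 0) = (qf, r)" by (meson surj_pair)
  have qfA: "qf \<in> (if acc then A else R)" using f qf by simp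
  have z: "qvec_at Mq x t = (\<lambda>_. 0)" if "Suc k \<le> t" for t
    using that
  proof (induction rule: dec_induct)
    case base
    show ?case using U[of k] qf qfA q by (simp add: proj_ket split: if_splits)
  next
    case (step t)
    thus ?case by (simp add: Ux_zero proj_zero)
  qed
  have "(if acc then acc_step Mq x else rej_step Mq x) = (\<lambda>t. if t = k then 1 else 0)"
  proof
    fix t
    consider "t < k" | "t = k" | "t > k" by linarith
    thus "(if acc then acc_step Mq x else rej_step Mq x) t = (if t = k then 1 else 0)"
    proof cases
      case 1
      obtain q' r' where "(nxt x ^^ Suc t) (i0, 0, 0) = (q', r')" by (meson surj_pair)
      thus ?thesis using 1 U[of t] assms(1)[of "Suc t"] q
        by (auto simp: acc_step_def rej_step_def proj_ket normsq_zero)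
    next
      case 2
      thus ?thesis using U[of t] qf qfA q by (cases acc) (simp_all add: acc_step_def rej_step_def proj_ket normsq_ket)
    next
      case 3
      thus ?thesis using z[of t] by (auto simp: acc_step_def rej_step_def proj_zero Ux_zero normsq_zero)
    qed
  qed
  thus ?thesis using sums_single[of k "\<lambda>_. 1::real"] by (simp add: eq_commute)
qed

end

section \<open>The reversible tour of predecessor trees\<close>

text \<open>\<open>ks\<close> enumerates all conceivable incoming transitions (source state, counter change, head move).
  In state \<open>Node q i\<close> the head is at a configuration with state \<open>q\<close> whose first \<open>i\<close> candidate
  predecessors are done; in state \<open>Try q i\<close> it is at the position of the \<open>i\<close>-th candidate.\<close>

datatype 'q tour_state = Node 'q nat | Try 'q nat

locale tour =
  fixes \<delta> :: "('q, 'a, unit) lmach" and Q :: "'q set" and q0 :: 'q and A R :: "'q set" and L :: "'a list set"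
    and ks :: "('q \<times> int \<times> int) list"
  assumes dec: "decides \<delta> Q q0 A R (\<lambda>_ _. ()) L" and tame: "tame \<delta> Q q0 (\<lambda>_ _. ())"
    and ks: "set ks = Q \<times> incs \<times> incs" "distinct ks"
begin

abbreviation "m \<equiv> length ks"
abbreviation "stpx x \<equiv> stp \<delta> Q x (\<lambda>_. ())"

lemma good: "good \<delta> Q" and q0Q: "q0 \<in> Q" and q0F: "q0 \<notin> A \<union> R" and AQ: "A \<subseteq> Q" and RQ: "R \<subseteq> Q" and AR: "A \<inter> R = {}"
  and fin: "\<And>q \<sigma> \<beta> z. q \<in> A \<union> R \<Longrightarrow> \<delta> q \<sigma> \<beta> z = None"
  and run: "\<exists>u. ((q0, 0, 0), u) \<in> (stpx x)\<^sup>* \<and> fst u \<in> (if x \<in> L then A else R)"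
  using dec unfolding decides_def by auto

section \<open>The tour as a permutation of its states\<close>

abbreviation "idx \<equiv> index_of ks"

lemmas idx = index_of[OF ks(2)]
lemmas idx_nth = index_of_nth[OF ks(2)]

text \<open>A successful \<open>Try\<close> descends to the child, a failed one returns to the
  parent with the candidate done; a node with all candidates done climbs its own outgoing edge.
  Without such an edge \<open>Node q 0\<close> has no entry from a \<open>Try\<close>, and sending
  the completed node there fills exactly this gap, so that the map is a bijection.\<close>

fun tour :: "'a tsym \<Rightarrow> bool \<Rightarrow> 'q tour_state \<Rightarrow> 'q tour_state" where
  "tour \<sigma> z (Try q i) = (case ks ! i of (p, c, d) \<Rightarrow> if \<delta> p \<sigma> () z = Some (q, c, d) then Node p 0 else Node q (Suc i))"
| "tour \<sigma> z (Node q i) = (if i < m then Try q i else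
     (case \<delta> q \<sigma> () z of None \<Rightarrow> Node q 0 | Some (p, c, d) \<Rightarrow> Node p (Suc (idx (q, c, d)))))"

text \<open>Entering \<open>Try q i\<close> undoes the \<open>i\<close>-th candidate transition,
  entering \<open>Node q (Suc i)\<close> redoes it. The latter serves both ways of entering: the
  failed trial and the climb from a completed child.\<close>

fun tC tD :: "'q tour_state \<Rightarrow> int" where
  "tC (Try q i) = (case ks ! i of (p, c, d) \<Rightarrow> if i < m then - c else 0)"
| "tC (Node q 0) = 0"
| "tC (Node q (Suc i)) = (case ks ! i of (p, c, d) \<Rightarrow> if i < m then c else 0)"
| "tD (Try q i) = (case ks ! i of (p, c, d) \<Rightarrow> if i < m then - d else 0)"
| "tD (Node q 0) = 0"
| "tD (Node q (Suc i)) = (case ks ! i of (p, c, d) \<Rightarrow> if i < m then d else 0)"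

definition TS :: "'q tour_state set" where
  "TS = (\<lambda>(q, i). Node q i) ` (Q \<times> {..m}) \<union> (\<lambda>(q, i). Try q i) ` (Q \<times> {..<m})"

lemma TS_iff [simp]: "Node q i \<in> TS \<longleftrightarrow> q \<in> Q \<and> i \<le> m" "Try q i \<in> TS \<longleftrightarrow> q \<in> Q \<and> i < m"
  by (auto simp: TS_def)

lemma finite_TS: "finite TS"
  using good unfolding TS_def good_def by auto

lemma ks_nth: assumes "i < m" "ks ! i = (p, c, d)" shows "p \<in> Q" "c \<in> incs" "d \<in> incs"
  using nth_mem[OF assms(1)] assms(2) ks(1) by auto

lemma ks_mem: "q \<in> Q \<Longrightarrow> \<delta> q \<sigma> \<beta> z = Some (p, c, d) \<Longrightarrow> (q, c, d) \<in> set ks"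
  using goodD[OF good] ks(1) by auto

lemma tCD: "tC r \<in> incs" "tD r \<in> incs"
proof -
  have *: "(case ks ! i of (p, c, d) \<Rightarrow> if i < m then c else 0) \<in> incs"
    "(case ks ! i of (p, c, d) \<Rightarrow> if i < m then d else 0) \<in> incs"
    "(case ks ! i of (p, c, d) \<Rightarrow> if i < m then - c else 0) \<in> incs"
    "(case ks ! i of (p, c, d) \<Rightarrow> if i < m then - d else 0) \<in> incs" for i
    using ks_nth[of i] by (auto split: prod.split simp: incs_def)
  have z: "0 \<in> incs" by (simp add: incs_def)
  show "tC r \<in> incs" by (cases r rule: tC.cases) (simp_all add: * z)
  show "tD r \<in> incs" by (cases r rule: tD.cases) (simp_all add: * z)
qed

lemma tour_closed: "r \<in> TS \<Longrightarrow> tour \<sigma> z r \<in> TS"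
proof (cases r)
  case (Node q i)
  assume r: "r \<in> TS"
  show ?thesis
  proof (cases "i < m")
    case False
    show ?thesis
    proof (cases "\<delta> q \<sigma> () z")
      case (Some k)
      obtain p c d where k: "k = (p, c, d)" by (cases k)
      have "p \<in> Q" "(q, c, d) \<in> set ks" using r Node Some k goodD[OF good] ks_mem by auto
      thus ?thesis using Some k Node False idx(1) by (auto simp: Suc_le_eq)
    qed (use r Node False in auto)
  qed (use r Node in auto)
next
  case (Try q i)
  assume "r \<in> TS"
  thus ?thesis using Try ks_nth[of i] by (auto split: prod.split)
qed

text \<open>\<open>prv\<close> inverts the map: whether a candidate edge exists is a question about
  the current letter and sign alone, so the entered state can ask it again.\<close>

lemma tour_inj: "inj_on (tour \<sigma> z) TS"
proof (rule inj_onI)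
  define prv where "prv r = (case r of
      Try q i \<Rightarrow> Node q i
    | Node q i \<Rightarrow> (case i of
        0 \<Rightarrow> (case \<delta> q \<sigma> () z of None \<Rightarrow> Node q m | Some (p, c, d) \<Rightarrow> Try p (idx (q, c, d)))
      | Suc j \<Rightarrow> (case ks ! j of (p, c, d) \<Rightarrow> if \<delta> p \<sigma> () z = Some (q, c, d) then Node p m else Try q j)))" for r
  have prv: "prv (tour \<sigma> z r) = r" if "r \<in> TS" for r
  proof (cases r)
    case (Node q i)
    show ?thesis
    proof (cases "i < m")
      case False
      hence i: "i = m" using that Node by auto
      show ?thesis
      proof (cases "\<delta> q \<sigma> () z")
        case (Some k)
        obtain p c d where k: "k = (p, c, d)" by (cases k)
        have "(q, c, d) \<in> set ks" using that Node Some k ks_mem by auto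
        thus ?thesis using Some k Node i idx by (auto simp: prv_def)
      qed (use Node i in \<open>auto simp: prv_def\<close>)
    qed (use Node in \<open>auto simp: prv_def\<close>)
  next
    case (Try q i)
    obtain p c d where k: "ks ! i = (p, c, d)" by (cases "ks ! i")
    thus ?thesis using Try that idx_nth[of i] by (auto simp: prv_def)
  qed
  fix r r' assume "r \<in> TS" "r' \<in> TS" "tour \<sigma> z r = tour \<sigma> z r'"
  thus "r = r'" using prv by metis
qed

section \<open>The tour on configurations\<close>

definition tnext :: "'a list \<Rightarrow> 'q tour_state \<times> int \<times> nat \<Rightarrow> 'q tour_state \<times> int \<times> nat" where
  "tnext x = (\<lambda>(r, a, b). let r' = tour (tape x b) (a = 0) r in (r', a + tC r', move x b (tD r')))"

text \<open>The run enters a final node with an index given by its last edge, so every index has to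
  count as halting.\<close>

definition halt :: "'q set \<Rightarrow> 'q tour_state set" where
  "halt F = {Node q i | q i. q \<in> F \<and> i \<le> m}"

definition trel :: "'a list \<Rightarrow> (('q tour_state \<times> int \<times> nat) \<times> ('q tour_state \<times> int \<times> nat)) set" where
  "trel x = {(u, v). v = tnext x u \<and> fst v \<notin> halt A \<union> halt R}"

lemma move_id: "0 \<le> b + d \<Longrightarrow> b + d \<le> int (length x) + 1 \<Longrightarrow> 0 \<le> b \<Longrightarrow> move x (nat b) d = nat (b + d)"
  by (simp add: move_def)

lemma move_back: "0 \<le> b \<Longrightarrow> b \<le> int (length x) + 1 \<Longrightarrow> move x (move x (nat b) (- d)) d = nat b"
  by (simp add: move_def mod_simps)

text \<open>The tour wraps around the tape, the machine does not: a candidate reached by wrapping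
  sits on an end-marker and would have to move across it, which \<open>good\<close>
  excludes.\<close>

lemma off_tape:
  assumes "0 \<le> b" "b \<le> int (length x) + 1" "d \<in> incs" "p \<in> Q"
    and "\<delta> p (tape x (move x (nat b) (- d))) () z = Some (q, c, d)"
  shows "0 \<le> b - d" "b - d \<le> int (length x) + 1"
proof -
  have "\<not> (b = 0 \<and> d = 1)"
  proof
    assume "b = 0 \<and> d = 1"
    hence "move x (nat b) (- d) = length x + 1" by (simp add: move_def zmod_minus1)
    thus False using goodD(5)[OF good assms(4,5)] \<open>b = 0 \<and> d = 1\<close> by (simp add: tape_def)
  qed
  moreover have "\<not> (b = int (length x) + 1 \<and> d = -1)"
  proof
    assume "b = int (length x) + 1 \<and> d = -1"
    hence "move x (nat b) (- d) = 0" by (simp add: move_def)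
    thus False using goodD(4)[OF good assms(4,5)] \<open>b = int (length x) + 1 \<and> d = -1\<close> by (simp add: tape_def)
  qed
  ultimately show "0 \<le> b - d" "b - d \<le> int (length x) + 1" using assms(1-3) by (auto simp: incs_def)
qed

lemma node_up:
  assumes "(q, a, b) \<in> vconf Q x" "gstep \<delta> x (\<lambda>_. ()) (q, a, b) = Some (p, a', b')"
  shows "\<exists>i<m. tnext x (Node q m, a, nat b) = (Node p (Suc i), a', nat b') \<and> ks ! i = (q, a' - a, b' - b)"
proof -
  obtain c d where k: "\<delta> q (tape x (nat b)) () (a = 0) = Some (p, c, d)" "a' = a + c" "b' = b + d"
    using assms(2) unfolding gstep_iff by auto
  have q: "q \<in> Q" using assms(1) by (simp add: vconf_iff)
  have s: "(q, c, d) \<in> set ks" using ks_mem[OF q k(1)] .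
  have "(p, a', b') \<in> vconf Q x" using vconf_step[OF good assms] .
  thus ?thesis using k idx[OF s] assms(1) move_id[of b d x]
    by (intro exI[of _ "idx (q, c, d)"]) (auto simp: tnext_def Let_def vconf_iff)
qed

text \<open>Induction over the predecessor tree. A genuine predecessor is toured by the induction
  hypothesis, and its edge leads back with the index it was left by, because \<open>ks\<close> has
  no duplicates. A false candidate is abandoned by the reverse move.\<close>

lemma tour_complete:
  assumes "v \<in> Wellfounded.acc (stpx x)" "v \<in> vconf Q x" "fst v \<notin> A \<union> R" "i \<le> m"
  shows "((Node (fst v) i, fst (snd v), nat (snd (snd v))), (Node (fst v) m, fst (snd v), nat (snd (snd v)))) \<in> (trel x)\<^sup>*"
  using assms
proof (induction v arbitrary: i rule: acc_induct_rule)
  case (1 v)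
  obtain q a b where v: "v = (q, a, b)" by (cases v)
  have qb: "q \<in> Q" "0 \<le> b" "b \<le> int (length x) + 1" using 1(3) by (auto simp: v vconf_iff)
  have nh: "Node q j \<notin> halt A \<union> halt R" for j using 1(4) by (auto simp: halt_def v)
  have one: "((Node q i, a, nat b), (Node q (Suc i), a, nat b)) \<in> (trel x)\<^sup>*" if i: "i < m" for i
  proof -
    obtain p c d where k: "ks ! i = (p, c, d)" by (cases "ks ! i")
    note kQ = ks_nth[OF i k]
    let ?b = "move x (nat b) (- d)"
    have s1: "((Node q i, a, nat b), (Try q i, a - c, ?b)) \<in> trel x"
      using i k by (auto simp: trel_def tnext_def Let_def halt_def)
    show ?thesis
    proof (cases "\<delta> p (tape x ?b) () (a - c = 0) = Some (q, c, d)")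
      case True
      note ot = off_tape[OF qb(2,3) kQ(3,1) True]
      have b: "?b = nat (b - d)" using ot move_id[of b "-d" x] qb by simp
      let ?u = "(p, a - c, b - d)"
      have u: "?u \<in> vconf Q x" using ot kQ by (auto simp: vconf_iff)
      have uv: "gstep \<delta> x (\<lambda>_. ()) ?u = Some v" using True by (auto simp: gstep_iff v b)
      have pF: "p \<notin> A \<union> R" using fin True by force
      have s2: "((Try q i, a - c, ?b), (Node p 0, a - c, ?b)) \<in> trel x"
        using True k pF by (auto simp: trel_def tnext_def Let_def halt_def move_def qb)
      have s3: "((Node p 0, a - c, nat (b - d)), (Node p m, a - c, nat (b - d))) \<in> (trel x)\<^sup>*"
        using 1(2)[of ?u 0] u uv pF by (auto simp: stp_def)
      obtain j where j: "j < m" "tnext x (Node p m, a - c, nat (b - d)) = (Node q (Suc j), a, nat b)" "ks ! j = (p, c, d)"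
        using node_up[OF u uv[unfolded v]] by auto
      have "j = i" using j(1,3) i k nth_eq_iff_index_eq[OF ks(2) j(1) i] by simp
      hence s4: "((Node p m, a - c, nat (b - d)), (Node q (Suc i), a, nat b)) \<in> trel x"
        using j(2) nh by (auto simp: trel_def)
      show ?thesis using s1 s2 s3 s4 unfolding b by (meson rtrancl.rtrancl_into_rtrancl converse_rtrancl_into_rtrancl)
    next
      case False
      have "((Try q i, a - c, ?b), (Node q (Suc i), a, nat b)) \<in> trel x"
        using False i k nh[of "Suc i"] move_back[OF qb(2,3)] by (auto simp: trel_def tnext_def Let_def)
      thus ?thesis using s1 by (meson r_into_rtrancl converse_rtrancl_into_rtrancl)
    qed
  qed
  have "((Node q i, a, nat b), (Node q m, a, nat b)) \<in> (trel x)\<^sup>*"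
    using \<open>i \<le> m\<close>
  proof (induction rule: inc_induct)
    case (step j)
    thus ?case using one[of j] by (meson rtrancl_trans)
  qed simp
  thus ?case by (simp add: v)
qed

text \<open>The start \<open>Node q0 m\<close> declares all candidates of the initial configuration
  done. After each edge of the run, only the candidates after that edge remain to be toured.\<close>

lemma tour_run:
  assumes "((q0, 0, 0), u) \<in> (stpx x)\<^sup>*" "fst u \<notin> A \<union> R"
  shows "((Node q0 m, 0, 0), (Node (fst u) m, fst (snd u), nat (snd (snd u)))) \<in> (trel x)\<^sup>*"
  using assms
proof (induction rule: rtrancl_induct)
  case (step u v)
  obtain q a b where u: "u = (q, a, b)" by (cases u)
  obtain p a' b' where v: "v = (p, a', b')" by (cases v)
  have g: "u \<in> vconf Q x" "gstep \<delta> x (\<lambda>_. ()) u = Some v" using step(2) by (auto simp: stp_def)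
  have "q \<notin> A \<union> R" using g(2) fin by (force simp: u gstep_iff)
  hence s: "((Node q0 m, 0, 0), (Node q m, a, nat b)) \<in> (trel x)\<^sup>*" using step(3) u by simp
  obtain i where i: "i < m" "tnext x (Node q m, a, nat b) = (Node p (Suc i), a', nat b')"
    using node_up[OF g[unfolded u v]] by auto
  have s2: "((Node q m, a, nat b), (Node p (Suc i), a', nat b')) \<in> trel x"
    using i step(4) by (auto simp: trel_def halt_def v)
  have "v \<in> Wellfounded.acc (stpx x)" using tame step(1,2) unfolding tame_def by (blast intro: rtrancl_into_rtrancl)
  hence "((Node p (Suc i), a', nat b'), (Node p m, a', nat b')) \<in> (trel x)\<^sup>*"
    using tour_complete[of v x "Suc i"] vconf_step[OF good g] step(4) i v by auto
  from rtrancl_trans[OF rtrancl_into_rtrancl[OF s s2] this] show ?case by (simp add: v)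
qed simp

lemma tour_halts:
  "\<exists>k. (\<forall>t. 0 < t \<longrightarrow> t \<le> k \<longrightarrow> fst ((tnext x ^^ t) (Node q0 m, 0, 0)) \<notin> halt A \<union> halt R) \<and>
     fst ((tnext x ^^ Suc k) (Node q0 m, 0, 0)) \<in> halt (if x \<in> L then A else R)"
proof -
  obtain v where v: "((q0, 0, 0), v) \<in> (stpx x)\<^sup>*" "fst v \<in> (if x \<in> L then A else R)" using run by blast
  \<comment> \<open>The last step into \<open>v\<close> is split off, since \<open>trel\<close>
    contains no step that enters a halting state.\<close>
  have "(q0, 0, 0) \<noteq> v" using v(2) q0F by (auto split: if_splits)
  then obtain u where u: "((q0, 0, 0), u) \<in> (stpx x)\<^sup>*" "(u, v) \<in> stpx x"
    using v(1) by (meson rtranclE)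
  have g: "u \<in> vconf Q x" "gstep \<delta> x (\<lambda>_. ()) u = Some v" using u(2) by (auto simp: stp_def)
  obtain q a b where u': "u = (q, a, b)" by (cases u)
  obtain p a' b' where v': "v = (p, a', b')" by (cases v)
  have "q \<notin> A \<union> R" using g(2) fin by (force simp: u' gstep_iff)
  hence "((Node q0 m, 0, 0), (Node q m, a, nat b)) \<in> (trel x)\<^sup>*" using tour_run[OF u(1)] u' by simp
  then obtain k where k: "((Node q0 m, 0, 0), (Node q m, a, nat b)) \<in> trel x ^^ k" using rtrancl_imp_relpow by blast
  have gen: "w = (tnext x ^^ k) w0 \<and> (\<forall>t. 0 < t \<longrightarrow> t \<le> k \<longrightarrow> fst ((tnext x ^^ t) w0) \<notin> halt A \<union> halt R)"
    if "(w0, w) \<in> trel x ^^ k" for w0 w k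
    using that
  proof (induction k arbitrary: w)
    case (Suc k)
    then obtain y where y: "(w0, y) \<in> trel x ^^ k" "(y, w) \<in> trel x" by auto
    have w: "w = (tnext x ^^ Suc k) w0" using Suc.IH[OF y(1)] y(2) by (simp add: trel_def)
    show ?case using Suc.IH[OF y(1)] y(2) w by (auto simp: le_Suc_eq trel_def)
  qed simp
  obtain i where "i < m" "tnext x (Node q m, a, nat b) = (Node p (Suc i), a', nat b')"
    using node_up[OF g[unfolded u' v']] by auto
  thus ?thesis using gen[OF k] v(2) v' by (intro exI[of _ k]) (auto simp: halt_def)
qed

section \<open>Coding the tour states by natural numbers\<close>

definition dir_of :: "int \<Rightarrow> dir" where
  "dir_of d = (if d = -1 then Lft else if d = 1 then Rgt else Stay)"

lemma mu_dir_of: "d \<in> incs \<Longrightarrow> mu (dir_of d) = d"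
  by (auto simp: dir_of_def incs_def)

theorem simulation:
  "\<exists>M' :: (nat, 'a) qca. is_2R1CA M' \<and> is_simple M' \<and>
     (\<forall>x. (x \<in> L \<longrightarrow> acc_step M' x sums 1) \<and> (x \<notin> L \<longrightarrow> rej_step M' x sums 1))"
proof -
  obtain e :: "'q tour_state \<Rightarrow> nat" where e: "inj_on e TS"
    using finite_imp_inj_to_nat_seg[OF finite_TS] by blast
  define f where "f = inv_into TS e"
  have f: "f (e r) = r" if "r \<in> TS" for r using that e by (simp add: f_def)
  define \<pi> where "\<pi> \<sigma> s n = e (tour \<sigma> (s = 0) (f n))" for \<sigma> :: "'a tsym" and s n :: nat
  let ?A = "e ` halt A" and ?R = "e ` halt R"
  have hT: "halt A \<subseteq> TS" "halt R \<subseteq> TS" using AQ RQ by (auto simp: halt_def)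
  interpret pm: perm_machine "e ` TS" "e (Node q0 m)" ?A ?R \<pi> "\<lambda>n. tC (f n)" "\<lambda>n. dir_of (tD (f n))"
  proof
    show "?A \<inter> ?R = {}" using inj_on_image_Int[OF e hT] AR by (auto simp: halt_def)
    show "inj_on (\<pi> \<sigma> s) (e ` TS)" for \<sigma> s
    proof (rule inj_onI, clarify)
      fix r r' assume r: "r \<in> TS" "r' \<in> TS" "\<pi> \<sigma> s (e r) = \<pi> \<sigma> s (e r')"
      hence "tour \<sigma> (s = 0) r = tour \<sigma> (s = 0) r'"
        using inj_onD[OF e] tour_closed by (simp add: \<pi>_def f)
      thus "e r = e r'" using inj_onD[OF tour_inj] r by blast
    qed
  qed (use finite_TS q0Q hT tCD tour_closed f in \<open>auto simp: \<pi>_def\<close>)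
  have nx: "pm.nxt x (e r, a, b) = (case tnext x (r, a, b) of (r', a', b') \<Rightarrow> (e r', a', b')) \<and> fst (tnext x (r, a, b)) \<in> TS"
    if "r \<in> TS" for x r a b
    using that tour_closed[OF that]
    by (auto simp: pm.nxt_def tnext_def Let_def \<pi>_def f sgnc_def mu_dir_of tCD)
  have nxs: "(pm.nxt x ^^ t) (e (Node q0 m), 0, 0) = (case (tnext x ^^ t) (Node q0 m, 0, 0) of (r', a', b') \<Rightarrow> (e r', a', b'))
     \<and> fst ((tnext x ^^ t) (Node q0 m, 0, 0)) \<in> TS" for x t
  proof (induction t)
    case (Suc t)
    obtain r a b where "(tnext x ^^ t) (Node q0 m, 0, 0) = (r, a, b)" by (cases "(tnext x ^^ t) (Node q0 m, 0, 0)")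
    thus ?case using Suc nx[of r x a b] by simp
  qed (use q0Q in simp)
  have fe: "fst ((pm.nxt x ^^ t) (e (Node q0 m), 0, 0)) \<in> e ` halt F \<longleftrightarrow> fst ((tnext x ^^ t) (Node q0 m, 0, 0)) \<in> halt F"
    if "F \<subseteq> Q" for x t F
  proof -
    have "halt F \<subseteq> TS" using that by (auto simp: halt_def)
    thus ?thesis using nxs[of t x] inj_on_image_mem_iff[OF e] by (auto split: prod.splits)
  qed
  have H: "(if x \<in> L then acc_step pm.Mq x else rej_step pm.Mq x) sums 1" for x
  proof -
    obtain k where k: "\<And>t. 0 < t \<Longrightarrow> t \<le> k \<Longrightarrow> fst ((tnext x ^^ t) (Node q0 m, 0, 0)) \<notin> halt A \<union> halt R"
      "fst ((tnext x ^^ Suc k) (Node q0 m, 0, 0)) \<in> halt (if x \<in> L then A else R)"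
      using tour_halts[of x] by auto
    show ?thesis
    proof (rule pm.halting_run[of k])
      show "fst ((pm.nxt x ^^ t) (e (Node q0 m), 0, 0)) \<notin> ?A \<union> ?R" if "0 < t" "t \<le> k" for t
        using k(1)[OF that] fe[OF AQ] fe[OF RQ] by auto
      show "fst ((pm.nxt x ^^ Suc k) (e (Node q0 m), 0, 0)) \<in> (if x \<in> L then ?A else ?R)"
        using k(2) fe[OF AQ, where t = "Suc k"] fe[OF RQ, where t = "Suc k"] by (auto split: if_splits simp del: funpow.simps)
    qed
  qed
  have "(x \<in> L \<longrightarrow> acc_step pm.Mq x sums 1) \<and> (x \<notin> L \<longrightarrow> rej_step pm.Mq x sums 1)" for x
    using H[of x] by auto
  thus ?thesis using pm.is_2R1CA pm.is_simple by blast
qed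

end

section \<open>Carrying a right-to-left annotation along with the head\<close>

text \<open>A move to the right with annotation \<open>X\<close> must find the true one among the annotations \<open>y\<close> with
  \<open>g \<sigma> y = X\<close>. \<open>Srch\<close> moves right with a relation from annotations of the current position to the
  candidates \<open>y\<close> they lead to, until one candidate is left; \<open>Ret\<close> then follows two annotations leading
  to different candidates back to the left until they merge. A move to the left is performed only
  after the move back to the right has been checked to restore the old annotation (third component of the context);
  otherwise wrong annotations could turn into correct ones and enlarge the predecessor trees.\<close>

datatype ('q, 'b) ann_state =
    GoEnd | Comp 'b | Main 'q 'b
  | Start "'q \<times> 'b \<times> 'b option"
  | Srch "'q \<times> 'b \<times> 'b option" "('b \<times> 'b) set"
  | Ret "'q \<times> 'b \<times> 'b option" 'b 'b
  | Fin "'q \<times> 'b \<times> 'b option" 'b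

text \<open>\<open>\<gamma> x b\<close> is the state of the finite automaton \<open>g\<close>,
  started in \<open>\<iota>\<close> at the right end, after reading the letters strictly to the
  right of \<open>b\<close>.\<close>

locale annotated =
  fixes \<delta> :: "('q, 'a, 'b) lmach" and Q :: "'q set" and q0 :: 'q and A R :: "'q set" and L :: "'a list set"
    and \<gamma> :: "'a list \<Rightarrow> int \<Rightarrow> 'b" and g :: "'a tsym \<Rightarrow> 'b \<Rightarrow> 'b" and \<iota> :: 'b and B :: "'b set"
  assumes dec: "decides \<delta> Q q0 A R \<gamma> L" and tame: "tame \<delta> Q q0 \<gamma>"
    and finB: "finite B" and \<iota>B: "\<iota> \<in> B" and gB: "\<And>\<sigma> \<beta>. \<beta> \<in> B \<Longrightarrow> g \<sigma> \<beta> \<in> B"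
    and \<gamma>_end: "\<And>x. \<gamma> x (int (length x) + 1) = \<iota>"
    and \<gamma>_step: "\<And>x b. 0 < b \<Longrightarrow> b \<le> int (length x) + 1 \<Longrightarrow> \<gamma> x (b - 1) = g (tape x (nat b)) (\<gamma> x b)"
begin

lemma good: "good \<delta> Q" and q0Q: "q0 \<in> Q" and AQ: "A \<subseteq> Q" and RQ: "R \<subseteq> Q" and AR: "A \<inter> R = {}"
  and final: "\<And>q \<sigma> \<beta> z. q \<in> A \<union> R \<Longrightarrow> \<delta> q \<sigma> \<beta> z = None"
  and run: "\<exists>u. ((q0, 0, 0), u) \<in> (stp \<delta> Q x (\<gamma> x))\<^sup>* \<and> fst u \<in> (if x \<in> L then A else R)"
  using dec unfolding decides_def by auto

text \<open>A search is decided once a single candidate is left, or at the right end, where the true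
  annotation is known to be \<open>\<iota>\<close>. In a genuine search, \<open>None\<close> at
  \<open>Dollar\<close> reveals that the given annotation was false.\<close>

definition res :: "'a tsym \<Rightarrow> ('b \<times> 'b) set \<Rightarrow> 'b option" where
  "res \<sigma> \<phi> = (if \<sigma> = Dollar then (if \<exists>y. (\<iota>, y) \<in> \<phi> then Some (SOME y. (\<iota>, y) \<in> \<phi>) else None)
     else if \<exists>y. Range \<phi> = {y} then Some (SOME y. Range \<phi> = {y}) else None)"

definition pre :: "'a tsym \<Rightarrow> 'b \<Rightarrow> ('b \<times> 'b) set" where
  "pre \<sigma> X = {(y, y) |y. y \<in> B \<and> g \<sigma> y = X}"

text \<open>As \<open>g\<close> is deterministic, the relation stays a partial function from
  annotations of the head position to candidates; a further letter can only lose candidates.\<close>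

definition ext :: "'a tsym \<Rightarrow> ('b \<times> 'b) set \<Rightarrow> ('b \<times> 'b) set" where
  "ext \<sigma> \<phi> = {(s, y). s \<in> B \<and> (g \<sigma> s, y) \<in> \<phi>}"

definition fork :: "('b \<times> 'b) set \<Rightarrow> 'b \<Rightarrow> 'b \<times> 'b \<Rightarrow> bool" where
  "fork \<phi> y = (\<lambda>(s1, s2). s1 \<in> B \<and> s2 \<in> B \<and> (s1, y) \<in> \<phi> \<and> (\<exists>y2. y2 \<noteq> y \<and> (s2, y2) \<in> \<phi>))"

fun \<delta>1 :: "(('q, 'b) ann_state, 'a, unit) lmach" where
  "\<delta>1 GoEnd \<sigma> _ z = (if \<sigma> = Dollar then Some (Comp \<iota>, 0, 0) else Some (GoEnd, 0, 1))"
| "\<delta>1 (Comp \<beta>) \<sigma> _ z = (if \<sigma> = Cent then Some (Main q0 \<beta>, 0, 0) else Some (Comp (g \<sigma> \<beta>), 0, -1))"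
| "\<delta>1 (Main q \<beta>) \<sigma> _ z = (case \<delta> q \<sigma> \<beta> z of None \<Rightarrow> None | Some (p, c, d) \<Rightarrow>
     if d = 0 then Some (Main p \<beta>, c, 0)
     else if d = 1 then Some (Start (p, \<beta>, None), c, 1)
     else Some (Start (p, g \<sigma> \<beta>, Some \<beta>), c, 0))"
| "\<delta>1 (Start k) \<sigma> _ z = (let \<phi> = pre \<sigma> (fst (snd k)) in case res \<sigma> \<phi> of Some y \<Rightarrow> Some (Fin k y, 0, 0)
     | None \<Rightarrow> if \<sigma> = Dollar then None else Some (Srch k \<phi>, 0, 1))"
| "\<delta>1 (Srch k \<phi>) \<sigma> _ z = (let \<phi>' = ext \<sigma> \<phi> in case res \<sigma> \<phi>' of
       Some y \<Rightarrow> if \<sigma> \<noteq> Cent \<and> (\<exists>p. fork \<phi> y p) then (case SOME p. fork \<phi> y p of (s1, s2) \<Rightarrow> Some (Ret k s1 s2, 0, -1)) else None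
     | None \<Rightarrow> if \<sigma> = Dollar then None else Some (Srch k \<phi>', 0, 1))"
| "\<delta>1 (Ret k s1 s2) \<sigma> _ z = (if g \<sigma> s1 = g \<sigma> s2 then Some (Fin k s1, 0, 0)
     else if \<sigma> = Cent then None else Some (Ret k (g \<sigma> s1) (g \<sigma> s2), 0, -1))"
| "\<delta>1 (Fin k y) \<sigma> _ z = (case k of (p, X, None) \<Rightarrow> Some (Main p y, 0, 0)
     | (p, X, Some \<beta>) \<Rightarrow> if y = \<beta> \<and> \<sigma> \<noteq> Cent then Some (Main p X, 0, -1) else None)"

definition ctxs :: "('q \<times> 'b \<times> 'b option) set" where
  "ctxs = Q \<times> B \<times> insert None (Some ` B)"

definition Q1 :: "('q, 'b) ann_state set" where
  "Q1 = insert GoEnd (Comp ` B) \<union> (\<lambda>(q, \<beta>). Main q \<beta>) ` (Q \<times> B) \<union> Start ` ctxs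
    \<union> (\<lambda>(k, \<phi>). Srch k \<phi>) ` (ctxs \<times> Pow (B \<times> B)) \<union> (\<lambda>(k, s1, s2). Ret k s1 s2) ` (ctxs \<times> B \<times> B)
    \<union> (\<lambda>(k, y). Fin k y) ` (ctxs \<times> B)"

lemma Q1_iff [simp]:
  "GoEnd \<in> Q1" "Comp \<beta> \<in> Q1 \<longleftrightarrow> \<beta> \<in> B" "Main q \<beta> \<in> Q1 \<longleftrightarrow> q \<in> Q \<and> \<beta> \<in> B" "Start k \<in> Q1 \<longleftrightarrow> k \<in> ctxs"
  "Srch k \<phi> \<in> Q1 \<longleftrightarrow> k \<in> ctxs \<and> \<phi> \<subseteq> B \<times> B" "Ret k s1 s2 \<in> Q1 \<longleftrightarrow> k \<in> ctxs \<and> s1 \<in> B \<and> s2 \<in> B"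
  "Fin k y \<in> Q1 \<longleftrightarrow> k \<in> ctxs \<and> y \<in> B"
  by (auto simp: Q1_def image_iff)

lemma ctxs_iff: "(p, X, m) \<in> ctxs \<longleftrightarrow> p \<in> Q \<and> X \<in> B \<and> (m = None \<or> (\<exists>\<beta>\<in>B. m = Some \<beta>))"
  by (auto simp: ctxs_def)

lemma res_Range: "res \<sigma> \<phi> = Some y \<Longrightarrow> y \<in> Range \<phi>"
  unfolding res_def by (auto split: if_splits intro: someI2)

lemma res_Dollar: "res Dollar \<phi> = Some y \<Longrightarrow> (\<iota>, y) \<in> \<phi>"
  unfolding res_def by (auto split: if_splits intro: someI2)

lemma res_Some: "\<sigma> \<noteq> Dollar \<Longrightarrow> res \<sigma> \<phi> = Some y \<Longrightarrow> Range \<phi> = {y}"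
  unfolding res_def by (auto split: if_splits)

lemma res_None: "\<sigma> \<noteq> Dollar \<Longrightarrow> res \<sigma> \<phi> = None \<Longrightarrow> Range \<phi> \<noteq> {y}"
  unfolding res_def by (auto split: if_splits)

lemma pre_sub: "pre \<sigma> X \<subseteq> B \<times> B" by (auto simp: pre_def)

lemma ext_sub: "\<phi> \<subseteq> B \<times> B \<Longrightarrow> ext \<sigma> \<phi> \<subseteq> B \<times> B" by (auto simp: ext_def)

lemma good1: "good \<delta>1 Q1"
  unfolding good_def
proof (intro conjI ballI allI impI)
  have "finite ctxs" using finB good by (auto simp: ctxs_def good_def)
  thus "finite Q1" using finB good unfolding Q1_def good_def by auto
next
  fix r \<sigma> \<beta>' z r' c d assume r: "r \<in> Q1" "\<delta>1 r \<sigma> \<beta>' z = Some (r', c, d)"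
  have "r' \<in> Q1 \<and> c \<in> incs \<and> d \<in> incs \<and> (\<sigma> = Cent \<longrightarrow> d \<noteq> - 1) \<and> (\<sigma> = Dollar \<longrightarrow> d \<noteq> 1)"
  proof (cases r)
    case (Main q \<beta>)
    then obtain p e f where k: "\<delta> q \<sigma> \<beta> z = Some (p, e, f)" using r(2) by (auto split: option.splits)
    show ?thesis using goodD[OF good _ k] r Main k gB[of \<beta> \<sigma>] by (auto split: if_splits simp: ctxs_iff incs_def)
  next
    case (Start k)
    show ?thesis using r Start pre_sub[of \<sigma> "fst (snd k)"] res_Range[of \<sigma> "pre \<sigma> (fst (snd k))"]
      by (auto simp: incs_def Let_def split: option.splits if_splits)
  next
    case (Srch k \<phi>)
    have \<phi>: "\<phi> \<subseteq> B \<times> B" "k \<in> ctxs" using r Srch by auto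
    show ?thesis
    proof (cases "res \<sigma> (ext \<sigma> \<phi>)")
      case None
      thus ?thesis using r Srch ext_sub[OF \<phi>(1)] \<phi> by (auto simp: incs_def Let_def split: if_splits)
    next
      case (Some y)
      hence f: "\<sigma> \<noteq> Cent" "\<exists>p. fork \<phi> y p" using r Srch by (auto simp: Let_def split: if_splits)
      obtain s1 s2 where s: "(SOME p. fork \<phi> y p) = (s1, s2)" by (meson surj_pair)
      have "fork \<phi> y (s1, s2)" using someI_ex[OF f(2)] s by simp
      thus ?thesis using r Srch Some f s \<phi> by (auto simp: incs_def Let_def fork_def split: if_splits)
    qed
  next
    case (Fin k y)
    obtain p X m where "k = (p, X, m)" by (cases k)
    thus ?thesis using r Fin by (cases m) (auto simp: incs_def ctxs_iff split: if_splits)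
  qed (use r gB \<iota>B q0Q in \<open>auto simp: incs_def split: if_splits\<close>)
  thus "r' \<in> Q1" "c \<in> incs" "d \<in> incs" "\<sigma> = Cent \<Longrightarrow> d \<noteq> - 1" "\<sigma> = Dollar \<Longrightarrow> d \<noteq> 1" by auto
qed

section \<open>Recovering an annotation by search and return\<close>

abbreviation "step1 x \<equiv> gstep \<delta>1 x (\<lambda>_. ())"
abbreviation "S1 x \<equiv> stp \<delta>1 Q1 x (\<lambda>_. ())"

definition main :: "('q, 'b) ann_state \<times> int \<times> int \<Rightarrow> bool" where
  "main u \<longleftrightarrow> (\<exists>q \<beta>. fst u = Main q \<beta>)"

text \<open>Time between two \<open>Main\<close> configurations: rightward phases count
  \<open>b\<close>, leftward ones \<open>-b\<close>, and multiples of the tape length separate the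
  phases. It bounds a search forwards as well as a backward path that avoids
  \<open>Main\<close>.\<close>

fun rank :: "'a list \<Rightarrow> ('q, 'b) ann_state \<times> int \<times> int \<Rightarrow> int" where
  "rank x (GoEnd, a, b) = b"
| "rank x (Comp \<beta>, a, b) = 2 * (int (length x) + 2) - b"
| "rank x (Main q \<beta>, a, b) = 0"
| "rank x (Start k, a, b) = 0"
| "rank x (Srch k \<phi>, a, b) = b"
| "rank x (Ret k s1 s2, a, b) = 2 * (int (length x) + 2) - b"
| "rank x (Fin k y, a, b) = 3 * (int (length x) + 2)"

lemma rank_step:
  assumes "u \<in> vconf Q1 x" "step1 x u = Some v" "\<not> main u" "\<not> main v"
  shows "rank x u < rank x v"
proof -
  obtain r a b where u: "u = (r, a, b)" by (cases u)
  obtain r' c d where v: "\<delta>1 r (tape x (nat b)) () (a = 0) = Some (r', c, d)" "v = (r', a + c, b + d)"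
    using assms(2) unfolding u gstep_iff by blast
  have b: "0 \<le> b" "b \<le> int (length x) + 1" using assms(1) by (auto simp: u vconf_iff)
  have nm: "\<And>q \<beta>. r \<noteq> Main q \<beta>" "\<And>q \<beta>. r' \<noteq> Main q \<beta>" using assms(3,4) by (auto simp: main_def u v)
  show ?thesis using b v(1) nm unfolding u v(2)
    by (cases r) (auto simp: Let_def split: if_splits option.splits prod.splits)
qed

lemma rank_bounds: "u \<in> vconf Q1 x \<Longrightarrow> 0 \<le> rank x u \<and> rank x u \<le> 3 * (int (length x) + 2)"
  by (cases u; cases "fst u") (auto simp: vconf_iff)

lemma \<gamma>B: "0 \<le> b \<Longrightarrow> b \<le> int (length x) + 1 \<Longrightarrow> \<gamma> x b \<in> B"
proof -
  have "k \<le> length x + 1 \<Longrightarrow> \<gamma> x (int (length x) + 1 - int k) \<in> B" for k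
  proof (induction k)
    case (Suc k)
    thus ?case using \<gamma>_step[of "int (length x) + 1 - int k" x] gB by (auto simp: algebra_simps)
  qed (use \<gamma>_end \<iota>B in auto)
  from this[of "nat (int (length x) + 1 - b)"] show "0 \<le> b \<Longrightarrow> b \<le> int (length x) + 1 \<Longrightarrow> \<gamma> x b \<in> B" by simp
qed

text \<open>The relation held by a search that started at \<open>b\<close>, after \<open>k\<close>
  letters to the right: a pair \<open>(s, y)\<close> means that annotation \<open>s\<close> at
  \<open>b + int k\<close> would force candidate \<open>y\<close> at \<open>b\<close>.\<close>

primrec phi :: "'a list \<Rightarrow> int \<Rightarrow> 'b \<Rightarrow> nat \<Rightarrow> ('b \<times> 'b) set" where
  "phi x b X 0 = pre (tape x (nat b)) X"
| "phi x b X (Suc k) = ext (tape x (nat (b + int k + 1))) (phi x b X k)"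

lemma phi_sub: "phi x b X k \<subseteq> B \<times> B"
  by (induction k) (auto simp: pre_def ext_def)

lemma phi_fun: "(s, y) \<in> phi x b X k \<Longrightarrow> (s, y') \<in> phi x b X k \<Longrightarrow> y = y'"
  by (induction k arbitrary: s) (auto simp: pre_def ext_def)

lemma phi_val: "(s, y) \<in> phi x b X k \<Longrightarrow> y \<in> B \<and> g (tape x (nat b)) y = X"
  by (induction k arbitrary: s) (auto simp: pre_def ext_def)

lemma phi_true:
  assumes "0 < b" "b + int k \<le> int (length x) + 1" "X = \<gamma> x (b - 1)"
  shows "(\<gamma> x (b + int k), \<gamma> x b) \<in> phi x b X k"
  using assms(2)
proof (induction k)
  case 0
  thus ?case using assms \<gamma>_step[of b x] \<gamma>B[of b x] by (auto simp: pre_def)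
next
  case (Suc k)
  thus ?case using assms(1) \<gamma>_step[of "b + int k + 1" x] \<gamma>B[of "b + int k + 1" x]
    by (auto simp: ext_def algebra_simps)
qed

text \<open>\<open>X = fst (snd k)\<close> is the alleged annotation of \<open>b - 1\<close> and may
  be false. A result \<open>y\<close> is claimed to be true only if \<open>X\<close> is, but it
  always satisfies \<open>g \<sigma> y = X\<close>. In \<open>srch\<close> the relation belongs to
  the cell left of the head, whose own letter is still to be used.\<close>

inductive routine :: "'a list \<Rightarrow> 'q \<times> 'b \<times> 'b option \<Rightarrow> int \<Rightarrow> int \<Rightarrow> ('q, 'b) ann_state \<times> int \<times> int \<Rightarrow> bool"
  for x k a b where
  start: "routine x k a b (Start k, a, b)"
| srch: "b + int j \<le> int (length x) \<Longrightarrow> (\<And>y. Range (phi x b (fst (snd k)) j) \<noteq> {y}) \<Longrightarrow>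
    routine x k a b (Srch k (phi x b (fst (snd k)) j), a, b + int j + 1)"
| ret: "b + int j \<le> int (length x) \<Longrightarrow> (s1, y) \<in> phi x b (fst (snd k)) j \<Longrightarrow> (s2, y2) \<in> phi x b (fst (snd k)) j \<Longrightarrow>
    y \<noteq> y2 \<Longrightarrow> (fst (snd k) = \<gamma> x (b - 1) \<Longrightarrow> y = \<gamma> x b) \<Longrightarrow> routine x k a b (Ret k s1 s2, a, b + int j)"
| fin: "y \<in> B \<Longrightarrow> g (tape x (nat b)) y = fst (snd k) \<Longrightarrow> (fst (snd k) = \<gamma> x (b - 1) \<Longrightarrow> y = \<gamma> x b) \<Longrightarrow>
    routine x k a b (Fin k y, a, b)"

lemma res_true:
  assumes "0 < b" "b + int j \<le> int (length x) + 1" "X = \<gamma> x (b - 1)" "res (tape x (nat (b + int j))) (phi x b X j) = Some y"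
  shows "y = \<gamma> x b"
proof (cases "tape x (nat (b + int j)) = Dollar")
  case True
  hence "\<gamma> x (b + int j) = \<iota>" using \<gamma>_end assms(1) by (auto simp: tape_Dollar_iff)
  thus ?thesis using phi_true[OF assms(1-3)] res_Dollar assms(4) True phi_fun by metis
next
  case False
  have "\<gamma> x b \<in> Range (phi x b X j)" using phi_true[OF assms(1-3)] by (rule RangeI)
  thus ?thesis using res_Some[OF False assms(4)] by simp
qed

lemma fork_ex:
  assumes "y \<in> Range \<phi>" "Range \<phi> \<noteq> {y}" "\<phi> \<subseteq> B \<times> B"
  shows "\<exists>p. fork \<phi> y p"
proof -
  obtain s1 where "(s1, y) \<in> \<phi>" using assms(1) by auto
  moreover obtain s2 y2 where "(s2, y2) \<in> \<phi>" "y2 \<noteq> y" using assms(1,2) by auto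
  ultimately show ?thesis using assms(3) unfolding fork_def by (intro exI[of _ "(s1, s2)"]) auto
qed

text \<open>The merging of the two followed states happens exactly at the position where the search started.\<close>
lemma routine_step:
  assumes "routine x k a b u" "0 < b" "b \<le> int (length x) + 1"
  shows "(\<exists>y. u = (Fin k y, a, b)) \<or> (\<exists>v. step1 x u = Some v \<and> routine x k a b v) \<or>
    step1 x u = None \<and> fst (snd k) \<noteq> \<gamma> x (b - 1)"
  using assms(1)
proof cases
  case start
  let ?\<sigma> = "tape x (nat b)" and ?X = "fst (snd k)"
  show ?thesis
  proof (cases "res ?\<sigma> (pre ?\<sigma> ?X)")
    case None
    show ?thesis
    proof (cases "?\<sigma> = Dollar")
      case True
      have "?X \<noteq> \<gamma> x (b - 1)"
      proof
        assume "?X = \<gamma> x (b - 1)"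
        hence "(\<gamma> x b, \<gamma> x b) \<in> pre ?\<sigma> ?X" using phi_true[of b 0 x ?X] assms by simp
        moreover have "\<gamma> x b = \<iota>" using True \<gamma>_end assms by (auto simp: tape_Dollar_iff)
        ultimately show False using None True by (auto simp: res_def split: if_splits)
      qed
      thus ?thesis using None True start by (auto simp: gstep_def)
    next
      case False
      hence "b \<le> int (length x)" using assms tape_Dollar_iff[of b x] by simp
      hence "routine x k a b (Srch k (pre ?\<sigma> ?X), a, b + 1)"
        using routine.srch[of b 0 x k a] res_None[OF False None] by simp
      thus ?thesis using None False start by (auto simp: gstep_iff)
    qed
  next
    case (Some y)
    have "y \<in> B \<and> g ?\<sigma> y = ?X" using res_Range[OF Some] phi_val[of _ y x b ?X 0] by auto
    hence "routine x k a b (Fin k y, a, b)" using res_true[of b 0 x ?X y] assms Some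
      by (intro routine.fin) auto
    thus ?thesis using Some start by (auto simp: gstep_iff)
  qed
next
  case (srch j)
  let ?\<sigma> = "tape x (nat (b + int j + 1))" and ?X = "fst (snd k)"
  let ?\<phi> = "phi x b ?X j"
  have e: "ext ?\<sigma> ?\<phi> = phi x b ?X (Suc j)" by simp
  have nC: "?\<sigma> \<noteq> Cent" using assms by (simp add: tape_Cent_iff)
  show ?thesis
  proof (cases "res ?\<sigma> (ext ?\<sigma> ?\<phi>)")
    case None
    show ?thesis
    proof (cases "?\<sigma> = Dollar")
      case True
      have "?X \<noteq> \<gamma> x (b - 1)"
      proof
        assume "?X = \<gamma> x (b - 1)"
        hence "(\<gamma> x (b + int (Suc j)), \<gamma> x b) \<in> ext ?\<sigma> ?\<phi>" using phi_true[of b "Suc j" x ?X] assms srch unfolding e by simp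
        moreover have "\<gamma> x (b + int (Suc j)) = \<iota>" using True \<gamma>_end assms by (auto simp: tape_Dollar_iff algebra_simps)
        ultimately show False using None True by (auto simp: res_def split: if_splits)
      qed
      thus ?thesis using None True srch by (auto simp: gstep_def)
    next
      case False
      hence "b + int (Suc j) \<le> int (length x)" using assms srch tape_Dollar_iff[of "b + int j + 1" x] by simp
      hence "routine x k a b (Srch k (ext ?\<sigma> ?\<phi>), a, b + int j + 2)"
        using routine.srch[of b "Suc j" x k a] res_None[OF False None] unfolding e by (simp add: algebra_simps)
      thus ?thesis using None False srch by (auto simp: gstep_iff algebra_simps)
    qed
  next
    case (Some y)
    have "Range (ext ?\<sigma> ?\<phi>) \<subseteq> Range ?\<phi>" by (auto simp: ext_def)
    hence "y \<in> Range ?\<phi>" using res_Range[OF Some] by blast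
    \<comment> \<open>Before this letter \<open>y\<close> was not the only candidate, so a second
      one is available to fork with.\<close>
    hence f: "\<exists>p. fork ?\<phi> y p" using fork_ex[OF _ srch(3) phi_sub] by blast
    obtain s1 s2 where s: "(SOME p. fork ?\<phi> y p) = (s1, s2)" by (meson surj_pair)
    have "fork ?\<phi> y (s1, s2)" using someI_ex[OF f] s by simp
    then obtain y2 where y2: "(s1, y) \<in> ?\<phi>" "(s2, y2) \<in> ?\<phi>" "y \<noteq> y2" unfolding fork_def by auto
    have tr: "y = \<gamma> x b" if "?X = \<gamma> x (b - 1)"
      using res_true[of b "Suc j" x ?X y] that assms srch Some unfolding e by (simp add: algebra_simps)
    have "routine x k a b (Ret k s1 s2, a, b + int j)" by (rule routine.ret[OF srch(2) y2 tr])
    thus ?thesis using Some f s srch nC by (auto simp: gstep_iff)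
  qed
next
  case (ret j s1 y s2 y2)
  let ?\<sigma> = "tape x (nat (b + int j))" and ?X = "fst (snd k)"
  show ?thesis
  proof (cases j)
    case 0
    \<comment> \<open>At offset 0 the two followed annotations are themselves candidates, both
      mapped to \<open>X\<close>, so they merge.\<close>
    have "s1 = y" "s2 = y2" "g ?\<sigma> s1 = ?X" "g ?\<sigma> s2 = ?X" "y \<in> B" using ret 0 by (auto simp: pre_def)
    moreover from this have "routine x k a b (Fin k y, a, b)" using ret 0 by (intro routine.fin) auto
    ultimately show ?thesis using ret 0 by (auto simp: gstep_iff)
  next
    case (Suc i)
    have s: "(g ?\<sigma> s1, y) \<in> phi x b ?X i" "(g ?\<sigma> s2, y2) \<in> phi x b ?X i" using ret Suc by (auto simp: ext_def algebra_simps)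
    \<comment> \<open>To the right of \<open>b\<close> the relation is still a function with two
      different values here, so its arguments differ and no merging can occur too early.\<close>
    hence ne: "g ?\<sigma> s1 \<noteq> g ?\<sigma> s2" using phi_fun ret by metis
    have "?\<sigma> \<noteq> Cent" using assms by (simp add: tape_Cent_iff)
    moreover have "routine x k a b (Ret k (g ?\<sigma> s1) (g ?\<sigma> s2), a, b + int i)" 
      using routine.ret[OF _ s ret(5,6)] ret(2) Suc by simp
    ultimately show ?thesis using ret Suc ne by (auto simp: gstep_iff)
  qed
qed auto

lemma routine_not_main: "routine x k a b u \<Longrightarrow> \<not> main u"
  by (cases rule: routine.cases) (auto simp: main_def)

lemma routine_forward:
  assumes "routine x k a b u" "u \<in> vconf Q1 x" "0 < b" "b \<le> int (length x) + 1" "fst (snd k) = \<gamma> x (b - 1)"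
  shows "(u, (Fin k (\<gamma> x b), a, b)) \<in> (S1 x)\<^sup>*"
  using assms(1,2)
proof (induction "nat (3 * (int (length x) + 2) - rank x u)" arbitrary: u rule: less_induct)
  case less
  consider y where "u = (Fin k y, a, b)" | v where "step1 x u = Some v" "routine x k a b v"
    using routine_step[OF less(2) assms(3,4)] assms(5) by auto
  thus ?case
  proof cases
    case 1
    have "y = \<gamma> x b" using less(2)[unfolded 1] assms(5) by (cases rule: routine.cases) auto
    thus ?thesis using 1 by simp
  next
    case 2
    have v: "v \<in> vconf Q1 x" using vconf_step[OF good1 less(3) 2(1)] .
    have "rank x u < rank x v" using rank_step[OF less(3) 2(1)] routine_not_main less(2) 2(2) by auto
    hence "(v, (Fin k (\<gamma> x b), a, b)) \<in> (S1 x)\<^sup>*" using less(1)[OF _ 2(2) v] rank_bounds[OF v] by auto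
    thus ?thesis using 2(1) less(3) by (intro converse_rtrancl_into_rtrancl[of u v]) (auto simp: stp_def)
  qed
qed

definition emb :: "'a list \<Rightarrow> 'q \<times> int \<times> int \<Rightarrow> ('q, 'b) ann_state \<times> int \<times> int" where
  "emb x = (\<lambda>(q, a, b). (Main q (\<gamma> x b), a, b))"

lemma emb_step:
  assumes "(u, v) \<in> stp \<delta> Q x (\<gamma> x)"
  shows "(emb x u, emb x v) \<in> (S1 x)\<^sup>*"
proof -
  obtain q a b where u: "u = (q, a, b)" by (cases u)
  obtain p c d where v: "\<delta> q (tape x (nat b)) (\<gamma> x b) (a = 0) = Some (p, c, d)" "v = (p, a + c, b + d)"
    using assms unfolding u stp_def by (auto simp: gstep_iff)
  have uv: "u \<in> vconf Q x" "v \<in> vconf Q x" using stp_vconf[OF good assms] by auto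
  have ev: "emb x w \<in> vconf Q1 x" if "w \<in> vconf Q x" for w
    using that \<gamma>B by (cases w) (auto simp: emb_def vconf_iff)
  have q: "q \<in> Q" using uv u by (auto simp: vconf_iff)
  have d: "d \<in> incs" using goodD[OF good q v(1)] by simp
  consider "d = 0" | "d = 1" | "d = -1" using d by (auto simp: incs_def)
  thus ?thesis
  proof cases
    case 1
    have "(emb x u, emb x v) \<in> S1 x" using v 1 ev[OF uv(1)] by (auto simp: stp_def emb_def u gstep_iff)
    thus ?thesis by simp
  next
    case 2
    let ?k = "(p, \<gamma> x b, None)"
    have b: "0 < b + 1" "b + 1 \<le> int (length x) + 1" using uv v(2) u 2 by (auto simp: vconf_iff)
    have s: "step1 x (emb x u) = Some (Start ?k, a + c, b + 1)" using v 2 by (simp add: emb_def u gstep_def)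
    have s': "(emb x u, (Start ?k, a + c, b + 1)) \<in> S1 x" using s ev[OF uv(1)] by (auto simp: stp_def)
    have "((Start ?k, a + c, b + 1), (Fin ?k (\<gamma> x (b + 1)), a + c, b + 1)) \<in> (S1 x)\<^sup>*"
      using routine_forward[OF routine.start vconf_step[OF good1 ev[OF uv(1)] s] b] by simp
    moreover from s' this have "(Fin ?k (\<gamma> x (b + 1)), a + c, b + 1) \<in> vconf Q1 x"
      using stps_vconf[OF good1 _ ev[OF uv(1)]] by (meson converse_rtrancl_into_rtrancl)
    hence "((Fin ?k (\<gamma> x (b + 1)), a + c, b + 1), emb x v) \<in> S1 x"
      by (auto simp: stp_def gstep_def emb_def v 2)
    ultimately show ?thesis using s' by (meson converse_rtrancl_into_rtrancl rtrancl.rtrancl_into_rtrancl)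
  next
    case 3
    let ?k = "(p, g (tape x (nat b)) (\<gamma> x b), Some (\<gamma> x b))"
    have b: "0 < b" "b \<le> int (length x) + 1" using uv v(2) u 3 by (auto simp: vconf_iff)
    have s: "step1 x (emb x u) = Some (Start ?k, a + c, b)" using v 3 by (simp add: emb_def u gstep_def)
    have s': "(emb x u, (Start ?k, a + c, b)) \<in> S1 x" using s ev[OF uv(1)] by (auto simp: stp_def)
    have "((Start ?k, a + c, b), (Fin ?k (\<gamma> x b), a + c, b)) \<in> (S1 x)\<^sup>*"
      using routine_forward[OF routine.start vconf_step[OF good1 ev[OF uv(1)] s] b] \<gamma>_step[OF b] by simp
    moreover from s' this have "(Fin ?k (\<gamma> x b), a + c, b) \<in> vconf Q1 x"
      using stps_vconf[OF good1 _ ev[OF uv(1)]] by (meson converse_rtrancl_into_rtrancl)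
    hence "((Fin ?k (\<gamma> x b), a + c, b), emb x v) \<in> S1 x"
      using b \<gamma>_step[OF b] by (auto simp: stp_def gstep_def emb_def v 3 tape_Cent_iff)
    ultimately show ?thesis using s' by (meson converse_rtrancl_into_rtrancl rtrancl.rtrancl_into_rtrancl)
  qed
qed

lemma emb_steps: "(u, v) \<in> (stp \<delta> Q x (\<gamma> x))\<^sup>* \<Longrightarrow> (emb x u, emb x v) \<in> (S1 x)\<^sup>*"
  by (induction rule: rtrancl_induct) (auto intro: rtrancl_trans dest: emb_step)

lemma init_run: "((GoEnd, 0, 0), emb x (q0, 0, 0)) \<in> (S1 x)\<^sup>*"
proof -
  let ?n = "int (length x) + 1"
  have 1: "k \<le> length x + 1 \<Longrightarrow> ((GoEnd, 0, 0), (GoEnd, 0, int k)) \<in> (S1 x)\<^sup>*" for k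
  proof (induction k)
    case (Suc k)
    hence "((GoEnd, 0, int k), (GoEnd, 0, int (Suc k))) \<in> S1 x"
      using tape_Dollar_iff[of "int k" x] by (auto simp: stp_def vconf_iff gstep_def)
    thus ?case using Suc by (meson Suc_leD rtrancl.rtrancl_into_rtrancl)
  qed simp
  have 2: "((GoEnd, 0, ?n), (Comp \<iota>, 0, ?n)) \<in> S1 x"
    using tape_Dollar_iff[of ?n x] by (auto simp: stp_def vconf_iff gstep_def)
  have 3: "k \<le> length x + 1 \<Longrightarrow> ((Comp \<iota>, 0, ?n), (Comp (\<gamma> x (?n - int k)), 0, ?n - int k)) \<in> (S1 x)\<^sup>*" for k
  proof (induction k)
    case (Suc k)
    hence "((Comp (\<gamma> x (?n - int k)), 0, ?n - int k), (Comp (\<gamma> x (?n - int (Suc k))), 0, ?n - int (Suc k))) \<in> S1 x"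
      using tape_Cent_iff[of "?n - int k" x] \<gamma>_step[of "?n - int k" x] \<gamma>B[of "?n - int k" x]
      by (auto simp: stp_def vconf_iff gstep_iff algebra_simps)
    thus ?case using Suc by (meson Suc_leD rtrancl.rtrancl_into_rtrancl)
  qed (simp add: \<gamma>_end)
  have 4: "((Comp (\<gamma> x 0), 0, 0), emb x (q0, 0, 0)) \<in> S1 x"
    using \<gamma>B[of 0 x] by (auto simp: stp_def vconf_iff gstep_def emb_def tape_def)
  have 1: "((GoEnd, 0, 0), (GoEnd, 0, ?n)) \<in> (S1 x)\<^sup>*" using 1[of "length x + 1"] by (simp add: algebra_simps)
  have 3: "((Comp \<iota>, 0, ?n), (Comp (\<gamma> x 0), 0, 0)) \<in> (S1 x)\<^sup>*" using 3[of "length x + 1"] by simp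
  from 1 2 3 4 show ?thesis by (meson rtrancl.rtrancl_into_rtrancl rtrancl_trans)
qed

section \<open>Backward paths from correctly annotated configurations\<close>

abbreviation "S1' x \<equiv> {(u, v) \<in> S1 x. \<not> main u}"

text \<open>A search can reach a \<open>Main\<close> configuration only through \<open>Fin\<close>,
  so whatever path leads out carries the invariant \<open>routine\<close> up to its last
  step.\<close>

lemma routine_exit:
  assumes "(u, t) \<in> (S1' x)\<^sup>+" "routine x k a b u" "main t" "0 < b" "b \<le> int (length x) + 1"
  shows "\<exists>y. routine x k a b (Fin k y, a, b) \<and> step1 x (Fin k y, a, b) = Some t"
  using assms(1,2)
proof (induction rule: converse_trancl_induct)
  case (base u)
  hence "step1 x u = Some t" by (simp add: stp_def)
  thus ?case using routine_step[OF base(2) assms(4,5)] routine_not_main[of x k a b t] assms(3) base(2) by auto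
next
  case (step u v)
  have u: "step1 x u = Some v" using step(1) by (simp add: stp_def)
  have "\<not> main v" using step(2) by (metis (no_types, lifting) case_prodD mem_Collect_eq tranclD)
  hence "\<And>y. u \<noteq> (Fin k y, a, b)" using u by (auto simp: gstep_iff main_def split: prod.splits option.splits if_splits)
  hence "routine x k a b v" using routine_step[OF step(4) assms(4,5)] u by auto
  thus ?case using step(3) by blast
qed

text \<open>A true annotation has only true predecessors. After a right move, the result
  \<open>y\<close> is true and the old annotation is \<open>g\<close> of it. Before a left move, the
  search started from an annotation that is now known to be true, so its result is true, and
  \<open>Fin\<close> has compared it with the old annotation \<open>\<beta>\<close>.\<close>

lemma main_pred:
  assumes "(u, v) \<in> S1 x" "main u" "v = emb x w \<or> (v, emb x w) \<in> (S1' x)\<^sup>+" 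
  shows "\<exists>w'. u = emb x w' \<and> (w', w) \<in> stp \<delta> Q x (\<gamma> x)"
proof -
  obtain q \<beta> a b where u: "u = (Main q \<beta>, a, b)" using assms(2) by (cases u) (auto simp: main_def)
  have uv: "q \<in> Q" "\<beta> \<in> B" "0 \<le> b" "b \<le> int (length x) + 1" "step1 x u = Some v" using assms(1) by (auto simp: stp_def u vconf_iff)
  let ?\<sigma> = "tape x (nat b)"
  obtain p c d where k: "\<delta> q ?\<sigma> \<beta> (a = 0) = Some (p, c, d)"
    using uv(5) by (auto simp: u gstep_iff split: option.splits)
  note gd = goodD[OF good uv(1) k]
  have vv: "v \<in> vconf Q1 x" using stp_vconf[OF good1 assms(1)] by simp
  obtain pw aw bw where w: "w = (pw, aw, bw)" by (cases w)
  have ew: "emb x w = (Main pw (\<gamma> x bw), aw, bw)" "main (emb x w)" by (auto simp: w emb_def main_def)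
  consider "d = 0" | "d = 1" | "d = -1" using gd by (auto simp: incs_def)
  thus ?thesis
  proof cases
    case 1
    have v: "v = (Main p \<beta>, a + c, b)" using uv(5) k 1 by (simp add: u gstep_def)
    have "v = emb x w" using assms(3) v by (auto simp: main_def dest: tranclD)
    hence "\<beta> = \<gamma> x b" "w = (p, a + c, b)" using v ew w by auto
    thus ?thesis using k 1 uv by (intro exI[of _ "(q, a, b)"]) (auto simp: u emb_def stp_def gstep_iff vconf_iff)
  next
    case 2
    let ?k = "(p, \<beta>, None)"
    have v: "v = (Start ?k, a + c, b + 1)" using uv(5) k 2 by (simp add: u gstep_def)
    have b: "0 < b + 1" "b + 1 \<le> int (length x) + 1" using vv v uv by (auto simp: vconf_iff)
    have "(v, emb x w) \<in> (S1' x)\<^sup>+" using assms(3) v ew by auto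
    then obtain y where y: "routine x ?k (a + c) (b + 1) (Fin ?k y, a + c, b + 1)" "step1 x (Fin ?k y, a + c, b + 1) = Some (emb x w)"
      using routine_exit[OF _ _ ew(2) b] routine.start v by blast
    have w': "w = (p, a + c, b + 1)" "y = \<gamma> x (b + 1)" using y(2) w ew by (auto simp: gstep_iff)
    have "\<beta> = \<gamma> x b" using y(1) \<gamma>_step[OF b] w' by (cases rule: routine.cases) auto
    thus ?thesis using k 2 uv w' by (intro exI[of _ "(q, a, b)"]) (auto simp: u emb_def stp_def gstep_iff vconf_iff)
  next
    case 3
    let ?k = "(p, g ?\<sigma> \<beta>, Some \<beta>)"
    have v: "v = (Start ?k, a + c, b)" using uv(5) k 3 by (simp add: u gstep_def)
    have b: "0 < b" "b \<le> int (length x) + 1" using uv gd(4) 3 tape_Cent_iff[of b x] by auto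
    have "(v, emb x w) \<in> (S1' x)\<^sup>+" using assms(3) v ew by auto
    then obtain y where y: "routine x ?k (a + c) b (Fin ?k y, a + c, b)" "step1 x (Fin ?k y, a + c, b) = Some (emb x w)"
      using routine_exit[OF _ _ ew(2) b] routine.start v by blast
    have w': "w = (p, a + c, b - 1)" "y = \<beta>" "g ?\<sigma> \<beta> = \<gamma> x (b - 1)" using y(2) w ew by (auto simp: gstep_iff split: if_splits)
    have "y = \<gamma> x b" using y(1) w'(3) by (cases rule: routine.cases) auto
    thus ?thesis using k 3 uv w' by (intro exI[of _ "(q, a, b)"]) (auto simp: u emb_def stp_def gstep_iff vconf_iff)
  qed
qed

text \<open>A backward path consists of stretches without \<open>Main\<close>, along which
  \<open>rank\<close> falls, and of \<open>Main\<close> configurations, which by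
  \<open>main_pred\<close> follow a backward path of \<open>\<delta>\<close>.\<close>

lemma acc_emb:
  assumes "w \<in> Wellfounded.acc (stp \<delta> Q x (\<gamma> x))"
  shows "emb x w \<in> Wellfounded.acc (S1 x)"
  using assms
proof (induction rule: acc_induct_rule)
  case (1 w)
  have lead: "v \<in> Wellfounded.acc (S1 x)" if "(v, emb x w) \<in> (S1' x)\<^sup>+" for v
    using that
  proof (induction "nat (rank x v)" arbitrary: v rule: less_induct)
    case less
    show ?case
    proof (rule accI)
      fix u assume u: "(u, v) \<in> S1 x"
      show "u \<in> Wellfounded.acc (S1 x)"
      proof (cases "main u")
        case True
        thus ?thesis using main_pred[OF u True] less(2) 1(2) by blast
      next
        case False
        have "\<not> main v" using less(2) by (metis (no_types, lifting) case_prodD mem_Collect_eq tranclD)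
        hence "rank x u < rank x v" using u rank_step False by (auto simp: stp_def)
        moreover have "0 \<le> rank x u" using u rank_bounds by (auto simp: stp_def)
        moreover have "(u, emb x w) \<in> (S1' x)\<^sup>+" using u False less(2) by (intro trancl_into_trancl2[of u v]) auto
        ultimately show ?thesis using less(1) by auto
      qed
    qed
  qed
  show ?case
  proof (rule accI)
    fix u assume u: "(u, emb x w) \<in> S1 x"
    show "u \<in> Wellfounded.acc (S1 x)"
    proof (cases "main u")
      case True
      thus ?thesis using main_pred[OF u True] 1(2) by blast
    next
      case False
      thus ?thesis using lead u by blast
    qed
  qed
qed

definition final1 :: "'q set \<Rightarrow> ('q, 'b) ann_state set" where
  "final1 F = (\<lambda>(q, \<beta>). Main q \<beta>) ` (F \<times> B)"

theorem decides1: "decides \<delta>1 Q1 GoEnd (final1 A) (final1 R) (\<lambda>_ _. ()) L"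
  unfolding decides_def
proof (intro conjI ballI allI)
  show "final1 A \<subseteq> Q1" "final1 R \<subseteq> Q1" "final1 A \<inter> final1 R = {}" using AQ RQ AR by (auto simp: final1_def)
  show "\<delta>1 q \<sigma> \<beta> z = None" if "q \<in> final1 A \<union> final1 R" for q \<sigma> \<beta> z
    using that final by (auto simp: final1_def)
  fix x
  obtain u where u: "((q0, 0, 0), u) \<in> (stp \<delta> Q x (\<gamma> x))\<^sup>*" "fst u \<in> (if x \<in> L then A else R)" using run by blast
  have "u \<in> vconf Q x" using stps_vconf[OF good u(1)] q0Q by (auto simp: vconf_iff)
  hence "fst (emb x u) \<in> (if x \<in> L then final1 A else final1 R)" using u(2) \<gamma>B by (cases u) (auto simp: emb_def final1_def vconf_iff)
  thus "\<exists>u. ((GoEnd, 0, 0), u) \<in> (S1 x)\<^sup>* \<and> fst u \<in> (if x \<in> L then final1 A else final1 R)"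
    using rtrancl_trans[OF init_run emb_steps[OF u(1)]] by blast
qed (use good1 in \<open>auto simp: final1_def\<close>)

theorem tame1: "tame \<delta>1 Q1 GoEnd (\<lambda>_ _. ())"
proof (rule tameI[OF decides1])
  fix x v assume v: "((GoEnd, 0, 0), v) \<in> (S1 x)\<^sup>*" "fst v \<in> final1 A \<union> final1 R"
  obtain u where u: "((q0, 0, 0), u) \<in> (stp \<delta> Q x (\<gamma> x))\<^sup>*" "fst u \<in> (if x \<in> L then A else R)" using run by blast
  have a: "emb x u \<in> Wellfounded.acc (S1 x)" using acc_emb tame u(1) unfolding tame_def by blast
  have "fst (emb x u) \<in> final1 A \<union> final1 R"
    using stps_vconf[OF good u(1)] q0Q u(2) \<gamma>B by (cases u) (auto simp: emb_def final1_def vconf_iff split: if_splits)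
  hence "step1 x (emb x u) = None" using final_stuck[OF decides1] by blast
  hence "(v, emb x u) \<in> (S1 x)\<^sup>*" using stp_det[OF v(1) rtrancl_trans[OF init_run emb_steps[OF u(1)]]] by blast
  with a show "v \<in> Wellfounded.acc (S1 x)" by (rule acc_downwards)
qed

end

section \<open>Cutting infinite predecessor paths\<close>

text \<open>In a functional graph there is only one way to continue from a point of a cycle: along
  the cycle.\<close>

lemma subcycle:
  assumes sv: "single_valued r" and sub: "s \<subseteq> r" and cyc: "(m, m) \<in> s\<^sup>+" and "(m, v) \<in> r\<^sup>*"
  shows "(m, v) \<in> s\<^sup>* \<and> (v, m) \<in> s\<^sup>+"
  using assms(4)
proof (induction rule: rtrancl_induct)
  case base
  show ?case using cyc by simp
next
  case (step v w)
  obtain w' where w': "(v, w') \<in> s" "(w', m) \<in> s\<^sup>*" using step(3) tranclD by metis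
  have "w' = w" using sv w'(1) sub step(2) by (auto dest: single_valuedD)
  thus ?case using step(3) w' cyc by (auto intro: rtrancl_into_rtrancl rtrancl_trancl_trancl)
qed

text \<open>\<open>TNode\<close> and \<open>TTry\<close> tour a predecessor tree as in \<^emph>\<open>tour\<close>; their flag records whether counter
  value 0 has been met.\<close>

datatype 'q loop_state = TMain 'q | TNode bool 'q nat | TTry bool 'q nat

locale loops =
  fixes \<delta> :: "('q, 'a, unit) lmach" and Q :: "'q set" and q0 :: 'q and A R :: "'q set" and L :: "'a list set"
    and ks :: "('q \<times> int \<times> int) list" and ord :: "'q \<Rightarrow> nat"
  assumes dec: "decides \<delta> Q q0 A R (\<lambda>_ _. ()) L"
    and ks: "set ks = Q \<times> incs \<times> incs" "distinct ks"
    and ord: "inj_on ord Q"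
begin

lemma good: "good \<delta> Q" and q0Q: "q0 \<in> Q" and q0F: "q0 \<notin> A \<union> R" and AQ: "A \<subseteq> Q" and RQ: "R \<subseteq> Q" and AR: "A \<inter> R = {}"
  and final: "\<And>q \<sigma> \<beta> z. q \<in> A \<union> R \<Longrightarrow> \<delta> q \<sigma> \<beta> z = None"
  and run: "\<exists>u. ((q0, 0, 0), u) \<in> (stp \<delta> Q x (\<lambda>_. ()))\<^sup>* \<and> fst u \<in> (if x \<in> L then A else R)"
  using dec unfolding decides_def by auto

abbreviation "m \<equiv> length ks"
abbreviation "idx \<equiv> index_of ks"
lemmas idx = index_of[OF ks(2)]
lemmas idx_nth = index_of_nth[OF ks(2)]

lemma ks_nth: assumes "i < m" "ks ! i = (p, c, d)" shows "p \<in> Q" "c \<in> incs" "d \<in> incs"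
  using nth_mem[OF assms(1)] assms(2) ks(1) by auto

lemma ks_mem: "q \<in> Q \<Longrightarrow> \<delta> q \<sigma> \<beta> z = Some (p, c, d) \<Longrightarrow> (q, c, d) \<in> set ks"
  using goodD[OF good] ks(1) by auto

text \<open>The functional graph of (state, position) pairs while the counter is nonzero.\<close>

definition flow :: "'a list \<Rightarrow> (('q \<times> int) \<times> ('q \<times> int)) set" where
  "flow x = {((q, b), (p, b')). q \<in> Q \<and> 0 \<le> b \<and> b \<le> int (length x) + 1 \<and>
     (\<exists>c. \<delta> q (tape x (nat b)) () False = Some (p, c, b' - b))}"

definition flow_from :: "'a list \<Rightarrow> int \<Rightarrow> (('q \<times> int) \<times> ('q \<times> int)) set" where
  "flow_from x l = {(u, v) \<in> flow x. l \<le> snd u \<and> l \<le> snd v}"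

text \<open>Shepherdson's crossing table of the tape from \<open>b\<close> to the right, for nonzero
  counter: entering \<open>b\<close> in the first state, the head eventually leaves to
  \<open>b - 1\<close> in the second.\<close>

definition exits :: "'a list \<Rightarrow> int \<Rightarrow> ('q \<times> 'q) set" where
  "exits x b = {(p, p'). \<exists>r. ((p, b), (r, b)) \<in> (flow_from x b)\<^sup>* \<and> ((r, b), (p', b - 1)) \<in> flow x}"

definition \<gamma> :: "'a list \<Rightarrow> int \<Rightarrow> ('q \<times> 'q) set" where
  "\<gamma> x b = exits x (b + 1)"

text \<open>One return to the current cell: a step without head move, or an excursion to the right,
  summarised by its crossing table \<open>F\<close>.\<close>

definition return_rel :: "'a tsym \<Rightarrow> ('q \<times> 'q) set \<Rightarrow> ('q \<times> 'q) set" where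
  "return_rel \<sigma> F = {(p, p'). p \<in> Q \<and> ((\<exists>c. \<delta> p \<sigma> () False = Some (p', c, 0)) \<or> (\<exists>r c. \<delta> p \<sigma> () False = Some (r, c, 1) \<and> (r, p') \<in> F))}"

definition g :: "'a tsym \<Rightarrow> ('q \<times> 'q) set \<Rightarrow> ('q \<times> 'q) set" where
  "g \<sigma> F = {(p, p'). \<exists>r c. (p, r) \<in> (return_rel \<sigma> F)\<^sup>* \<and> r \<in> Q \<and> \<delta> r \<sigma> () False = Some (p', c, -1)}"

text \<open>Returning to the own state means lying on a cycle that never goes left of the current
  cell. Only the letter and the crossing table enter, so the head can decide this.\<close>

definition marked_at :: "'a tsym \<Rightarrow> ('q \<times> 'q) set \<Rightarrow> 'q \<Rightarrow> bool" where
  "marked_at \<sigma> F q \<longleftrightarrow> (q, q) \<in> (return_rel \<sigma> F)\<^sup>+ \<and> (\<forall>p. (q, p) \<in> (return_rel \<sigma> F)\<^sup>+ \<longrightarrow> ord q \<le> ord p)"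

abbreviation "marked x u \<equiv> marked_at (tape x (nat (snd u))) (\<gamma> x (snd u)) (fst u)"

section \<open>Crossing tables describe the flow\<close>

lemma flow_single_valued: "single_valued (flow x)"
  by (auto simp: single_valued_def flow_def)

lemma flow_dist: assumes "((q, b), (p, b')) \<in> flow x" shows "b' = b - 1 \<or> b' = b \<or> b' = b + 1" "q \<in> Q" "p \<in> Q"
proof -
  obtain c where c: "q \<in> Q" "\<delta> q (tape x (nat b)) () False = Some (p, c, b' - b)" using assms by (auto simp: flow_def)
  show "b' = b - 1 \<or> b' = b \<or> b' = b + 1" "q \<in> Q" "p \<in> Q" using goodD[OF good c] c by (auto simp: incs_def)
qed

lemma flow_pos: assumes "((q, b), (p, b')) \<in> flow x" shows "0 \<le> b" "b \<le> int (length x) + 1" "0 \<le> b'" "b' \<le> int (length x) + 1"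
proof -
  obtain c where c: "q \<in> Q" "\<delta> q (tape x (nat b)) () False = Some (p, c, b' - b)" "0 \<le> b" "b \<le> int (length x) + 1"
    using assms by (auto simp: flow_def)
  have "(p, 1 + c, b') \<in> vconf Q x" using vconf_step[OF good, of "(q, 1, b)" x "\<lambda>_. ()"] c
    by (auto simp: vconf_iff gstep_def)
  thus "0 \<le> b" "b \<le> int (length x) + 1" "0 \<le> b'" "b' \<le> int (length x) + 1" using c by (auto simp: vconf_iff)
qed

lemma finite_flow: "finite (flow x)"
proof (rule finite_subset)
  show "flow x \<subseteq> (Q \<times> {0..int (length x) + 1}) \<times> (Q \<times> {0..int (length x) + 1})"
    using flow_dist flow_pos by fastforce
  show "finite \<dots>" using good by (auto simp: good_def)
qed

lemma return_rel_stay: "((p, b), (p', b)) \<in> flow x \<Longrightarrow> (p, p') \<in> return_rel (tape x (nat b)) (\<gamma> x b)"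
  by (auto simp: flow_def return_rel_def)

lemma return_rel_exit: "((p, b), (r, b + 1)) \<in> flow x \<Longrightarrow> (r, p') \<in> exits x (b + 1) \<Longrightarrow> (p, p') \<in> return_rel (tape x (nat b)) (\<gamma> x b)"
  by (auto simp: flow_def return_rel_def \<gamma>_def)

text \<open>The path is cut at its visits to \<open>b\<close>. The second alternative describes an
  excursion in progress, which turns into one step of \<open>return_rel\<close> when it
  ends.\<close>

lemma flow_from_return_rel:
  assumes "((q, b), (s, j)) \<in> (flow_from x b)\<^sup>+"
  shows "j = b \<and> (q, s) \<in> (return_rel (tape x (nat b)) (\<gamma> x b))\<^sup>+ \<or>
    b < j \<and> (\<exists>r r'. (q, r) \<in> (return_rel (tape x (nat b)) (\<gamma> x b))\<^sup>* \<and> ((r, b), (r', b + 1)) \<in> flow x \<and> ((r', b + 1), (s, j)) \<in> (flow_from x (b + 1))\<^sup>*)"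
  using assms
proof (induction "(s, j)" arbitrary: s j rule: trancl_induct)
  case (base s j)
  hence n: "((q, b), (s, j)) \<in> flow x" "b \<le> j" by (auto simp: flow_from_def)
  thus ?case using flow_dist(1)[OF n(1)] return_rel_stay[of q b s x] by auto
next
  case (step v s' j')
  obtain s j where v: "v = (s, j)" by (cases v)
  have n: "((s, j), (s', j')) \<in> flow x" "b \<le> j" "b \<le> j'" using step(2) v by (auto simp: flow_from_def)
  note IH = step(3)[OF v]
  show ?case
  proof (cases "j = b")
    case True
    hence q: "(q, s) \<in> (return_rel (tape x (nat b)) (\<gamma> x b))\<^sup>+" using IH by auto
    show ?thesis
    proof (cases "j' = b")
      case t: True
      thus ?thesis using return_rel_stay[of s b s' x] n True q by (auto intro: trancl_into_trancl)
    next
      case False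
      hence "j' = b + 1" using flow_dist(1)[OF n(1)] n True by auto
      thus ?thesis using n True trancl_into_rtrancl[OF q] by auto
    qed
  next
    case False
    then obtain r r' where r: "(q, r) \<in> (return_rel (tape x (nat b)) (\<gamma> x b))\<^sup>*" "((r, b), (r', b + 1)) \<in> flow x" "((r', b + 1), (s, j)) \<in> (flow_from x (b + 1))\<^sup>*"
      using IH by auto
    show ?thesis
    proof (cases "j' = b")
      case True
      hence j: "j = b + 1" using flow_dist(1)[OF n(1)] n False by auto
      hence "(r', s') \<in> exits x (b + 1)" using r(3) n(1) True by (auto simp: exits_def)
      thus ?thesis using return_rel_exit[OF r(2)] r(1) True by (auto intro: rtrancl_into_trancl1)
    next
      case f: False
      hence "((s, j), (s', j')) \<in> flow_from x (b + 1)" using n False by (auto simp: flow_from_def)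
      hence "((r', b + 1), (s', j')) \<in> (flow_from x (b + 1))\<^sup>*" using r(3) by (rule rtrancl_into_rtrancl[rotated])
      thus ?thesis using r(1,2) f n by auto
    qed
  qed
qed

lemma flow_from_mono: "l \<le> l' \<Longrightarrow> flow_from x l' \<subseteq> flow_from x l"
  by (auto simp: flow_from_def)

lemma return_rel_flow:
  assumes "(p, p') \<in> return_rel (tape x (nat b)) (\<gamma> x b)" "0 \<le> b" "b \<le> int (length x) + 1"
  shows "((p, b), (p', b)) \<in> (flow_from x b)\<^sup>+"
proof -
  have p: "p \<in> Q" using assms by (auto simp: return_rel_def)
  consider c where "\<delta> p (tape x (nat b)) () False = Some (p', c, 0)"
    | r c where "\<delta> p (tape x (nat b)) () False = Some (r, c, 1)" "(r, p') \<in> exits x (b + 1)"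
    using assms(1) by (auto simp: return_rel_def \<gamma>_def)
  thus ?thesis
  proof cases
    case 1
    thus ?thesis using p assms by (auto simp: flow_from_def flow_def intro!: r_into_trancl)
  next
    case 2
    have s: "((p, b), (r, b + 1)) \<in> flow_from x b" using 2 p assms by (auto simp: flow_from_def flow_def)
    obtain t where t: "((r, b + 1), (t, b + 1)) \<in> (flow_from x (b + 1))\<^sup>*" "((t, b + 1), (p', b)) \<in> flow x"
      using 2 by (auto simp: exits_def)
    have "((r, b + 1), (t, b + 1)) \<in> (flow_from x b)\<^sup>*" using t(1) rtrancl_mono[OF flow_from_mono[of b "b + 1" x]] by auto
    moreover have "((t, b + 1), (p', b)) \<in> flow_from x b" using t(2) by (auto simp: flow_from_def)
    ultimately show ?thesis using s by (meson rtrancl_into_trancl2 rtrancl_into_rtrancl)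
  qed
qed

lemma return_rel_flow_plus:
  assumes "0 \<le> b" "b \<le> int (length x) + 1"
  shows "(p, p') \<in> (return_rel (tape x (nat b)) (\<gamma> x b))\<^sup>+ \<longleftrightarrow> ((p, b), (p', b)) \<in> (flow_from x b)\<^sup>+"
proof
  assume "(p, p') \<in> (return_rel (tape x (nat b)) (\<gamma> x b))\<^sup>+"
  thus "((p, b), (p', b)) \<in> (flow_from x b)\<^sup>+"
    by (induction rule: trancl_induct) (auto intro: return_rel_flow assms trancl_trans)
qed (use flow_from_return_rel in blast)

lemma return_rel_flow_star:
  assumes "0 \<le> b" "b \<le> int (length x) + 1"
  shows "(p, p') \<in> (return_rel (tape x (nat b)) (\<gamma> x b))\<^sup>* \<longleftrightarrow> ((p, b), (p', b)) \<in> (flow_from x b)\<^sup>*"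
  using return_rel_flow_plus[OF assms] by (auto simp: rtrancl_eq_or_trancl)

lemma \<gamma>_end: "\<gamma> x (int (length x) + 1) = {}"
  using flow_pos by (fastforce simp: \<gamma>_def exits_def)

lemma \<gamma>_step: assumes "0 < b" "b \<le> int (length x) + 1" shows "\<gamma> x (b - 1) = g (tape x (nat b)) (\<gamma> x b)"
  using assms by (auto simp: \<gamma>_def[of x "b - 1"] exits_def g_def return_rel_flow_star flow_def; blast)

lemma g_sub: "g \<sigma> F \<subseteq> Q \<times> Q"
proof clarify
  fix p p' assume "(p, p') \<in> g \<sigma> F"
  then obtain r c where r: "(p, r) \<in> (return_rel \<sigma> F)\<^sup>*" "r \<in> Q" "\<delta> r \<sigma> () False = Some (p', c, -1)" by (auto simp: g_def)
  have "p \<in> Q" using r(1,2) by (cases rule: converse_rtranclE) (auto simp: return_rel_def)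
  thus "p \<in> Q \<and> p' \<in> Q" using goodD(1)[OF good r(2,3)] by simp
qed

lemma marked_iff:
  assumes "0 \<le> b" "b \<le> int (length x) + 1"
  shows "marked x (q, b) \<longleftrightarrow> ((q, b), (q, b)) \<in> (flow_from x b)\<^sup>+ \<and> (\<forall>p. ((q, b), (p, b)) \<in> (flow_from x b)\<^sup>+ \<longrightarrow> ord q \<le> ord p)"
  by (simp add: marked_at_def return_rel_flow_plus[OF assms])

lemma marked_at_Some: "marked_at \<sigma> F q \<Longrightarrow> q \<in> Q \<and> \<delta> q \<sigma> () False \<noteq> None"
  by (auto simp: marked_at_def return_rel_def dest!: tranclD)

section \<open>Existence and uniqueness of marked nodes\<close>

lemma flow_from_sub: "flow_from x l \<subseteq> flow x" by (auto simp: flow_from_def)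

lemma flow_from_pos: "(u, v) \<in> (flow_from x l)\<^sup>+ \<Longrightarrow> l \<le> snd u \<and> l \<le> snd v"
  by (induction rule: trancl_induct) (auto simp: flow_from_def)

text \<open>By \<open>subcycle\<close> the nodes reachable from \<open>u\<close> are exactly the
  cycle, so minimising the position and then \<open>ord\<close> over them yields a node that passes
  the local criterion.\<close>

lemma cycle_mark:
  assumes cyc: "(u, u) \<in> (flow x)\<^sup>+"
  shows "\<exists>v. (u, v) \<in> (flow x)\<^sup>* \<and> marked x v"
proof -
  define Ob where "Ob = {v. (u, v) \<in> (flow x)\<^sup>*}"
  have onC: "(v, u) \<in> (flow x)\<^sup>+ \<and> (v, v) \<in> (flow x)\<^sup>+" if "v \<in> Ob" for v
  proof -
    have uv: "(u, v) \<in> (flow x)\<^sup>*" using that by (simp add: Ob_def)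
    have vu: "(v, u) \<in> (flow x)\<^sup>+" using subcycle[OF flow_single_valued subset_refl cyc uv] by simp
    show ?thesis using vu trancl_rtrancl_trancl[OF vu uv] by simp
  qed
  have pos: "0 \<le> snd v \<and> snd v \<le> int (length x) + 1 \<and> fst v \<in> Q" if vO: "v \<in> Ob" for v
  proof -
    obtain w where "(v, w) \<in> flow x" using onC[OF vO] tranclD by metis
    thus ?thesis using flow_pos flow_dist by (cases v; cases w) auto
  qed
  have "u \<in> Ob" by (simp add: Ob_def)
  then obtain v0 where v0: "v0 \<in> Ob" "\<And>v. v \<in> Ob \<Longrightarrow> nat (snd v0) \<le> nat (snd v)"
    using ex_has_least_nat[of "\<lambda>v. v \<in> Ob" u "\<lambda>v. nat (snd v)"] by auto
  define l where "l = snd v0"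
  have l: "l \<le> snd v" if "v \<in> Ob" for v using v0(2)[OF that] pos[OF that] pos[OF v0(1)] unfolding l_def by linarith
  obtain v where v: "v \<in> Ob" "snd v = l" "\<And>w. w \<in> Ob \<Longrightarrow> snd w = l \<Longrightarrow> ord (fst v) \<le> ord (fst w)"
    using ex_has_least_nat[of "\<lambda>v. v \<in> Ob \<and> snd v = l" v0 "\<lambda>v. ord (fst v)"] v0(1) l_def by auto
  have inr: "(w, w') \<in> (flow_from x l)\<^sup>+" if "(w, w') \<in> (flow x)\<^sup>+" "w \<in> Ob" for w w'
    using that
  proof (induction rule: trancl_induct)
    case (base y)
    thus ?case using l[of w] l[of y] by (auto simp: flow_from_def Ob_def intro!: r_into_trancl intro: rtrancl_into_rtrancl)
  next
    case (step y z)
    have "y \<in> Ob" using step(1,4) unfolding Ob_def by (auto intro: rtrancl_trans trancl_into_rtrancl)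
    moreover from this have "z \<in> Ob" using step(2) unfolding Ob_def by (auto intro: rtrancl_into_rtrancl)
    ultimately have "(y, z) \<in> flow_from x l" using l step(2) by (auto simp: flow_from_def)
    thus ?case using step by (auto intro: trancl_into_trancl)
  qed
  obtain q where q: "v = (q, l)" using v(2) by (cases v) auto
  have "marked x (q, l)"
  proof (subst marked_iff)
    show "0 \<le> l" "l \<le> int (length x) + 1" using pos[OF v(1)] q by auto
    show "((q, l), (q, l)) \<in> (flow_from x l)\<^sup>+ \<and> (\<forall>p. ((q, l), (p, l)) \<in> (flow_from x l)\<^sup>+ \<longrightarrow> ord q \<le> ord p)"
    proof (intro conjI allI impI)
      show "((q, l), (q, l)) \<in> (flow_from x l)\<^sup>+" using inr[OF _ v(1)] onC[OF v(1)] q by auto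
      fix p assume "((q, l), (p, l)) \<in> (flow_from x l)\<^sup>+"
      hence "(v, (p, l)) \<in> (flow x)\<^sup>*" using trancl_mono[OF _ flow_from_sub] q by (auto intro: trancl_into_rtrancl)
      hence "(p, l) \<in> Ob" using v(1) unfolding Ob_def by (auto intro: rtrancl_trans)
      thus "ord q \<le> ord p" using v(3)[of "(p, l)"] q by simp
    qed
  qed
  thus ?thesis using v(1) q unfolding Ob_def by auto
qed

text \<open>Both nodes lie on one cycle and both are leftmost on it, so their positions agree. Each
  state is then minimal for \<open>ord\<close> against the other, and \<open>ord\<close> is
  injective.\<close>

lemma marked_unique:
  assumes "marked x u" "marked x v" "(u, v) \<in> (flow x)\<^sup>*" "0 \<le> snd u" "snd u \<le> int (length x) + 1" "0 \<le> snd v" "snd v \<le> int (length x) + 1"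
  shows "u = v"
proof -
  obtain q b where u: "u = (q, b)" by (cases u)
  obtain p l where v: "v = (p, l)" by (cases v)
  have cu: "(u, u) \<in> (flow_from x b)\<^sup>+" "\<And>p. (u, (p, b)) \<in> (flow_from x b)\<^sup>+ \<Longrightarrow> ord q \<le> ord p"
    using assms(1,4,5) marked_iff[of b x q] by (auto simp: u)
  have cv: "(v, v) \<in> (flow_from x l)\<^sup>+" "\<And>q. (v, (q, l)) \<in> (flow_from x l)\<^sup>+ \<Longrightarrow> ord p \<le> ord q"
    using assms(2,6,7) marked_iff[of l x p] by (auto simp: v)
  have 1: "(u, v) \<in> (flow_from x b)\<^sup>+" and back1: "(v, u) \<in> (flow_from x b)\<^sup>+"
    using subcycle[OF flow_single_valued flow_from_sub cu(1) assms(3)] cu(1) by (auto intro: trancl_rtrancl_trancl)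
  have vu: "(v, u) \<in> (flow x)\<^sup>*" using trancl_mono[OF back1 flow_from_sub] by (rule trancl_into_rtrancl)
  have 2: "(v, u) \<in> (flow_from x l)\<^sup>+"
    using subcycle[OF flow_single_valued flow_from_sub cv(1) vu] cv(1) by (auto intro: trancl_rtrancl_trancl)
  have "l = b" using flow_from_pos[OF 1] flow_from_pos[OF 2] by (auto simp: u v)
  hence "ord q = ord p" using cu(2)[of p] cv(2)[of q] 1 2 by (auto simp: u v)
  moreover have "q \<in> Q" "p \<in> Q" using marked_at_Some assms(1,2) u v by auto
  ultimately show ?thesis using ord \<open>l = b\<close> by (auto simp: u v inj_on_def)
qed

section \<open>Well-foundedness away from marked nodes\<close>

definition unmarked_flow :: "'a list \<Rightarrow> (('q \<times> int) \<times> ('q \<times> int)) set" where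
  "unmarked_flow x = {(u, v) \<in> flow x. \<not> marked x u}"

lemma acyclic_unmarked: "acyclic (unmarked_flow x)"
proof (rule acyclicI, intro allI notI)
  fix u assume u: "(u, u) \<in> (unmarked_flow x)\<^sup>+"
  have sub: "unmarked_flow x \<subseteq> flow x" by (auto simp: unmarked_flow_def)
  obtain v where v: "(u, v) \<in> (flow x)\<^sup>*" "marked x v" using cycle_mark trancl_mono[OF u sub] by blast
  have "(v, u) \<in> (unmarked_flow x)\<^sup>+" using subcycle[OF flow_single_valued sub u v(1)] by simp
  thus False using v(2) by (auto simp: unmarked_flow_def dest: tranclD)
qed

lemma finite_unmarked: "finite (unmarked_flow x)"
  using finite_flow by (rule finite_subset[rotated]) (auto simp: unmarked_flow_def)

lemma wf_unmarked: "wf (unmarked_flow x)" "wf ((unmarked_flow x)\<inverse>)"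
  using finite_acyclic_wf finite_acyclic_wf_converse finite_unmarked acyclic_unmarked by auto

definition lap :: "'a list \<Rightarrow> (('q \<times> int \<times> int) \<times> ('q \<times> int \<times> int)) set" where
  "lap x = {(u, v). u \<in> vconf Q x \<and> fst (snd u) \<noteq> 0 \<and> \<not> marked x (fst u, snd (snd u)) \<and> gstep \<delta> x (\<lambda>_. ()) u = Some v}"

lemma lap_unmarked: "(u, v) \<in> lap x \<Longrightarrow> ((fst u, snd (snd u)), (fst v, snd (snd v))) \<in> unmarked_flow x"
  by (cases u; cases v) (auto simp: lap_def unmarked_flow_def flow_def gstep_iff vconf_iff)

text \<open>The counter ranges over all integers, but forgetting it maps \<open>lap\<close> into a
  finite acyclic graph. One direction bounds the depth of a test, the other the way from a node up
  to the root.\<close>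

lemma wf_lap: "wf (lap x)" "wf ((lap x)\<inverse>)"
proof -
  have "lap x \<subseteq> inv_image (unmarked_flow x) (\<lambda>u. (fst u, snd (snd u)))" using lap_unmarked by (auto simp: inv_image_def)
  thus "wf (lap x)" using wf_subset wf_inv_image wf_unmarked(1) by blast
  have "(lap x)\<inverse> \<subseteq> inv_image ((unmarked_flow x)\<inverse>) (\<lambda>u. (fst u, snd (snd u)))" using lap_unmarked by (auto simp: inv_image_def)
  thus "wf ((lap x)\<inverse>)" using wf_subset wf_inv_image wf_unmarked(2) by blast
qed

section \<open>The automaton with tests\<close>

definition off :: "'a tsym \<Rightarrow> int \<Rightarrow> bool" where
  "off \<sigma> d \<longleftrightarrow> \<sigma> = Cent \<and> d = -1 \<or> \<sigma> = Dollar \<and> d = 1"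

text \<open>A test descends only into unmarked nodes, so a completed node that is marked must be its
  root; there the pending step of \<open>\<delta>\<close> is made if the flag is up. A candidate on
  the tape with counter 0 raises the flag, be it a genuine predecessor or not, and is not descended
  into.\<close>

fun \<delta>a :: "('q loop_state, 'a, ('q \<times> 'q) set) lmach" where
  "\<delta>a (TMain q) \<sigma> F z = (if \<not> z \<and> marked_at \<sigma> F q then Some (TNode False q 0, 0, 0)
     else map_option (\<lambda>(p, c, d). (TMain p, c, d)) (\<delta> q \<sigma> () z))"
| "\<delta>a (TNode f q i) \<sigma> F z =
     (if i < m then (case ks ! i of (p, c, d) \<Rightarrow> if off \<sigma> (- d) then Some (TNode f q (Suc i), 0, 0) else Some (TTry f q i, - c, - d))
      else if z then None
      else (case \<delta> q \<sigma> () False of None \<Rightarrow> None | Some (p, c, d) \<Rightarrow>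
        if marked_at \<sigma> F q then (if f then Some (TMain p, c, d) else None) else Some (TNode f p (Suc (idx (q, c, d))), c, d)))"
| "\<delta>a (TTry f q i) \<sigma> F z = (case ks ! i of (p, c, d) \<Rightarrow>
     if off \<sigma> d then None
     else if z then Some (TNode True q (Suc i), c, d)
     else if \<not> marked_at \<sigma> F p \<and> \<delta> p \<sigma> () False = Some (q, c, d) then Some (TNode f p 0, 0, 0)
     else Some (TNode f q (Suc i), c, d))"

definition Qa :: "'q loop_state set" where
  "Qa = TMain ` Q \<union> (\<lambda>(f, q, i). TNode f q i) ` (UNIV \<times> Q \<times> {..m}) \<union> (\<lambda>(f, q, i). TTry f q i) ` (UNIV \<times> Q \<times> {..<m})"

lemma Qa_iff [simp]: "TMain q \<in> Qa \<longleftrightarrow> q \<in> Q" "TNode f q i \<in> Qa \<longleftrightarrow> q \<in> Q \<and> i \<le> m" "TTry f q i \<in> Qa \<longleftrightarrow> q \<in> Q \<and> i < m"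
  by (auto simp: Qa_def image_iff)

lemma good_a: "good \<delta>a Qa"
  unfolding good_def
proof (intro conjI ballI allI impI)
  show "finite Qa" using good unfolding Qa_def good_def by auto
next
  fix r \<sigma> F z r' c d assume r: "r \<in> Qa" "\<delta>a r \<sigma> F z = Some (r', c, d)"
  have "r' \<in> Qa \<and> c \<in> incs \<and> d \<in> incs \<and> (\<sigma> = Cent \<longrightarrow> d \<noteq> - 1) \<and> (\<sigma> = Dollar \<longrightarrow> d \<noteq> 1)"
  proof (cases r)
    case (TMain q)
    show ?thesis
    proof (cases "\<not> z \<and> marked_at \<sigma> F q")
      case False
      then obtain p where "\<delta> q \<sigma> () z = Some (p, c, d)" "r' = TMain p" using r TMain by auto
      thus ?thesis using goodD[OF good, of q \<sigma> "()" z p c d] r TMain by auto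
    qed (use r TMain in \<open>auto simp: incs_def\<close>)
  next
    case (TNode f q i)
    show ?thesis
    proof (cases "i < m")
      case True
      obtain p e h where k: "ks ! i = (p, e, h)" by (cases "ks ! i")
      show ?thesis using ks_nth[OF True k] r TNode True k by (auto simp: incs_def off_def split: if_splits)
    next
      case False
      then obtain p e h where k: "\<delta> q \<sigma> () False = Some (p, e, h)" using r TNode by (auto split: if_splits option.splits)
      have q: "q \<in> Q" using r TNode by simp
      show ?thesis using goodD[OF good q k] idx(1)[OF ks_mem[OF q k]] r TNode k False by (auto split: if_splits)
    qed
  next
    case (TTry f q i)
    obtain p e h where k: "ks ! i = (p, e, h)" by (cases "ks ! i")
    have "i < m" using r TTry by simp
    thus ?thesis using ks_nth[OF _ k] r TTry k by (auto simp: incs_def off_def split: if_splits)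
  qed
  thus "r' \<in> Qa" "c \<in> incs" "d \<in> incs" "\<sigma> = Cent \<Longrightarrow> d \<noteq> - 1" "\<sigma> = Dollar \<Longrightarrow> d \<noteq> 1" by auto
qed

section \<open>A halting run passes its tests\<close>

abbreviation "S x \<equiv> stp \<delta> Q x (\<lambda>_. ())"
abbreviation "step_a x \<equiv> gstep \<delta>a x (\<gamma> x)"
abbreviation "steps_a x \<equiv> stp \<delta>a Qa x (\<gamma> x)"

lemma off_iff: "0 \<le> b \<Longrightarrow> b \<le> int (length x) + 1 \<Longrightarrow> d \<in> incs \<Longrightarrow>
    off (tape x (nat b)) d \<longleftrightarrow> \<not> (0 \<le> b + d \<and> b + d \<le> int (length x) + 1)"
  by (auto simp: off_def tape_Cent_iff tape_Dollar_iff incs_def)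

inductive sees_zero :: "'a list \<Rightarrow> 'q \<times> int \<times> int \<Rightarrow> bool" for x where
  zero: "(p, c, d) \<in> set ks \<Longrightarrow> 0 \<le> b - d \<Longrightarrow> b - d \<le> int (length x) + 1 \<Longrightarrow> a - c = 0 \<Longrightarrow> sees_zero x (q, a, b)"
| child: "(u, v) \<in> lap x \<Longrightarrow> sees_zero x u \<Longrightarrow> sees_zero x v"

definition hit :: "'a list \<Rightarrow> 'q \<times> int \<times> int \<Rightarrow> nat \<Rightarrow> bool" where
  "hit x v i = (case v of (q, a, b) \<Rightarrow> case ks ! i of (p, c, d) \<Rightarrow> 0 \<le> b - d \<and> b - d \<le> int (length x) + 1 \<and>
     (a = c \<or> ((p, a - c, b - d), v) \<in> lap x \<and> sees_zero x (p, a - c, b - d)))"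

lemma sees_zero_hit:
  assumes "sees_zero x v"
  shows "\<exists>i<m. hit x v i"
  using assms
proof (cases rule: sees_zero.cases)
  case (zero p c d b a q)
  thus ?thesis using idx[OF zero(2)] by (intro exI[of _ "idx (p, c, d)"]) (auto simp: hit_def)
next
  case (child u)
  obtain p a b where u: "u = (p, a, b)" by (cases u)
  obtain q c d where k: "\<delta> p (tape x (nat b)) () (a = 0) = Some (q, c, d)" "v = (q, a + c, b + d)"
    using child(1) by (auto simp: lap_def u gstep_iff)
  have p: "p \<in> Q" "0 \<le> b" "b \<le> int (length x) + 1" using child(1) by (auto simp: lap_def u vconf_iff)
  show ?thesis using idx[OF ks_mem[OF p(1) k(1)]] child k p by (intro exI[of _ "idx (p, c, d)"]) (auto simp: hit_def u)
qed

text \<open>The recursion into children ends because \<open>lap\<close> is well-founded. The flag is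
  never lowered, so a single hit among the remaining candidates suffices.\<close>

lemma test_complete:
  assumes "v \<in> vconf Q x" "i \<le> m"
  shows "\<exists>f'. ((TNode f (fst v) i, snd v), (TNode f' (fst v) m, snd v)) \<in> (steps_a x)\<^sup>* \<and> (f \<longrightarrow> f') \<and> (\<forall>j. i \<le> j \<and> j < m \<and> hit x v j \<longrightarrow> f')"
  using wf_lap(1)[of x] assms
proof (induction v arbitrary: f i rule: wf_induct_rule)
  case (less v)
  obtain q a b where v: "v = (q, a, b)" by (cases v)
  have qb: "q \<in> Q" "0 \<le> b" "b \<le> int (length x) + 1" using less(2) by (auto simp: v vconf_iff)
  have one: "\<exists>f'. ((TNode f q i, a, b), (TNode f' q (Suc i), a, b)) \<in> (steps_a x)\<^sup>* \<and> (f \<longrightarrow> f') \<and> (hit x v i \<longrightarrow> f')" if i: "i < m" for f i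
  proof -
    obtain p c d where k: "ks ! i = (p, c, d)" by (cases "ks ! i")
    note kQ = ks_nth[OF i k]
    have d': "- d \<in> incs" using kQ by (auto simp: incs_def)
    show ?thesis
    proof (cases "off (tape x (nat b)) (- d)")
      case True
      have "\<not> hit x v i" using True off_iff[OF qb(2,3) d'] by (auto simp: hit_def v k)
      moreover have "((TNode f q i, a, b), (TNode f q (Suc i), a, b)) \<in> steps_a x"
        using i k True qb by (auto simp: stp_def vconf_iff gstep_iff)
      ultimately show ?thesis by blast
    next
      case False
      hence b': "0 \<le> b - d" "b - d \<le> int (length x) + 1" using off_iff[OF qb(2,3) d'] by auto
      have s1: "((TNode f q i, a, b), (TTry f q i, a - c, b - d)) \<in> steps_a x"
        using i k False qb by (auto simp: stp_def vconf_iff gstep_iff)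
      have no: "\<not> off (tape x (nat (b - d))) d" using off_iff[OF b' kQ(3)] qb by auto
      have tryS: "((TTry f q i, a - c, b - d), w) \<in> steps_a x" if "step_a x (TTry f q i, a - c, b - d) = Some w" for w
        using that qb i b' by (auto simp: stp_def vconf_iff simp del: \<delta>a.simps)
      let ?u = "(p, a - c, b - d)"
      have lap: "(?u, v) \<in> lap x \<longleftrightarrow> a \<noteq> c \<and> \<not> marked x (p, b - d) \<and> \<delta> p (tape x (nat (b - d))) () False = Some (q, c, d)"
        using kQ b' by (auto simp: lap_def vconf_iff gstep_iff v)
      consider "a = c" | "a \<noteq> c" "(?u, v) \<in> lap x" | "a \<noteq> c" "(?u, v) \<notin> lap x" by blast
      thus ?thesis
      proof cases
        case 1
        have "((TTry f q i, a - c, b - d), (TNode True q (Suc i), a, b)) \<in> steps_a x"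
          by (rule tryS) (use 1 k no in \<open>auto simp: gstep_iff\<close>)
        hence "((TNode f q i, a, b), (TNode True q (Suc i), a, b)) \<in> (steps_a x)\<^sup>*" using s1 by auto
        thus ?thesis by blast
      next
        case 2
        have s2: "((TTry f q i, a - c, b - d), (TNode f p 0, a - c, b - d)) \<in> steps_a x"
          by (rule tryS) (use 2 k no lap in \<open>auto simp: gstep_iff\<close>)
        have uv: "?u \<in> vconf Q x" using 2(2) by (auto simp: lap_def)
        obtain f' where f': "((TNode f p 0, a - c, b - d), (TNode f' p m, a - c, b - d)) \<in> (steps_a x)\<^sup>*" "f \<longrightarrow> f'"
          "\<forall>j. 0 \<le> j \<and> j < m \<and> hit x ?u j \<longrightarrow> f'"
          using less(1)[OF 2(2) uv, of 0 f] by auto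
        have "idx (p, c, d) = i" using idx_nth[OF i] k by simp
        hence s3: "((TNode f' p m, a - c, b - d), (TNode f' q (Suc i), a, b)) \<in> steps_a x"
          using 2 lap kQ b' by (auto simp: stp_def vconf_iff gstep_iff)
        have "hit x v i \<longrightarrow> f'" using sees_zero_hit[of x ?u] f'(3) 2(1) by (auto simp: hit_def v k)
        moreover have "((TNode f q i, a, b), (TNode f' q (Suc i), a, b)) \<in> (steps_a x)\<^sup>*"
          using s1 s2 f'(1) s3 by (meson converse_rtrancl_into_rtrancl rtrancl_into_rtrancl)
        ultimately show ?thesis using f'(2) by blast
      next
        case 3
        have "((TTry f q i, a - c, b - d), (TNode f q (Suc i), a, b)) \<in> steps_a x"
          by (rule tryS) (use 3 k no lap in \<open>auto simp: gstep_iff\<close>)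
        hence "((TNode f q i, a, b), (TNode f q (Suc i), a, b)) \<in> (steps_a x)\<^sup>*" using s1 by auto
        moreover have "\<not> hit x v i" using 3 by (auto simp: hit_def v k)
        ultimately show ?thesis by blast
      qed
    qed
  qed
  have "\<exists>f'. ((TNode f q i, a, b), (TNode f' q m, a, b)) \<in> (steps_a x)\<^sup>* \<and> (f \<longrightarrow> f') \<and> (\<forall>j. i \<le> j \<and> j < m \<and> hit x v j \<longrightarrow> f')"
    using \<open>i \<le> m\<close>
  proof (induction i arbitrary: f rule: inc_induct)
    case base
    show ?case by (intro exI[of _ f]) auto
  next
    case (step i)
    obtain f1 where f1: "((TNode f q i, a, b), (TNode f1 q (Suc i), a, b)) \<in> (steps_a x)\<^sup>*" "f \<longrightarrow> f1" "hit x v i \<longrightarrow> f1"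
      using one[OF step(2)] by blast
    obtain f' where f': "((TNode f1 q (Suc i), a, b), (TNode f' q m, a, b)) \<in> (steps_a x)\<^sup>*" "f1 \<longrightarrow> f'"
      "\<forall>j. Suc i \<le> j \<and> j < m \<and> hit x v j \<longrightarrow> f'" using step(3) by blast
    have "f'" if "i \<le> j" "j < m" "hit x v j" for j
      using that f1 f' by (cases "j = i") auto
    thus ?case using rtrancl_trans[OF f1(1) f'(1)] f1 f' by blast
  qed
  thus ?case by (simp add: v)
qed

definition embed_main :: "'q \<times> int \<times> int \<Rightarrow> 'q loop_state \<times> int \<times> int" where
  "embed_main u = (TMain (fst u), snd u)"

lemma embed_main_step:
  assumes uv: "(u, v) \<in> S x" and z: "fst (snd u) \<noteq> 0 \<Longrightarrow> marked x (fst u, snd (snd u)) \<Longrightarrow> sees_zero x u"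
  shows "(embed_main u, embed_main v) \<in> (steps_a x)\<^sup>*"
proof -
  obtain q a b where u: "u = (q, a, b)" by (cases u)
  have vc: "u \<in> vconf Q x" using uv by (auto simp: stp_def)
  have qb: "q \<in> Q" "0 \<le> b" "b \<le> int (length x) + 1" using vc by (auto simp: u vconf_iff)
  obtain p c d where k: "\<delta> q (tape x (nat b)) () (a = 0) = Some (p, c, d)" "v = (p, a + c, b + d)"
    using uv by (auto simp: stp_def u gstep_iff)
  show ?thesis
  proof (cases "a \<noteq> 0 \<and> marked x (q, b)")
    case True
    obtain j where j: "j < m" "hit x u j" using sees_zero_hit[OF z] True u by auto
    obtain f' where f': "((TNode False q 0, a, b), (TNode f' q m, a, b)) \<in> (steps_a x)\<^sup>*" "f'"
      using test_complete[OF vc, of 0 False] j by (auto simp: u)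
    have "(embed_main u, (TNode False q 0, a, b)) \<in> steps_a x" using True qb by (auto simp: stp_def vconf_iff gstep_iff u embed_main_def)
    moreover have "((TNode f' q m, a, b), embed_main v) \<in> steps_a x" using True qb k f'(2) by (auto simp: stp_def vconf_iff gstep_iff embed_main_def)
    ultimately show ?thesis using f'(1) by (meson converse_rtrancl_into_rtrancl rtrancl_into_rtrancl)
  next
    case False
    hence "(embed_main u, embed_main v) \<in> steps_a x" using k qb by (auto simp: stp_def vconf_iff gstep_iff u embed_main_def)
    thus ?thesis by simp
  qed
qed

text \<open>Let \<open>T1\<close> be the first visit to the marked node since the counter was last 0. If the counter had
  moved away from 0 between \<open>T1\<close> and \<open>T\<close>, the run would repeat this segment forever. Hence the path
  into the node at time \<open>T1\<close>, shifted by \<open>D\<close>, crosses counter value 0.\<close>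

lemma run_sees_zero:
  fixes f :: "nat \<Rightarrow> 'q \<times> int \<times> int"
  assumes f0: "f 0 = (q0, 0, 0)" and st: "\<And>i. i < N \<Longrightarrow> (f i, f (Suc i)) \<in> S x" and stuck: "gstep \<delta> x (\<lambda>_. ()) (f N) = None"
    and T: "T \<le> N" "fst (snd (f T)) \<noteq> 0" "marked x (fst (f T), snd (snd (f T)))"
  shows "sees_zero x (f T)"
proof -
  define a where "a t = fst (snd (f t))" for t
  define q where "q t = fst (f t)" for t
  define b where "b t = snd (snd (f t))" for t
  have f: "f t = (q t, a t, b t)" for t by (simp add: a_def q_def b_def)
  have vc: "q t \<in> Q" "0 \<le> b t" "b t \<le> int (length x) + 1" if "t \<le> N" for t
  proof -
    have "f t \<in> vconf Q x"
    proof (cases t)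
      case 0
      thus ?thesis using f0 q0Q by (auto simp: vconf_iff)
    next
      case (Suc s)
      thus ?thesis using st[of s] that stp_vconf[OF good] by auto
    qed
    thus "q t \<in> Q" "0 \<le> b t" "b t \<le> int (length x) + 1" by (auto simp: f vconf_iff)
  qed
  have tr: "\<exists>c d. \<delta> (q t) (tape x (nat (b t))) () (a t = 0) = Some (q (Suc t), c, d) \<and> a (Suc t) = a t + c \<and> b (Suc t) = b t + d \<and> c \<in> incs"
    if "t < N" for t
  proof -
    have "gstep \<delta> x (\<lambda>_. ()) (q t, a t, b t) = Some (q (Suc t), a (Suc t), b (Suc t))" using st[OF that] by (auto simp: stp_def f)
    thus ?thesis using goodD(2)[OF good vc(1)[of t]] that by (auto simp: gstep_iff)
  qed
  have lip: "\<bar>a (Suc t) - a t\<bar> \<le> 1" if "t < N" for t using tr[OF that] by (auto simp: incs_def)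
  have nr: "((q t, b t), (q (Suc t), b (Suc t))) \<in> flow x" if "t < N" "a t \<noteq> 0" for t
    using tr[OF that(1)] vc[of t] that by (auto simp: flow_def)
  have aT: "a T \<noteq> 0" using T by (simp add: a_def)
  have a0: "a 0 = 0" "0 < T" using f0 aT by (auto simp: a_def intro: gr0I)
  define t0 where "t0 = Max {t. t < T \<and> a t = 0}"
  have "t0 \<in> {t. t < T \<and> a t = 0}" unfolding t0_def using a0 by (intro Max_in) auto
  hence t0: "t0 < T" "a t0 = 0" by auto
  have nz: "a t \<noteq> 0" if "t0 < t" "t \<le> T" for t
  proof
    assume "a t = 0"
    hence "t < T" using that aT by (cases "t = T") auto
    hence "t \<le> t0" unfolding t0_def using \<open>a t = 0\<close> by (intro Max_ge) auto
    thus False using that by simp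
  qed
  define P where "P t \<longleftrightarrow> t0 < t \<and> marked x (q t, b t)" for t
  have PT: "P T" using t0 T by (simp add: q_def b_def P_def)
  define T1 where "T1 = (LEAST t. P t)"
  have P1: "P T1" "T1 \<le> T" "\<And>t. t < T1 \<Longrightarrow> \<not> P t"
    unfolding T1_def using LeastI[of P, OF PT] Least_le[of P, OF PT] not_less_Least[of _ P] by blast+
  have T1: "t0 < T1" "marked x (q T1, b T1)" "T1 \<le> T" "\<And>t. t0 < t \<Longrightarrow> t < T1 \<Longrightarrow> \<not> marked x (q t, b t)"
    using P1 by (simp_all add: P_def)
  \<comment> \<open>The counter stays nonzero from \<open>T1\<close> to \<open>T\<close>, so the run
    follows \<open>flow\<close> from one marked node to another, and these coincide by
    uniqueness.\<close>
  have "((q T1, b T1), (q T, b T)) \<in> (flow x)\<^sup>*"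
    using T1(3)
  proof (induction rule: inc_induct)
    case (step t)
    thus ?case using nr[of t] nz[of t] T1(1) T(1) by (auto intro: converse_rtrancl_into_rtrancl)
  qed simp
  hence nd: "q T1 = q T" "b T1 = b T"
    using marked_unique[of x "(q T1, b T1)" "(q T, b T)"] T1 T vc[of T] vc[of T1] by (auto simp: q_def b_def)
  \<comment> \<open>The sign of the counter since \<open>t0\<close>; it is constant because steps of
    size at most 1 cannot jump over 0. Multiplying by \<open>e\<close> treats both signs at
    once.\<close>
  define e where "e = sgn (a T)"
  have e: "e = 1 \<or> e = -1" using aT by (auto simp: e_def sgn_if)
  have pos: "0 < e * a t" if "t0 < t" "t \<le> T" for t
    using that(2,1)
  proof (induction rule: inc_induct)
    case base
    show ?case using aT by (auto simp: e_def sgn_if)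
  next
    case (step t)
    have "0 < e * a (Suc t)" "\<bar>a (Suc t) - a t\<bar> \<le> 1" "a t \<noteq> 0" using step lip[of t] T(1) nz[of t] by auto
    thus ?case using e by auto
  qed
  define D where "D = a T - a T1"
  have le: "e * D \<le> 0"
  proof (rule ccontr)
    assume D: "\<not> e * D \<le> 0"
    hence lt: "T1 < T" using T1(3) by (cases "T1 = T") (auto simp: D_def)
    \<comment> \<open>From \<open>T\<close> on the run copies its course from \<open>T1\<close>,
      with the counter shifted by \<open>D\<close> further away from 0, so every zero test has the
      same result. It could never get stuck.\<close>
    have "T + j \<le> N \<and> q (T + j) = q (T1 + j) \<and> b (T + j) = b (T1 + j) \<and> a (T + j) = a (T1 + j) + D \<and> 0 < e * a (T1 + j)" for j
    proof (induction j rule: less_induct)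
      case (less j)
      show ?case
      proof (cases j)
        case 0
        thus ?thesis using T(1) nd pos[OF T1(1,3)] by (auto simp: D_def)
      next
        case (Suc i)
        note IH = less[of i, unfolded Suc, simplified]
        have nzi: "a (T1 + i) \<noteq> 0" "a (T + i) \<noteq> 0" using IH D e by auto
        obtain c d where cd: "\<delta> (q (T1 + i)) (tape x (nat (b (T1 + i)))) () (a (T1 + i) = 0) = Some (q (Suc (T1 + i)), c, d)"
          "a (Suc (T1 + i)) = a (T1 + i) + c" "b (Suc (T1 + i)) = b (T1 + i) + d"
          using tr[of "T1 + i"] IH lt by auto
        have g: "gstep \<delta> x (\<lambda>_. ()) (f (T + i)) = Some (q (Suc (T1 + i)), a (T + i) + c, b (T + i) + d)"
          using cd(1) nzi IH by (auto simp: f gstep_iff)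
        hence "T + i < N" using IH stuck by (cases "T + i = N") auto
        moreover from this have "f (Suc (T + i)) = (q (Suc (T1 + i)), a (T + i) + c, b (T + i) + d)"
          using st[of "T + i"] g by (auto simp: stp_def)
        moreover have "0 < e * a (Suc (T1 + i))"
        proof (cases "Suc (T1 + i) \<le> T")
          case True
          thus ?thesis using pos T1(1) by auto
        next
          case False
          \<comment> \<open>Beyond \<open>T\<close> the course to be copied is itself a copy of an
            earlier part; \<open>k < j\<close> because \<open>T1 < T\<close>.\<close>
          define k where "k = Suc (T1 + i) - T"
          have k: "k < j" "T + k = Suc (T1 + i)" using False lt Suc by (auto simp: k_def)
          have "a (T + k) = a (T1 + k) + D" "0 < e * a (T1 + k)" using less[OF k(1)] by auto
          thus ?thesis using D unfolding k(2) by (simp add: distrib_left)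
        qed
        ultimately show ?thesis using Suc IH cd by (auto simp: f)
      qed
    qed
    from this[of "Suc N"] show False by simp
  qed
  \<comment> \<open>Signed counter of the path shifted to end in \<open>f T\<close>: not positive at
    \<open>t0\<close> since \<open>e * D \<le> 0\<close>, positive at \<open>T1\<close>. At the last
    time \<open>j\<close> where it is not positive it equals 0, again by the unit steps.\<close>
  define h where "h t = e * (a t + D)" for t
  define j where "j = Max {t. t0 \<le> t \<and> t \<le> T1 \<and> h t \<le> 0}"
  have "j \<in> {t. t0 \<le> t \<and> t \<le> T1 \<and> h t \<le> 0}" unfolding j_def
    using t0(2) le T1(1) by (intro Max_in) (auto simp: h_def intro!: exI[of _ t0])
  hence j: "t0 \<le> j" "j \<le> T1" "h j \<le> 0" by auto
  have hT1: "0 < h T1" using pos[of T] t0 by (simp add: h_def D_def)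
  hence jl: "j < T1" using j by (cases "j = T1") auto
  have hp: "0 < h t" if "j < t" "t \<le> T1" for t
  proof (rule ccontr)
    assume "\<not> 0 < h t"
    hence "t \<le> j" unfolding j_def using that j by (intro Max_ge) auto
    thus False using that by simp
  qed
  have jN: "j < N" using jl T1(3) T(1) by simp
  have "h j = 0" using hp[of "Suc j"] j(3) lip[OF jN] jl e by (auto simp: h_def)
  hence j0: "a j + D = 0" using e by (auto simp: h_def)
  \<comment> \<open>The transition at \<open>j\<close> belongs to the original run. At the shifted
    source the counter is 0 and \<open>\<delta>\<close> may act differently, but the rule
    \<open>zero\<close> needs only a candidate there.\<close>
  have base: "sees_zero x (q (Suc j), a (Suc j) + D, b (Suc j))"
  proof -
    obtain c d where cd: "\<delta> (q j) (tape x (nat (b j))) () (a j = 0) = Some (q (Suc j), c, d)" "a (Suc j) = a j + c" "b (Suc j) = b j + d"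
      using tr[OF jN] by blast
    show ?thesis using ks_mem[OF vc(1) cd(1)] cd j0 vc[of j] jN by (intro sees_zero.zero[of "q j" c d]) auto
  qed
  have "sees_zero x (q T1, a T1 + D, b T1)"
    using Suc_leI[OF jl]
  proof (induction rule: dec_induct)
    case base
    show ?case using \<open>sees_zero x (q (Suc j), a (Suc j) + D, b (Suc j))\<close> .
  next
    case (step t)
    have t: "t < N" "t0 < t" "t \<le> T" "t < T1" using step(1,2) T1(3) T(1) j by auto
    obtain c d where cd: "\<delta> (q t) (tape x (nat (b t))) () (a t = 0) = Some (q (Suc t), c, d)" "a (Suc t) = a t + c" "b (Suc t) = b t + d"
      using tr[OF t(1)] by blast
    \<comment> \<open>Neither the original nor the shifted counter is 0, so the shift preserves the
      transition; before \<open>T1\<close> the nodes are unmarked, so it is an edge of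
      \<open>lap\<close>.\<close>
    have "a t \<noteq> 0" "a t + D \<noteq> 0" using nz[OF t(2,3)] hp[of t] step(1) t by (auto simp: h_def)
    hence "((q t, a t + D, b t), (q (Suc t), a (Suc t) + D, b (Suc t))) \<in> lap x"
      using cd vc[of t] t T1(4)[of t] by (auto simp: lap_def vconf_iff gstep_iff)
    thus ?case using step(3) by (rule sees_zero.child)
  qed
  thus ?thesis using nd by (simp add: f D_def)
qed

definition mains :: "'q set \<Rightarrow> 'q loop_state set" where "mains F = TMain ` F"

theorem decides_a: "decides \<delta>a Qa (TMain q0) (mains A) (mains R) \<gamma> L"
  unfolding decides_def
proof (intro conjI ballI allI)
  show "TMain q0 \<notin> mains A \<union> mains R" "mains A \<subseteq> Qa" "mains R \<subseteq> Qa" "mains A \<inter> mains R = {}" using q0F AQ RQ AR by (auto simp: mains_def)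
  show "\<delta>a q \<sigma> \<beta> z = None" if qF: "q \<in> mains A \<union> mains R" for q \<sigma> \<beta> z
  proof -
    obtain p where p: "q = TMain p" "p \<in> A \<union> R" using qF by (auto simp: mains_def)
    have "\<not> marked_at \<sigma> \<beta> p" using marked_at_Some[of \<sigma> \<beta> p] final[OF p(2)] by auto
    thus ?thesis using p final by simp
  qed
  fix x
  obtain u where u: "((q0, 0, 0), u) \<in> (S x)\<^sup>*" "fst u \<in> (if x \<in> L then A else R)" using run by blast
  obtain N where "((q0, 0, 0), u) \<in> S x ^^ N" using u(1) rtrancl_imp_relpow by blast
  then obtain f where f: "f 0 = (q0, 0, 0)" "f N = u" "\<And>i. i < N \<Longrightarrow> (f i, f (Suc i)) \<in> S x" unfolding relpow_fun_conv by blast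
  have stuck: "gstep \<delta> x (\<lambda>_. ()) (f N) = None" using final_stuck[OF dec, of u x] u(2) f(2) by (auto split: if_splits)
  have "t \<le> N \<Longrightarrow> (embed_main (f 0), embed_main (f t)) \<in> (steps_a x)\<^sup>*" for t
  proof (induction t)
    case (Suc t)
    have "(embed_main (f t), embed_main (f (Suc t))) \<in> (steps_a x)\<^sup>*"
      using Suc(2) f(3)[of t] run_sees_zero[OF f(1,3) stuck, of t] by (intro embed_main_step) auto
    thus ?case using Suc by (meson Suc_leD rtrancl_trans)
  qed simp
  from this[of N] have "((TMain q0, 0, 0), embed_main u) \<in> (steps_a x)\<^sup>*" by (simp add: f embed_main_def)
  thus "\<exists>u. ((TMain q0, 0, 0), u) \<in> (steps_a x)\<^sup>* \<and> fst u \<in> (if x \<in> L then mains A else mains R)"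
    using u(2) by (intro exI[of _ "embed_main u"]) (auto simp: embed_main_def mains_def)
qed (use good_a q0Q in auto)

section \<open>No infinite backward path from a halting configuration\<close>

definition test :: "'q loop_state \<times> int \<times> int \<Rightarrow> bool" where
  "test w \<longleftrightarrow> (\<forall>q. fst w \<noteq> TMain q)"

fun flag :: "'q loop_state \<Rightarrow> bool" where
  "flag (TMain q) = False"
| "flag (TNode f q i) = f"
| "flag (TTry f q i) = f"

fun node :: "'q loop_state \<times> int \<times> int \<Rightarrow> 'q \<times> int" where
  "node (TMain q, a, b) = (q, b)"
| "node (TNode f q i, a, b) = (q, b)"
| "node (TTry f q i, a, b) = (q, b)"

text \<open>With \<open>flag_enter\<close> and \<open>flag_exit\<close> this excludes completed
  tests away from counter 0: the flag starts down, cannot change, and must be up at the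
  exit.\<close>

lemma flag_step: "(u, v) \<in> steps_a x \<Longrightarrow> test u \<Longrightarrow> test v \<Longrightarrow> fst (snd u) \<noteq> 0 \<Longrightarrow> flag (fst v) = flag (fst u)"
  by (cases u; cases "fst u") (auto simp: stp_def gstep_iff test_def split: prod.splits if_splits option.splits)

lemma flag_exit: "(u, v) \<in> steps_a x \<Longrightarrow> test u \<Longrightarrow> \<not> test v \<Longrightarrow> flag (fst u)"
  by (cases u; cases "fst u") (auto simp: stp_def gstep_iff test_def split: prod.splits if_splits option.splits)

lemma flag_enter: "(u, v) \<in> steps_a x \<Longrightarrow> \<not> test u \<Longrightarrow> test v \<Longrightarrow> \<not> flag (fst v)"
  by (cases u; cases "fst u") (auto simp: stp_def gstep_iff test_def split: prod.splits if_splits option.splits)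

lemma main_step: "(u, v) \<in> steps_a x \<Longrightarrow> \<not> test u \<Longrightarrow> \<not> test v \<Longrightarrow> fst (snd u) \<noteq> 0 \<Longrightarrow> (node u, node v) \<in> unmarked_flow x"
  by (cases u; cases "fst u") (auto simp: stp_def gstep_iff test_def unmarked_flow_def flow_def vconf_iff split: prod.splits if_splits option.splits)

definition test_flow :: "'a list \<Rightarrow> (('q loop_state \<times> int \<times> int) \<times> ('q loop_state \<times> int \<times> int)) set" where
  "test_flow x = {(u, v) \<in> steps_a x. test u \<and> test v}"

lemma test_flow_cases:
  assumes "(w, v) \<in> test_flow x"
  obtains (skip) f q i a b where "w = (TNode f q i, a, b)" "v = (TNode f q (Suc i), a, b)"
  | (down) f q i a b p c d where "w = (TNode f q i, a, b)" "ks ! i = (p, c, d)" "v = (TTry f q i, a - c, b - d)"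
  | (up) f q p a b c d where "w = (TNode f q m, a, b)" "((q, a, b), (p, a + c, b + d)) \<in> lap x" "idx (q, c, d) < m" "ks ! idx (q, c, d) = (q, c, d)"
      "v = (TNode f p (Suc (idx (q, c, d))), a + c, b + d)"
  | (fail) f f' q i a b p c d where "w = (TTry f q i, a, b)" "ks ! i = (p, c, d)" "v = (TNode f' q (Suc i), a + c, b + d)"
  | (enter) f q i a b p c d where "w = (TTry f q i, a, b)" "i < m" "ks ! i = (p, c, d)" "((p, a, b), (q, a + c, b + d)) \<in> lap x" "v = (TNode f p 0, a, b)"
proof -
  obtain r a b where w: "w = (r, a, b)" by (cases w)
  have s: "r \<in> Qa" "0 \<le> b" "b \<le> int (length x) + 1" "step_a x w = Some v" "test w" "test v" using assms by (auto simp: test_flow_def stp_def w vconf_iff)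
  show ?thesis
  proof (cases r)
    case (TMain q)
    thus ?thesis using s by (simp add: test_def w)
  next
    case (TNode f q i)
    show ?thesis
    proof (cases "i < m")
      case True
      obtain p c d where k: "ks ! i = (p, c, d)" by (cases "ks ! i")
      show ?thesis using s(4) True k skip[of f q i a b] down[of f q i a b p c d] by (auto simp: w TNode gstep_iff split: if_splits)
    next
      case False
      have i: "i = m" "q \<in> Q" using s(1) False TNode by auto
      then obtain p c d where k: "\<delta> q (tape x (nat b)) () False = Some (p, c, d)" "a \<noteq> 0" "\<not> marked x (q, b)" "v = (TNode f p (Suc (idx (q, c, d))), a + c, b + d)"
        using s(4,6) by (auto simp: w TNode gstep_iff test_def split: if_splits option.splits)
      have "((q, a, b), (p, a + c, b + d)) \<in> lap x" using k i s by (auto simp: lap_def vconf_iff gstep_iff)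
      thus ?thesis using up[of f q a b p c d] k i idx[OF ks_mem[OF i(2) k(1)]] by (auto simp: w TNode)
    qed
  next
    case (TTry f q i)
    obtain p c d where k: "ks ! i = (p, c, d)" by (cases "ks ! i")
    have i: "i < m" using s(1) TTry by simp
    note kQ = ks_nth[OF i k]
    consider f' where "v = (TNode f' q (Suc i), a + c, b + d)" |
      "a \<noteq> 0" "\<not> marked x (p, b)" "\<delta> p (tape x (nat b)) () False = Some (q, c, d)" "v = (TNode f p 0, a, b)"
      using s(4) k by (auto simp: w TTry gstep_iff split: if_splits)
    thus ?thesis
    proof cases
      case 1
      thus ?thesis using fail[of f q i a b p c d f'] k by (auto simp: w TTry)
    next
      case 2
      hence "((p, a, b), (q, a + c, b + d)) \<in> lap x" using kQ s by (auto simp: lap_def vconf_iff gstep_iff)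
      thus ?thesis using enter[of f q i a b p c d] k i 2 by (auto simp: w TTry)
    qed
  qed
qed

lemma acc_Try:
  assumes "(TNode f q i, a, b) \<in> Wellfounded.acc (test_flow x)" "ks ! i = (p, c, d)"
  shows "(TTry f q i, a - c, b - d) \<in> Wellfounded.acc (test_flow x)"
proof (rule accI)
  fix w assume "(w, (TTry f q i, a - c, b - d)) \<in> test_flow x"
  thus "w \<in> Wellfounded.acc (test_flow x)" using assms by (cases rule: test_flow_cases) auto
qed

text \<open>Into index \<open>Suc i\<close> lead the previous index, the failed trial, and the
  completed child. The start of the child's own tour comes from the trial at index \<open>i\<close>,
  so the induction over \<open>lap\<close> applies to the child and reaches its completion.\<close>

lemma acc_Node:
  assumes "\<And>f. (TNode f (fst v) 0, snd v) \<in> Wellfounded.acc (test_flow x)"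
  shows "(TNode f (fst v) i, snd v) \<in> Wellfounded.acc (test_flow x)"
  using wf_lap(1)[of x] assms
proof (induction v arbitrary: f i rule: wf_induct_rule)
  case (less v)
  show ?case
  proof (induction i arbitrary: f)
    case 0
    show ?case using less(2) .
  next
    case (Suc i)
    obtain q a b where v: "v = (q, a, b)" by (cases v)
    obtain p c d where k: "ks ! i = (p, c, d)" by (cases "ks ! i")
    have tr: "(TTry f q i, a - c, b - d) \<in> Wellfounded.acc (test_flow x)" for f
      using acc_Try[OF _ k] Suc by (simp add: v)
    show ?case
    proof (rule accI)
      fix w assume w: "(w, (TNode f (fst v) (Suc i), snd v)) \<in> test_flow x"
      from w show "w \<in> Wellfounded.acc (test_flow x)"
      proof (cases rule: test_flow_cases)
        case (skip f' q' i' a' b')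
        hence "w = (TNode f' (fst v) i, snd v)" by (cases v) simp
        thus ?thesis using Suc by simp
      next
        case (fail f' f'' q' i' a' b' p' c' d')
        hence "i' = i" "q' = q" "a' + c' = a" "b' + d' = b" using v by auto
        moreover from this have "c' = c" "d' = d" using fail(2) k by auto
        ultimately have "w = (TTry f' q i, a - c, b - d)" using fail(1) by simp
        thus ?thesis using tr by simp
      next
        case (up f' p' p'' a' b' c' d')
        have i: "idx (p', c', d') = i" and v': "v = (p'', a' + c', b' + d')" using up(5) by (auto simp: v)
        have k': "p' = p" "c' = c" "d' = d" using up(4) k i by auto
        have ab: "a' = a - c" "b' = b - d" "p'' = q" using v v' k' by auto
        have uv: "((p, a - c, b - d), v) \<in> lap x" using up(2) v' k' ab by simp
        have "(TNode f p 0, a - c, b - d) \<in> Wellfounded.acc (test_flow x)" for f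
        proof (rule accI)
          fix y assume "(y, (TNode f p 0, a - c, b - d)) \<in> test_flow x"
          thus "y \<in> Wellfounded.acc (test_flow x)"
          proof (cases rule: test_flow_cases)
            case (enter f2 q2 i2 a2 b2 p2 c2 d2)
            have "(q2, a2 + c2, b2 + d2) = v" using enter(4,5) uv by (auto simp: lap_def)
            hence e: "q2 = q" "c2 = c" "d2 = d" "a2 = a - c" "b2 = b - d" "p2 = p" using enter(5) v by auto
            have "i2 = i" using idx_nth[OF enter(2)] enter(3) e i k' by simp
            thus ?thesis using enter(1) e tr by simp
          qed simp_all
        qed
        from less(1)[OF uv, of f' m] this have "(TNode f' p m, a - c, b - d) \<in> Wellfounded.acc (test_flow x)" by simp
        thus ?thesis using up(1) k' ab by simp
      qed simp_all
    qed
  qed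
qed

text \<open>Within tests, index 0 of a node is entered only from a trial of its parent, so induction
  runs towards the root, along the converse of \<open>lap\<close>. This covers tests in any
  intermediate state, also those never properly started.\<close>

lemma wf_test_flow: "wf (test_flow x)"
proof (rule acc_wfI, rule allI)
  have root: "(TNode f (fst v) 0, snd v) \<in> Wellfounded.acc (test_flow x)" for f v
    using wf_lap(2)[of x]
  proof (induction v arbitrary: f rule: wf_induct_rule)
    case (less v)
    show ?case
    proof (rule accI)
      fix y assume "(y, (TNode f (fst v) 0, snd v)) \<in> test_flow x"
      thus "y \<in> Wellfounded.acc (test_flow x)"
      proof (cases rule: test_flow_cases)
        case (enter f q i a b p c d)
        have v: "v = (p, a, b)" using enter by (cases v) auto
        have "(TNode f q i, a + c, b + d) \<in> Wellfounded.acc (test_flow x)"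
          using acc_Node[of "(q, a + c, b + d)" x f i] less[of "(q, a + c, b + d)"] enter(4) v by simp
        from acc_Try[OF this enter(3)] show ?thesis using enter(1) by simp
      qed simp_all
    qed
  qed
  have nodes: "(TNode f q i, a, b) \<in> Wellfounded.acc (test_flow x)" for f q i a b
    using acc_Node[of "(q, a, b)"] root[of _ "(q, a, b)"] by simp
  fix w :: "'q loop_state \<times> int \<times> int"
  obtain r a b where w: "w = (r, a, b)" by (cases w)
  show "w \<in> Wellfounded.acc (test_flow x)"
  proof (cases r)
    case (TMain q)
    hence "(v, w) \<notin> test_flow x" for v by (simp add: test_flow_def test_def w)
    thus ?thesis by (meson accI)
  next
    case (TNode f q i)
    thus ?thesis using nodes w by simp
  next
    case (TTry f q i)
    obtain p c d where k: "ks ! i = (p, c, d)" by (cases "ks ! i")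
    thus ?thesis using acc_Try[OF nodes k, of f q "a + c" "b + d"] w TTry by simp
  qed
qed

text \<open>The distance to a stuck configuration is unique, hence a backward path from it never
  repeats a configuration.\<close>

lemma relpow_stuck:
  assumes "(w, u) \<in> steps_a x ^^ k" "(w, u) \<in> steps_a x ^^ l" "step_a x u = None"
  shows "k = l"
  using assms(1,2)
proof (induction k arbitrary: w l)
  case 0
  hence wu: "w = u" by simp
  have False if l: "l = Suc l'" for l'
  proof -
    obtain w' where "(w, w') \<in> steps_a x" using relpow_Suc_D2[of w u l' "steps_a x"] 0(2) l by blast
    thus False using wu assms(3) by (auto simp: stp_def)
  qed
  thus ?case by (cases l) auto
next
  case (Suc k)
  obtain w' where w': "(w, w') \<in> steps_a x" "(w', u) \<in> steps_a x ^^ k" using relpow_Suc_D2[OF Suc(2)] by blast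
  note IH = Suc(1)[OF w'(2)] and l = Suc(3)
  show ?case
  proof (cases l)
    case 0
    thus ?thesis using l w'(1) assms(3) by (simp add: stp_def)
  next
    case (Suc l')
    obtain w'' where w'': "(w, w'') \<in> steps_a x" "(w'', u) \<in> steps_a x ^^ l'" using relpow_Suc_D2[OF l[unfolded Suc]] by blast
    have "w'' = w'" using w'(1) w''(1) by (auto simp: stp_def)
    thus ?thesis using IH[of l'] w''(2) Suc by simp
  qed
qed

text \<open>An infinite backward path eventually avoids counter value 0; from there on the flag of a test
  can no longer be raised, so no test is completed and the path would cycle without meeting a marked node.\<close>
lemma halting_acc:
  assumes "step_a x u = None"
  shows "u \<in> Wellfounded.acc (steps_a x)"
proof -
  define H where "H = {w. (w, u) \<in> (steps_a x)\<^sup>*}"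
  define r where "r = {(w, v) \<in> steps_a x. v \<in> H}"
  have "wf r"
  proof (rule ccontr)
    assume "\<not> wf r"
    then obtain F where F: "\<And>i. (F (Suc i), F i) \<in> r" unfolding wf_iff_no_infinite_down_chain by blast
    have FS: "(F (Suc i), F i) \<in> steps_a x" for i using F by (auto simp: r_def)
    have Fv: "F i \<in> vconf Qa x" for i using FS[of i] stp_vconf[OF good_a] by blast
    have "(F 0, u) \<in> (steps_a x)\<^sup>*" using F[of 0] by (auto simp: r_def H_def)
    from rtrancl_imp_relpow[OF this] obtain k0 where k0: "(F 0, u) \<in> steps_a x ^^ k0" by blast
    have kF: "(F i, u) \<in> steps_a x ^^ (k0 + i)" for i
    proof (induction i)
      case (Suc i)
      thus ?case using relpow_Suc_I2[OF FS] by simp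
    qed (use k0 in simp)
    have inj: "inj F"
    proof (rule injI)
      fix i j assume "F i = F j"
      thus "i = j" using relpow_stuck[OF kF[of i] _ assms, of "k0 + j"] kF[of j] by simp
    qed
    \<comment> \<open>The configurations with counter 0: a finite set, which the injective
      \<open>F\<close> visits for the last time before some index \<open>I\<close>.\<close>
    define Z where "Z = Qa \<times> {0 :: int} \<times> {0..int (length x) + 1}"
    have "finite Z" using good_a by (auto simp: Z_def good_def)
    hence "finite (F -` Z)" using inj by (rule finite_vimageI)
    then obtain I where I: "\<And>i. i \<in> F -` Z \<Longrightarrow> i < I" using finite_nat_set_iff_bounded[of "F -` Z"] by blast
    have nz: "fst (snd (F i)) \<noteq> 0" if "I \<le> i" for i
    proof
      assume "fst (snd (F i)) = 0"
      hence "F i \<in> Z" using Fv[of i] by (cases "F i") (auto simp: Z_def vconf_iff)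
      thus False using I[of i] that by simp
    qed
    have main_inf: "\<exists>j\<ge>i. \<not> test (F j)" for i
    proof (rule ccontr)
      assume "\<not> ?thesis"
      hence t: "test (F (i + j))" for j by simp
      have "(F (i + Suc j), F (i + j)) \<in> test_flow x" for j using FS[of "i + j"] t[of j] t[of "Suc j"] by (simp add: test_flow_def)
      hence "\<exists>f. \<forall>j. (f (Suc j), f j) \<in> test_flow x" by (intro exI[of _ "\<lambda>j. F (i + j)"]) blast
      thus False using wf_test_flow unfolding wf_iff_no_infinite_down_chain by blast
    qed
    have main_Suc: "\<not> test (F (Suc i))" if i: "I \<le> i" "\<not> test (F i)" for i
    proof
      assume t: "test (F (Suc i))"
      \<comment> \<open>\<open>F\<close> runs backwards in time: the test that ends on entering
        \<open>F i\<close> was started from \<open>F j\<close>, and its first configuration is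
        \<open>F k\<close>, where the flag is down.\<close>
      define j where "j = (LEAST j. Suc i \<le> j \<and> \<not> test (F j))"
      have "\<exists>j. Suc i \<le> j \<and> \<not> test (F j)" using main_inf by blast
      from LeastI_ex[OF this] have j: "Suc i \<le> j" "\<not> test (F j)" unfolding j_def by auto
      have tj: "test (F l)" if "Suc i \<le> l" "l < j" for l using that not_less_Least[of l] unfolding j_def by blast
      have "j \<noteq> Suc i" using j(2) t by auto
      then obtain k where k: "j = Suc k" "Suc i \<le> k" using j(1) by (cases j) auto
      have "\<not> flag (fst (F k))" using flag_enter[OF FS[of k]] j(2) tj[of k] k by auto
      have "\<not> flag (fst (F (Suc i)))"
        using k(2)
      proof (induction rule: inc_induct)
        case base
        show ?case using \<open>\<not> flag (fst (F k))\<close> .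
      next
        case (step l)
        thus ?case using flag_step[OF FS[of l]] tj[of l] tj[of "Suc l"] nz[of "Suc l"] i(1) k(1) by simp
      qed
      thus False using flag_exit[OF FS[of i]] t i(2) by blast
    qed
    obtain i0 where i0: "I \<le> i0" "\<not> test (F i0)" using main_inf by blast
    have mains: "\<not> test (F (i0 + j))" for j
    proof (induction j)
      case (Suc j)
      thus ?case using main_Suc[of "i0 + j"] i0(1) by simp
    qed (use i0 in simp)
    have "(node (F (i0 + Suc j)), node (F (i0 + j))) \<in> unmarked_flow x" for j
      using main_step[OF FS[of "i0 + j"]] mains[of j] mains[of "Suc j"] nz[of "i0 + Suc j"] i0(1) by simp
    hence "\<exists>f. \<forall>j. (f (Suc j), f j) \<in> unmarked_flow x" by (intro exI[of _ "\<lambda>j. node (F (i0 + j))"]) blast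
    thus False using wf_unmarked(1) unfolding wf_iff_no_infinite_down_chain by blast
  qed
  have "w \<in> H \<Longrightarrow> w \<in> Wellfounded.acc (steps_a x)" for w
    using \<open>wf r\<close>
  proof (induction w rule: wf_induct_rule)
    case (less w)
    show ?case
    proof (rule accI)
      fix v assume "(v, w) \<in> steps_a x"
      moreover from this have "v \<in> H" using less(2) unfolding H_def by (auto intro: converse_rtrancl_into_rtrancl)
      ultimately show "v \<in> Wellfounded.acc (steps_a x)" using less by (auto simp: r_def)
    qed
  qed
  thus ?thesis by (simp add: H_def)
qed

theorem tame_a: "tame \<delta>a Qa (TMain q0) \<gamma>"
  by (rule tameI[OF decides_a]) (use final_stuck[OF decides_a] halting_acc in blast)

end

section \<open>The simulation\<close>

text \<open>\<open>Ini\<close> is needed because the initial state of the given automaton may be a halting one, which counts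
  only when it is entered again.\<close>

datatype 'q nowrap_state = Ini | Md 'q | GoL 'q | GoR 'q

section \<open>Removing the moves across the ends of the tape\<close>

context
  fixes M :: "('q, 'a) dca" and L :: "'a list set"
  assumes valid: "valid_dca M" and rec: "dca_recognizes M L"
begin

text \<open>A move across an end becomes a walk over the whole tape with unchanged counter. The
  state is passed along by \<open>GoL\<close> or \<open>GoR\<close>, so a halting state takes effect
  only when the head has arrived.\<close>

definition unwrap :: "'a tsym \<Rightarrow> 'q \<times> int \<times> dir \<Rightarrow> 'q nowrap_state \<times> int \<times> int" where
  "unwrap \<sigma> = (\<lambda>(q, c, d). if \<sigma> = Dollar \<and> d = Rgt then (GoL q, c, -1)
     else if \<sigma> = Cent \<and> d = Lft then (GoR q, c, 1) else (Md q, c, mu d))"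

definition sg :: "bool \<Rightarrow> nat" where "sg z = (if z then 0 else 1)"

fun \<delta>0 :: "('q nowrap_state, 'a, unit) lmach" where
  "\<delta>0 Ini \<sigma> _ z = Some (unwrap \<sigma> (dtrans M (dinit M) \<sigma> (sg z)))"
| "\<delta>0 (Md q) \<sigma> _ z = (if q \<in> dacc M \<union> drej M then None else Some (unwrap \<sigma> (dtrans M q \<sigma> (sg z))))"
| "\<delta>0 (GoL q) \<sigma> _ z = (if \<sigma> = Cent then Some (Md q, 0, 0) else Some (GoL q, 0, -1))"
| "\<delta>0 (GoR q) \<sigma> _ z = (if \<sigma> = Dollar then Some (Md q, 0, 0) else Some (GoR q, 0, 1))"

definition Q0 :: "'q nowrap_state set" where
  "Q0 = insert Ini (Md ` dstates M \<union> GoL ` dstates M \<union> GoR ` dstates M)"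

lemma Q0_iff [simp]: "Ini \<in> Q0" "Md q \<in> Q0 \<longleftrightarrow> q \<in> dstates M" "GoL q \<in> Q0 \<longleftrightarrow> q \<in> dstates M" "GoR q \<in> Q0 \<longleftrightarrow> q \<in> dstates M"
  by (auto simp: Q0_def)

lemma dtrans_closed: "q \<in> dstates M \<Longrightarrow> dtrans M q \<sigma> (sg z) = (p, c, d) \<Longrightarrow> p \<in> dstates M \<and> c \<in> incs"
proof -
  assume q: "q \<in> dstates M" and k: "dtrans M q \<sigma> (sg z) = (p, c, d)"
  have s: "sg z \<in> {0, 1}" by (simp add: sg_def)
  have "\<forall>q\<in>dstates M. \<forall>\<sigma> s. s \<in> {0,1} \<longrightarrow> (case dtrans M q \<sigma> s of (q', c, d) \<Rightarrow> q' \<in> dstates M \<and> c \<in> incs)"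
    using valid unfolding valid_dca_def by (elim conjE)
  from this[rule_format, OF q s, of \<sigma>] show ?thesis by (simp add: k)
qed

lemma mu_incs: "mu d \<in> incs" by (cases d) (auto simp: incs_def)

lemma unwrap_ok:
  assumes "q \<in> dstates M" "unwrap \<sigma> (dtrans M q \<sigma> (sg z)) = (r, c, d)"
  shows "r \<in> Q0 \<and> c \<in> incs \<and> d \<in> incs \<and> (\<sigma> = Cent \<longrightarrow> d \<noteq> -1) \<and> (\<sigma> = Dollar \<longrightarrow> d \<noteq> 1)"
proof -
  obtain p e f where k: "dtrans M q \<sigma> (sg z) = (p, e, f)" by (cases "dtrans M q \<sigma> (sg z)")
  show ?thesis using dtrans_closed[OF assms(1) k] assms(2) mu_incs[of f]
    by (cases f) (auto simp: k unwrap_def incs_def split: if_splits)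
qed

lemma good0: "good \<delta>0 Q0"
  unfolding good_def
proof (intro conjI ballI allI impI)
  show "finite Q0" using valid by (auto simp: valid_dca_def Q0_def)
next
  fix r \<sigma> \<beta> z r' c d assume r: "r \<in> Q0" "\<delta>0 r \<sigma> \<beta> z = Some (r', c, d)"
  have i: "dinit M \<in> dstates M" using valid by (auto simp: valid_dca_def)
  have "r' \<in> Q0 \<and> c \<in> incs \<and> d \<in> incs \<and> (\<sigma> = Cent \<longrightarrow> d \<noteq> - 1) \<and> (\<sigma> = Dollar \<longrightarrow> d \<noteq> 1)"
    using r i unwrap_ok[of _ \<sigma> z r' c d] by (cases r) (auto simp: incs_def split: if_splits)
  thus "r' \<in> Q0" "c \<in> incs" "d \<in> incs" "\<sigma> = Cent \<Longrightarrow> d \<noteq> - 1" "\<sigma> = Dollar \<Longrightarrow> d \<noteq> 1" by auto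
qed

abbreviation "S0 x \<equiv> stp \<delta>0 Q0 x (\<lambda>_. ())"

lemma walk_left: "k \<le> length x + 1 \<Longrightarrow> q \<in> dstates M \<Longrightarrow> ((GoL q, a, int k), (Md q, a, 0)) \<in> (S0 x)\<^sup>*"
proof (induction k)
  case 0
  have "((GoL q, a, 0), (Md q, a, 0)) \<in> S0 x" using 0 by (auto simp: stp_def vconf_iff gstep_def tape_def)
  thus ?case by auto
next
  case (Suc k)
  have "((GoL q, a, int (Suc k)), (GoL q, a, int k)) \<in> S0 x"
    using Suc by (auto simp: stp_def vconf_iff gstep_def tape_def)
  thus ?case using Suc by (meson Suc_leD converse_rtrancl_into_rtrancl)
qed

lemma walk_right:
  assumes "k \<le> length x + 1" "q \<in> dstates M"
  shows "((GoR q, a, int (length x + 1) - int k), (Md q, a, int (length x + 1))) \<in> (S0 x)\<^sup>*"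
  using assms
proof (induction k)
  case 0
  have "((GoR q, a, int (length x + 1)), (Md q, a, int (length x + 1))) \<in> S0 x"
    using 0 tape_Dollar_iff[of "int (length x + 1)" x] by (auto simp: stp_def vconf_iff gstep_def)
  thus ?case by auto
next
  case (Suc k)
  have "((GoR q, a, int (length x + 1) - int (Suc k)), (GoR q, a, int (length x + 1) - int k)) \<in> S0 x"
    using Suc tape_Dollar_iff[of "int (length x) - int k" x] by (auto simp: stp_def vconf_iff gstep_def)
  thus ?case using Suc by (meson Suc_leD converse_rtrancl_into_rtrancl)
qed

lemma dstep_sim:
  assumes r: "r = Md q \<and> q \<notin> dacc M \<union> drej M \<or> r = Ini \<and> q = dinit M" and q: "q \<in> dstates M" "b \<le> length x + 1"
    and st: "dstep M x (q, a, b) = (q', a', b')"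
  shows "((r, a, int b), (Md q', a', int b')) \<in> (S0 x)\<^sup>* \<and> q' \<in> dstates M \<and> b' \<le> length x + 1"
proof -
  let ?\<sigma> = "tape x b"
  have sg: "sg (a = 0) = sgnc a" by (simp add: sg_def sgnc_def)
  obtain p c d where k: "dtrans M q ?\<sigma> (sgnc a) = (p, c, d)" by (cases "dtrans M q ?\<sigma> (sgnc a)")
  have s: "q' = p" "a' = a + c" "b' = move x b (mu d)" using st k by (auto simp: dstep_def)
  have p: "p \<in> dstates M" using dtrans_closed[OF q(1), of ?\<sigma> "a = 0"] k by (simp add: sg)
  have b': "b' \<le> length x + 1"
  proof -
    have "(int b + mu d) mod int (length x + 2) < int (length x + 2)" by (intro pos_mod_bound) simp
    thus ?thesis unfolding s move_def by linarith
  qed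
  have rQ: "r \<in> Q0" using r q by auto
  have first: "((r, a, int b), (r', a + c', int b + d')) \<in> S0 x" if "unwrap ?\<sigma> (p, c, d) = (r', c', d')" for r' c' d'
    using that r q rQ k sg by (auto simp: stp_def vconf_iff gstep_def)
  have tC: "?\<sigma> = Cent \<longleftrightarrow> b = 0" and tD: "?\<sigma> = Dollar \<longleftrightarrow> b = length x + 1" by (auto simp: tape_def)
  consider "?\<sigma> = Dollar" "d = Rgt" | "?\<sigma> = Cent" "d = Lft" | "\<not> (?\<sigma> = Dollar \<and> d = Rgt)" "\<not> (?\<sigma> = Cent \<and> d = Lft)" by blast
  hence "((r, a, int b), (Md q', a', int b')) \<in> (S0 x)\<^sup>*"
  proof cases
    case 1
    have "b = length x + 1" using 1 tD by simp
    hence "b' = 0" using 1 by (simp add: s move_def)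
    have "((r, a, int b), (GoL p, a', int (length x))) \<in> S0 x" using first[of "GoL p" c "-1"] 1 tD by (simp add: unwrap_def s)
    thus ?thesis using walk_left[of "length x" x p a'] p \<open>b' = 0\<close> by (auto simp: s intro: converse_rtrancl_into_rtrancl)
  next
    case 2
    have "b' = length x + 1" using 2 tC by (simp add: s move_def zmod_minus1)
    moreover have "((r, a, int b), (GoR p, a', 1)) \<in> S0 x" using first[of "GoR p" c 1] 2 tC by (simp add: unwrap_def s)
    ultimately show ?thesis using walk_right[of "length x" x p a'] p by (auto simp: s intro: converse_rtrancl_into_rtrancl)
  next
    case 3
    have "0 \<le> int b + mu d" "int b + mu d \<le> int (length x) + 1" using 3 tC tD q(2) by (cases d; auto)+
    hence "int b' = int b + mu d" by (simp add: s move_def)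
    moreover have "unwrap ?\<sigma> (p, c, d) = (Md p, c, mu d)" using 3 by (auto simp: unwrap_def)
    ultimately show ?thesis using first[of "Md p" c "mu d"] by (auto simp: s)
  qed
  thus ?thesis using p b' s by simp
qed

theorem decides0: "decides \<delta>0 Q0 Ini (Md ` dacc M) (Md ` drej M) (\<lambda>_ _. ()) L"
  unfolding decides_def
proof (intro conjI ballI allI)
  show "Md ` dacc M \<subseteq> Q0" "Md ` drej M \<subseteq> Q0" "Md ` dacc M \<inter> Md ` drej M = {}"
    using valid by (auto simp: valid_dca_def)
  show "\<delta>0 q \<sigma> \<beta> z = None" if "q \<in> Md ` dacc M \<union> Md ` drej M" for q \<sigma> \<beta> z using that by auto
  fix x
  define T where "T = (LEAST t. dhalted_at M x t)"
  have ex: "\<exists>t. dhalted_at M x t" using rec by (auto simp: dca_recognizes_def)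
  have T: "dhalted_at M x T" using LeastI_ex[OF ex] by (simp add: T_def)
  have nT: "\<not> dhalted_at M x t" if "t < T" for t using that not_less_Least by (auto simp: T_def)
  have acc: "x \<in> L \<longleftrightarrow> fst (dconf M x T) \<in> dacc M" using rec by (auto simp: dca_recognizes_def T_def)
  \<comment> \<open>The correspondence starts at time 1, because at time 0 the simulating state is
    \<open>Ini\<close> instead of \<open>Md\<close>.\<close>
  have sim: "Suc t \<le> T \<Longrightarrow> (case dconf M x (Suc t) of (q, a, b) \<Rightarrow> ((Ini, 0, 0), (Md q, a, int b)) \<in> (S0 x)\<^sup>* \<and> q \<in> dstates M \<and> b \<le> length x + 1)" for t
  proof (induction t)
    case 0
    obtain q a b where k: "dstep M x (dinit M, 0, 0) = (q, a, b)" by (cases "dstep M x (dinit M, 0, 0)")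
    have "dinit M \<in> dstates M" using valid by (auto simp: valid_dca_def)
    thus ?case using dstep_sim[OF _ _ _ k, of Ini] k by (auto simp: dconf_def)
  next
    case (Suc t)
    obtain q a b where k: "dconf M x (Suc t) = (q, a, b)" by (cases "dconf M x (Suc t)")
    obtain q' a' b' where k': "dstep M x (q, a, b) = (q', a', b')" by (cases "dstep M x (q, a, b)")
    have "dconf M x (Suc (Suc t)) = (q', a', b')" using k k' by (simp add: dconf_def)
    moreover have "q \<notin> dacc M \<union> drej M" using nT[of "Suc t"] Suc(2) k by (auto simp: dhalted_at_def)
    ultimately show ?case using dstep_sim[OF _ _ _ k', of "Md q"] Suc k by (auto intro: rtrancl_trans)
  qed
  obtain t where t: "T = Suc t" using T by (cases T) (auto simp: dhalted_at_def)
  obtain q a b where k: "dconf M x T = (q, a, b)" by (cases "dconf M x T")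
  have "((Ini, 0, 0), (Md q, a, int b)) \<in> (S0 x)\<^sup>*" using sim[of t] t k by simp
  moreover have "q \<in> (if x \<in> L then dacc M else drej M)" using acc T k by (auto simp: dhalted_at_def)
  ultimately show "\<exists>u. ((Ini, 0, 0), u) \<in> (S0 x)\<^sup>* \<and> fst u \<in> (if x \<in> L then Md ` dacc M else Md ` drej M)"
    by (intro exI[of _ "(Md q, a, int b)"]) auto
qed (use good0 in auto)

section \<open>Composition of the constructions\<close>

theorem reversible_simulation:
  "\<exists>M' :: (nat, 'a) qca. is_2R1CA M' \<and> is_simple M' \<and>
     (\<forall>x. (x \<in> L \<longrightarrow> acc_step M' x sums 1) \<and> (x \<notin> L \<longrightarrow> rej_step M' x sums 1))"
proof -
  have moves: "\<exists>ks. set ks = Q \<times> incs \<times> incs \<and> distinct ks" if "finite Q" for Q :: "'s set"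
    using finite_distinct_list[of "Q \<times> incs \<times> incs"] that by simp
  have fin: "finite Q0" using good0 by (simp add: good_def)
  obtain ks where ks: "set ks = Q0 \<times> incs \<times> incs" "distinct ks" using moves[OF fin] by blast
  obtain ord :: "'q nowrap_state \<Rightarrow> nat" where "inj_on ord Q0" using finite_imp_inj_to_nat_seg[OF fin] by blast
  then interpret l: loops \<delta>0 Q0 Ini "Md ` dacc M" "Md ` drej M" L ks ord
    by unfold_locales (use decides0 ks in auto)
  \<comment> \<open>Nothing lies to the right of the right end-marker, so the automaton of crossing
    tables starts with the empty table.\<close>
  interpret a: annotated l.\<delta>a l.Qa "TMain Ini" "l.mains (Md ` dacc M)" "l.mains (Md ` drej M)" L l.\<gamma> l.g "{}" "Pow (Q0 \<times> Q0)"
    by unfold_locales (use l.decides_a l.tame_a fin l.g_sub l.\<gamma>_end l.\<gamma>_step in auto)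
  have "finite a.Q1" using a.good1 by (simp add: good_def)
  then obtain ks1 where ks1: "set ks1 = a.Q1 \<times> incs \<times> incs" "distinct ks1" using moves by blast
  interpret t: tour a.\<delta>1 a.Q1 GoEnd "a.final1 (l.mains (Md ` dacc M))" "a.final1 (l.mains (Md ` drej M))" L ks1
    by unfold_locales (use a.decides1 a.tame1 ks1 in auto)
  show ?thesis by (rule t.simulation)
qed

end

theorem theorem12:
  fixes M :: "('q, 'a :: finite) dca" and L :: "'a list set"
  assumes "valid_dca M" and "dca_recognizes M L"
  shows "\<exists>M' :: (nat, 'a) qca. is_2R1CA M' \<and> is_simple M' \<and>
           (\<forall>x. (x \<in> L \<longrightarrow> acc_step M' x sums 1) \<and> (x \<notin> L \<longrightarrow> rej_step M' x sums 1))"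
  using assms by (rule reversible_simulation)

end
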